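(* Let $n\geq2$, let $\mathcal R$ be a potential class of resolvent type, with associated function $[\,\cdot\,]_{\mathcal R}$, and let $S_r^n$ be a sphere in $\mathbb R^{n+1}$ with radius $r$. Assume that $u\in\mathcal H^1_t(\mathcal L_2)\cap\mathcal H^2_x(\mathcal L_2)$ is a solution of the Schrödinger inequality $$|(i\partial_t+\Delta)u(x,t)|\leq|V(x)u(x,t)|$$ with $V\in\mathcal R$, and that $u$ vanishes on an exterior neighborhood of $S_r^n$ in a neighborhood of a point $p\in S_r^n$. Let $\nu$ be the unit outward normal vector of $S_r^n$ at $p$. Then it follows that $u\equiv0$ in a neighborhood of $p$, if $|V|\in A_2(\nu')$ and $[V]_{\mathcal R}<\varepsilon$ for a sufficiently small $\varepsilon>0$.
   Context: Here $u:\mathbb R^{n+1}\to\mathbb C$ is a function of $(x,t)\in\mathbb R^n\times\mathbb R$, $V:\mathbb R^n\to\mathbb C$ is a potential, and $\Delta$ is the Laplacian in $x$. $L^2(w)$ denotes the $L^2$ space with respect to the measure $w\,dx$. Resolvent type: a potential class $\mathcal R$ is of resolvent type if there exists a suitable function $[\,\cdot\,]_{\mathcal R}$, depending only on $\mathcal R$ itself, such that for $V\in\mathcal R$ the resolvent estimate $\|(-\Delta-z)^{-1}f\|_{L^2(|V|)}\leq C(V)\|f\|_{L^2(|V|^{-1})}$, $z\in\mathbb C\setminus\mathbb R$, with $C(V)$ independent of $z$, holds with bound $C(V)=[V]_{\mathcal R}$. If $|V_1|\leq|V_2|$ and the estimate holds for $V_2$, then it also holds for $V_1$ with $C(V_1)=C(V_2)$,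 and in this case $[V_1]_{\mathcal R}$ is taken to be at most $[V_2]_{\mathcal R}$. Solution space: $\mathcal L_2=L^2\cap L^2(|V|^{-1})$ (for functions on $\mathbb R^{n+1}$, with the weight depending on $x$ only); $\mathcal H^1_t(\mathcal L_2)$ is the space of functions whose derivatives up to order $1$ with respect to $t$ belong to $\mathcal L_2$, and $\mathcal H^2_x(\mathcal L_2)$ is the space of functions whose derivatives up to order $2$ with respect to $x$ belong to $\mathcal L_2$. "$u$ vanishes on an exterior neighborhood of $S_r^n$ in a neighborhood of $p$" means that there is a neighborhood $\mathcal N$ of $p$ in $\mathbb R^{n+1}$ such that $u=0$ at the points of $\mathcal N$ lying outside the sphere. For $\nu=(\nu_1,\dots,\nu_n,\nu_{n+1})$, $\nu'=(\nu_1,\dots,\nu_n)\in\mathbb R^n$. Directional $A_2$: a weight is a locally integrable function with values in $[0,\infty]$ which is allowed to be zero or infinite only on a set of Lebesgue measure zero. A weight $w$ on $\mathbb R$ is in $A_2(\mathbb R)$ if there is a constant $C_{A_2}$ with $\sup_I\big(\frac1{|I|}\int_Iw\big)\big(\frac1{|I|}\int_Iw^{-1}\big)<C_{A_2}$, the supremum being over intervals $I$. Given $v\in\mathbb R^n$, write $x=sv+\widetilde x$ with $s\in\mathbb R$ and $\widetilde x$ in a hyperplane $\mathcal P$ whose normal vector is $v$; then $w\in A_2(v)$ means that the function $w_{\widetilde x}(s):=w(x)$ is in $A_2(\mathbb R)$ with $C_{A_2}$ uniform in almost every $\widetilde x\in\mathcal P$. *)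

theory Defs
  imports "HOL-Analysis.Analysis"
begin

section \<open>Weak derivatives\<close>

fun Ck :: "nat \<Rightarrow> ('a::euclidean_space \<Rightarrow> real) \<Rightarrow> bool" where
  "Ck 0 \<phi> \<longleftrightarrow> continuous_on UNIV \<phi>"
| "Ck (Suc k) \<phi> \<longleftrightarrow> (\<forall>x. \<phi> differentiable (at x)) \<and>
     (\<forall>b\<in>Basis. Ck k (\<lambda>x. frechet_derivative \<phi> (at x) b))"

definition test_function :: "('a::euclidean_space \<Rightarrow> real) \<Rightarrow> bool" where
  "test_function \<phi> \<longleftrightarrow> (\<forall>k. Ck k \<phi>) \<and> compact (closure {x. \<phi> x \<noteq> 0})"

definition loc_integrable :: "('a::euclidean_space \<Rightarrow> complex) \<Rightarrow> bool" where
  "loc_integrable f \<longleftrightarrow> (\<forall>K. compact K \<longrightarrow> set_integrable lebesgue K f)"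

definition has_weak_deriv ::
    "('a::euclidean_space \<Rightarrow> complex) \<Rightarrow> ('a \<Rightarrow> complex) \<Rightarrow> 'a \<Rightarrow> bool" where
  "has_weak_deriv f g b \<longleftrightarrow> loc_integrable f \<and> loc_integrable g \<and>
     (\<forall>\<phi>. test_function \<phi> \<longrightarrow>
        (LINT x|lebesgue. frechet_derivative \<phi> (at x) b *\<^sub>R f x) =
        - (LINT x|lebesgue. \<phi> x *\<^sub>R g x))"

text \<open>A weak derivative is only unique up to a null set; \<open>wderiv b f\<close> is some representative.\<close>

definition wderiv ::
    "'a::euclidean_space \<Rightarrow> ('a \<Rightarrow> complex) \<Rightarrow> 'a \<Rightarrow> complex" where
  "wderiv b f = (SOME g. has_weak_deriv f g b)"

text \<open>The functions whose weak derivatives up to order \<open>k\<close> in the directions \<open>B\<close>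
  (including the function itself) belong to the function space \<open>X\<close>.\<close>

fun sobolev ::
    "'a::euclidean_space set \<Rightarrow> nat \<Rightarrow> ('a \<Rightarrow> complex) set \<Rightarrow> ('a \<Rightarrow> complex) set" where
  "sobolev B 0 X = X"
| "sobolev B (Suc k) X =
     {f \<in> X. \<forall>b\<in>B. (\<exists>g. has_weak_deriv f g b) \<and> wderiv b f \<in> sobolev B k X}"

section \<open>Weighted spaces and potential classes of resolvent type\<close>

definition L2 :: "'a measure \<Rightarrow> ('a \<Rightarrow> complex) set" where
  "L2 M = {f \<in> borel_measurable M. integrable M (\<lambda>x. (cmod (f x))\<^sup>2)}"

definition L2_norm :: "'a measure \<Rightarrow> ('a \<Rightarrow> complex) \<Rightarrow> real" where
  "L2_norm M f = sqrt (LINT x|M. (cmod (f x))\<^sup>2)"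

text \<open>The measures \<open>|V| dx\<close> and \<open>|V|\<^sup>-\<^sup>1 dx\<close>. Since \<open>inverse 0 = \<infinity>\<close> in \<^typ>\<open>ennreal\<close>, a function
  that is square integrable for the latter vanishes almost everywhere on the zero set of \<open>V\<close>.\<close>

definition pot_measure :: "('a::euclidean_space \<Rightarrow> complex) \<Rightarrow> 'a measure" where
  "pot_measure V = density lebesgue (\<lambda>x. ennreal (cmod (V x)))"

definition inv_pot_measure :: "('a::euclidean_space \<Rightarrow> complex) \<Rightarrow> 'a measure" where
  "inv_pot_measure V = density lebesgue (\<lambda>x. inverse (ennreal (cmod (V x))))"

definition laplacian :: "('a::euclidean_space \<Rightarrow> complex) \<Rightarrow> 'a \<Rightarrow> complex" where
  "laplacian f x = (\<Sum>b\<in>Basis. wderiv b (wderiv b f) x)"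

text \<open>\<open>g = (-\<Delta> - z)\<^sup>-\<^sup>1 f\<close>, where \<open>-\<Delta>\<close> is the operator on \<open>L\<^sup>2\<close> with domain \<open>H\<^sup>2\<close>.\<close>

definition is_resolvent ::
    "complex \<Rightarrow> ('a::euclidean_space \<Rightarrow> complex) \<Rightarrow> ('a \<Rightarrow> complex) \<Rightarrow> bool" where
  "is_resolvent z f g \<longleftrightarrow> g \<in> sobolev Basis 2 (L2 lebesgue) \<and>
     (AE x in lebesgue. - laplacian g x - z * g x = f x)"

definition resolvent_estimate ::
    "('a::euclidean_space \<Rightarrow> complex) \<Rightarrow> real \<Rightarrow> bool" where
  "resolvent_estimate V C \<longleftrightarrow>
     (\<forall>z f g. z \<notin> \<real> \<longrightarrow> f \<in> L2 lebesgue \<inter> L2 (inv_pot_measure V) \<longrightarrow> is_resolvent z f g \<longrightarrow>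
        g \<in> L2 (pot_measure V) \<and>
        L2_norm (pot_measure V) g \<le> C * L2_norm (inv_pot_measure V) f)"

definition resolvent_type ::
    "('a::euclidean_space \<Rightarrow> complex) set \<Rightarrow> (('a \<Rightarrow> complex) \<Rightarrow> real) \<Rightarrow> bool" where
  "resolvent_type R br \<longleftrightarrow>
     (\<forall>V\<in>R. V \<in> borel_measurable lebesgue \<and> resolvent_estimate V (br V)) \<and>
     (\<forall>V1\<in>R. \<forall>V2\<in>R. (AE x in lebesgue. cmod (V1 x) \<le> cmod (V2 x)) \<longrightarrow> br V1 \<le> br V2)"

section \<open>Directional Muckenhoupt weights\<close>

definition weight :: "('a::euclidean_space \<Rightarrow> ennreal) \<Rightarrow> bool" where
  "weight w \<longleftrightarrow> w \<in> borel_measurable lebesgue \<and>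
     (\<forall>K. compact K \<longrightarrow> (\<integral>\<^sup>+x\<in>K. w x \<partial>lebesgue) < \<infinity>) \<and>
     (AE x in lebesgue. w x \<noteq> 0 \<and> w x \<noteq> \<infinity>)"

definition average :: "(real \<Rightarrow> ennreal) \<Rightarrow> real \<Rightarrow> real \<Rightarrow> ennreal" where
  "average w a b = (\<integral>\<^sup>+s\<in>{a..b}. w s \<partial>lebesgue) / ennreal (b - a)"

text \<open>\<open>C\<close> is an admissible constant \<open>C\<^sub>A\<^sub>2\<close> in the definition of \<open>A\<^sub>2(\<real>)\<close>.\<close>

definition A2_line :: "real \<Rightarrow> (real \<Rightarrow> ennreal) \<Rightarrow> bool" where
  "A2_line C w \<longleftrightarrow> weight w \<and>
     (SUP (a, b) \<in> {(a, b). a < b}. average w a b * average (\<lambda>s. inverse (w s)) a b) < ennreal C"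

text \<open>\<open>w \<in> A\<^sub>2(v)\<close> with constant \<open>C\<close>. A set of points of the hyperplane \<open>{y. y \<bullet> v = 0}\<close> is null for
  the Lebesgue measure of the hyperplane iff the cylinder over it in direction \<open>v\<close> is null in the
  full space; so ``almost every point of the hyperplane'' is expressed as ``the foot \<open>x'\<close> of almost
  every \<open>x\<close>''. For \<open>v = 0\<close> one has \<open>x' = x\<close> and the sliced weights are constant.\<close>

definition A2_dir :: "real \<Rightarrow> 'a::euclidean_space \<Rightarrow> ('a \<Rightarrow> ennreal) \<Rightarrow> bool" where
  "A2_dir C v w \<longleftrightarrow> weight w \<and>
     (AE x in lebesgue. let x' = x - ((x \<bullet> v) / (v \<bullet> v)) *\<^sub>R v in A2_line C (\<lambda>s. w (s *\<^sub>R v + x')))"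

section \<open>The Schroedinger inequality in space-time\<close>

text \<open>Space-time \<open>\<real>\<^sup>n\<^sup>+\<^sup>1\<close> is \<open>'a \<times> real\<close> with \<open>'a = \<real>\<^sup>n\<close>; the product norm is the Euclidean one.\<close>

definition time_dir :: "'a::euclidean_space \<times> real" where
  "time_dir = (0, 1)"

definition space_dirs :: "('a::euclidean_space \<times> real) set" where
  "space_dirs = (\<lambda>b. (b, 0)) ` Basis"

definition sol_L2 :: "('a::euclidean_space \<Rightarrow> complex) \<Rightarrow> ('a \<times> real \<Rightarrow> complex) set" where
  "sol_L2 V = L2 lebesgue \<inter> L2 (inv_pot_measure (\<lambda>y. V (fst y)))"

definition H1_t ::
    "('a::euclidean_space \<times> real \<Rightarrow> complex) set \<Rightarrow> ('a \<times> real \<Rightarrow> complex) set" where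
  "H1_t X = sobolev {time_dir} 1 X"

definition H2_x ::
    "('a::euclidean_space \<times> real \<Rightarrow> complex) set \<Rightarrow> ('a \<times> real \<Rightarrow> complex) set" where
  "H2_x X = sobolev space_dirs 2 X"

definition schroedinger_op ::
    "('a::euclidean_space \<times> real \<Rightarrow> complex) \<Rightarrow> 'a \<times> real \<Rightarrow> complex" where
  "schroedinger_op u y =
     \<i> * wderiv time_dir u y + (\<Sum>e\<in>space_dirs. wderiv e (wderiv e u) y)"

text \<open>Elements of \<open>L\<^sup>2\<close> are determined up to null sets, so equalities and inequalities between
  them are understood almost everywhere.\<close>

definition schroedinger_ineq ::
    "('a::euclidean_space \<Rightarrow> complex) \<Rightarrow> ('a \<times> real \<Rightarrow> complex) \<Rightarrow> bool" where
  "schroedinger_ineq V u \<longleftrightarrow>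
     (AE (x, t) in lebesgue. cmod (schroedinger_op u (x, t)) \<le> cmod (V x * u (x, t)))"

definition vanishes_near :: "('b::euclidean_space \<Rightarrow> complex) \<Rightarrow> 'b \<Rightarrow> bool" where
  "vanishes_near u p \<longleftrightarrow>
     (\<exists>N. open N \<and> p \<in> N \<and> (AE y in lebesgue. y \<in> N \<longrightarrow> u y = 0))"

definition vanishes_outside_near ::
    "('b::euclidean_space \<Rightarrow> complex) \<Rightarrow> 'b \<Rightarrow> real \<Rightarrow> 'b \<Rightarrow> bool" where
  "vanishes_outside_near u c r p \<longleftrightarrow>
     (\<exists>N. open N \<and> p \<in> N \<and> (AE y in lebesgue. y \<in> N \<and> r < dist c y \<longrightarrow> u y = 0))"

definition outward_normal :: "'b::euclidean_space \<Rightarrow> real \<Rightarrow> 'b \<Rightarrow> 'b" where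
  "outward_normal c r p = (1 / r) *\<^sub>R (p - c)"

end

theory Submission
  imports Defs "HOL-Computational_Algebra.Polynomial"
begin

text \<open>Both the solution space and the inequality are global in space-time, so a solution vanishes
  identically once the resolvent constant is small. Cut \<open>u\<close> off in time by \<open>\<eta>(t/n)\<close> and expand it in a
  Fourier series in \<open>t\<close>: every coefficient solves a resolvent equation in \<open>x\<close>, and summing the resolvent
  estimates over all frequencies gives
  \<open>\<parallel>\<eta> u\<parallel>\<^sup>2 \<le> c [V]\<^sup>2 \<parallel>\<eta> F + \<i> \<eta>' u\<parallel>\<^sup>2\<close> with \<open>F = (\<i>\<partial>\<^sub>t + \<Delta>)u\<close>, where the left norm is that of
  \<open>L\<^sup>2(|V|)\<close> and the right one that of \<open>L\<^sup>2(|V|\<^sup>-\<^sup>1)\<close>. Since \<open>|F| \<le> |V u|\<close>, the term \<open>\<eta> F\<close> is absorbed on the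
  left if \<open>[V]\<close> is small, and what remains is of order \<open>1/n\<^sup>2\<close>. As the weight \<open>|V|\<close> is positive almost
  everywhere, \<open>u = 0\<close>.\<close>

section \<open>Test functions\<close>

text \<open>The time expansion is compatible with the estimate because the weight depends on x alone
  and the resolvent bound is uniform in the spectral parameter, so every frequency has the same
  constant. Coefficient sums are compared with time integrals by two-sided bounds whose quotient is
  4, whatever the length of the interval; the loss is paid by smallness. This fixes the threshold
  1/8: its square becomes 1/32 when the error of the shifted spectral parameter is split off, 1/8 by
  the quotient 4, and 1/4 by splitting \<open>\<eta> F + \<i> \<eta>' u\<close>. Cancelling the
  absorbed term requires it to be finite, which follows from weighted integrability of
  \<open>u\<close> and its derivatives. The technical obstacle is that \<open>wderiv\<close> and the
  spaces fix functions only up to Lebesgue null sets, while slicing in time rests on Fubini and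
  joint Borel measurability. All data are therefore replaced by Borel representatives, and
  uniqueness of weak derivatives leads back to the chosen ones.\<close>

lemma frechet_derivative_eqI: "(f has_derivative D) (at x) \<Longrightarrow> frechet_derivative f (at x) = D"
  using frechet_derivative_at by metis

lemma frechet_derivative_has_derivative:
  "f differentiable (at x) \<Longrightarrow> (f has_derivative frechet_derivative f (at x)) (at x)"
  by (simp add: frechet_derivative_works)

lemma Ck_Suc_imp: "Ck (Suc k) f \<Longrightarrow> Ck k f"
proof (induction k arbitrary: f)
  case 0
  then show ?case
    by (auto intro!: continuous_at_imp_continuous_on differentiable_imp_continuous_within)
next
  case (Suc k)
  then show ?case by (metis Ck.simps(2))
qed

lemma Ck_SucI:
  assumes "\<And>x. (f has_derivative D x) (at x)" "\<And>b. b \<in> Basis \<Longrightarrow> Ck k (\<lambda>x. D x b)"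
  shows "Ck (Suc k) f"
proof -
  have "frechet_derivative f (at x) = D x" for x
    using assms(1) by (rule frechet_derivative_eqI)
  with assms show ?thesis by (auto simp: differentiable_def)
qed

lemma Ck_SucD:
  assumes "Ck (Suc k) f"
  shows "(f has_derivative frechet_derivative f (at x)) (at x)"
    "b \<in> Basis \<Longrightarrow> Ck k (\<lambda>x. frechet_derivative f (at x) b)"
  using assms by (auto simp: frechet_derivative_has_derivative)

lemma Ck_const: "Ck k (\<lambda>x. c)"
proof (induction k arbitrary: c)
  case (Suc k)
  show ?case by (rule Ck_SucI[where D = "\<lambda>_ _. 0"]) (auto simp: Suc)
qed auto

lemma Ck_add: "Ck k f \<Longrightarrow> Ck k g \<Longrightarrow> Ck k (\<lambda>x. f x + g x)"
proof (induction k arbitrary: f g)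
  case 0 then show ?case by (auto intro: continuous_intros)
next
  case (Suc k)
  show ?case
    by (rule Ck_SucI[OF has_derivative_add[OF Ck_SucD(1)[OF Suc.prems(1)] Ck_SucD(1)[OF Suc.prems(2)]]])
       (use Suc.IH Ck_SucD(2) Suc.prems in blast)
qed

lemma Ck_mult: "Ck k f \<Longrightarrow> Ck k g \<Longrightarrow> Ck k (\<lambda>x. f x * g x)"
proof (induction k arbitrary: f g)
  case 0 then show ?case by (auto intro: continuous_intros)
next
  case (Suc k)
  show ?case
    by (rule Ck_SucI[OF has_derivative_mult[OF Ck_SucD(1)[OF Suc.prems(1)] Ck_SucD(1)[OF Suc.prems(2)]]])
       (intro Ck_add Suc.IH Ck_SucD(2)[OF Suc.prems(1)] Ck_SucD(2)[OF Suc.prems(2)]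
          Ck_Suc_imp[OF Suc.prems(1)] Ck_Suc_imp[OF Suc.prems(2)])
qed

lemma Ck_sum: "finite I \<Longrightarrow> (\<And>i. i \<in> I \<Longrightarrow> Ck k (f i)) \<Longrightarrow> Ck k (\<lambda>x. \<Sum>i\<in>I. f i x)"
  by (induction I rule: finite_induct) (auto intro: Ck_const Ck_add)

lemma Ck_prod: "finite I \<Longrightarrow> (\<And>i. i \<in> I \<Longrightarrow> Ck k (f i)) \<Longrightarrow> Ck k (\<lambda>x. \<Prod>i\<in>I. f i x)"
  by (induction I rule: finite_induct) (auto intro: Ck_const Ck_mult)

lemma Ck_compose_affine:
  fixes f :: "'a::euclidean_space \<Rightarrow> real" and l :: "'b::euclidean_space \<Rightarrow> 'a"
  assumes "Ck k f" and l: "bounded_linear l"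
  shows "Ck k (\<lambda>x. f (l x + c))"
  using assms(1)
proof (induction k arbitrary: f)
  case 0
  then show ?case
    using linear_continuous_on[OF l, of UNIV]
    by (auto intro!: continuous_on_compose2[of UNIV f] continuous_intros)
next
  case (Suc k)
  let ?D = "\<lambda>x. frechet_derivative f (at x)"
  have D: "((\<lambda>x. f (l x + c)) has_derivative (\<lambda>h. ?D (l x + c) (l h))) (at x)" for x
    by (rule has_derivative_compose[OF _ Ck_SucD(1)[OF Suc.prems], of "\<lambda>x. l x + c"])
       (auto intro!: derivative_eq_intros bounded_linear.has_derivative[OF l])
  \<comment> \<open>\<open>Ck\<close> speaks about derivatives in basis directions only, and
    \<open>l b\<close> need not be one; linearity expands it into them with constant
    coefficients.\<close>
  have "?D (l x + c) (l b) = (\<Sum>e\<in>Basis. (l b \<bullet> e) * ?D (l x + c) e)" for x b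
  proof -
    have lin: "linear (?D (l x + c))"
      using Ck_SucD(1)[OF Suc.prems] has_derivative_linear by blast
    have "?D (l x + c) (l b) = ?D (l x + c) (\<Sum>e\<in>Basis. (l b \<bullet> e) *\<^sub>R e)"
      by (simp add: euclidean_representation)
    then show ?thesis by (simp add: linear_sum[OF lin] linear_cmul[OF lin] o_def)
  qed
  then have "Ck k (\<lambda>x. ?D (l x + c) (l b))" for b
    using Suc.IH[OF Ck_SucD(2)[OF Suc.prems]] by (auto intro!: Ck_sum Ck_mult Ck_const)
  with D show ?case by (rule Ck_SucI)
qed

lemma Ck_SucI_real:
  fixes f :: "real \<Rightarrow> real"
  assumes "\<And>x. (f has_real_derivative f' x) (at x)" "Ck k f'"
  shows "Ck (Suc k) f"
  by (rule Ck_SucI[where D = "\<lambda>x h. f' x * h"]) (use assms in \<open>auto simp: has_field_derivative_def\<close>)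

lemma Ck_SucD_real:
  fixes f :: "real \<Rightarrow> real"
  assumes "Ck (Suc k) f"
  shows "(f has_real_derivative deriv f x) (at x)" "Ck k (deriv f)"
proof -
  have d: "f differentiable (at x)" for x using assms by auto
  show *: "(f has_real_derivative deriv f x) (at x)" for x
    using d[of x] DERIV_deriv_iff_real_differentiable by blast
  have "frechet_derivative f (at x) 1 = deriv f x" for x
    using frechet_derivative_eqI[OF *[of x, unfolded has_field_derivative_def]] by simp
  then show "Ck k (deriv f)" using assms by auto
qed

text \<open>Proved jointly, since each function differentiates into the other.\<close>

lemma Ck_sin_cos: "Ck k (\<lambda>t. sin (a * t)) \<and> Ck k (\<lambda>t::real. cos (a * t))"
proof (induction k)
  case 0 show ?case by (auto intro!: continuous_intros)
next
  case (Suc k)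
  have "Ck (Suc k) (\<lambda>t. sin (a * t))"
    by (rule Ck_SucI_real[where f' = "\<lambda>t. cos (a * t) * a"])
       (auto intro!: derivative_eq_intros Ck_mult Ck_const simp: Suc simp del: Ck.simps)
  moreover have "Ck (Suc k) (\<lambda>t. cos (a * t))"
    by (rule Ck_SucI_real[OF _ Ck_mult[OF Ck_const[of _ "- a"] conjunct1[OF Suc]]])
       (auto intro!: derivative_eq_intros)
  ultimately show ?case by blast
qed

section \<open>Smooth functions with compact support\<close>

text \<open>With a polynomial factor in \<open>1 / t\<close> the class is closed under
  differentiation, so that smoothness becomes an induction over all \<open>p\<close> at once. The
  case \<open>p = 1\<close> is the classical flat function.\<close>

definition flat :: "real poly \<Rightarrow> real \<Rightarrow> real" where
  "flat p t = (if t > 0 then poly p (1 / t) * exp (- (1 / t)) else 0)"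

lemma poly_mult_exp_minus_tendsto_0: "((\<lambda>y::real. poly p y * exp (- y)) \<longlongrightarrow> 0) at_top"
proof -
  have "((\<lambda>y. \<Sum>i\<le>degree p. coeff p i * (y ^ i / exp y)) \<longlongrightarrow> (\<Sum>i\<le>degree p. coeff p i * 0)) at_top"
    by (intro tendsto_intros tendsto_power_div_exp_0)
  then show ?thesis
    by (simp add: poly_altdef sum_distrib_right exp_minus divide_inverse mult.assoc)
qed

lemma flat_tendsto_0: "(flat p \<longlongrightarrow> 0) (at 0)"
proof -
  have "((\<lambda>t. poly p (1 / t) * exp (- (1 / t))) \<longlongrightarrow> 0) (at_right 0)"
    using filterlim_compose[OF poly_mult_exp_minus_tendsto_0 filterlim_inverse_at_top_right]
    by (simp add: divide_inverse)
  then have "(flat p \<longlongrightarrow> 0) (at_right 0)"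
    by (rule Lim_transform_eventually) (auto simp: flat_def eventually_at_filter)
  moreover have "(flat p \<longlongrightarrow> 0) (at_left 0)"
    by (rule Lim_transform_eventually[OF tendsto_const]) (auto simp: flat_def eventually_at_filter)
  ultimately show ?thesis by (simp add: filterlim_split_at)
qed

text \<open>Differentiating \<open>p(1/t) exp(-1/t)\<close> gives
  \<open>(1/t)^2 (p - p')(1/t) exp(-1/t)\<close>; \<open>[:0, 0, 1:]\<close> is the square of the
  variable.\<close>

lemma has_real_derivative_flat:
  "(flat p has_real_derivative flat ([:0, 0, 1:] * (p - pderiv p)) t) (at t)"
proof -
  consider "t > 0" | "t < 0" | "t = 0" by linarith
  then show ?thesis
  proof cases
    case 1
    have "((\<lambda>t. poly p (1 / t) * exp (- (1 / t))) has_real_derivative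
        flat ([:0, 0, 1:] * (p - pderiv p)) t) (at t)"
      using 1 by (auto intro!: derivative_eq_intros poly_DERIV[THEN DERIV_chain2]
          simp: flat_def field_simps power2_eq_square)
    then show ?thesis
      by (rule has_field_derivative_transform_within_open[of _ _ _ "{0<..}"])
         (use 1 in \<open>auto simp: flat_def\<close>)
  next
    case 2
    have "((\<lambda>t. 0) has_real_derivative flat ([:0, 0, 1:] * (p - pderiv p)) t) (at t)"
      using 2 by (auto simp: flat_def)
    then show ?thesis
      by (rule has_field_derivative_transform_within_open[of _ _ _ "{..<0}"])
         (use 2 in \<open>auto simp: flat_def\<close>)
  next
    case 3
    \<comment> \<open>Dividing by \<open>h\<close> is multiplication by the variable
      \<open>1 / h\<close>, so the difference quotient at 0 is again of the form \<open>flat\<close>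
      and tends to 0.\<close>
    have "(flat p h - flat p 0) / (h - 0) = flat ([:0, 1:] * p) h" for h
      by (simp add: flat_def)
    then show ?thesis
      using flat_tendsto_0[of "[:0, 1:] * p"] 3
      by (simp add: has_field_derivative_iff flat_def[of _ 0])
  qed
qed

lemma Ck_flat: "Ck k (flat p)"
proof (induction k arbitrary: p)
  case 0
  show ?case
    by (auto intro!: continuous_at_imp_continuous_on DERIV_isCont has_real_derivative_flat)
qed (rule Ck_SucI_real[OF has_real_derivative_flat])

lemma flat_1: "flat 1 t = (if t > 0 then exp (- (1 / t)) else 0)"
  by (simp add: flat_def)

lemma test_functionI:
  fixes \<phi> :: "'a::euclidean_space \<Rightarrow> real"
  assumes "\<And>k. Ck k \<phi>" "\<And>x. x \<notin> K \<Longrightarrow> \<phi> x = 0" "bounded K"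
  shows "test_function \<phi>"
proof -
  have "bounded {x. \<phi> x \<noteq> 0}"
    by (rule bounded_subset[OF assms(3)]) (use assms(2) in auto)
  then show ?thesis using assms(1) by (simp add: test_function_def)
qed

lemma test_functionD:
  fixes \<phi> :: "'a::euclidean_space \<Rightarrow> real"
  assumes "test_function \<phi>"
  obtains R where "\<And>x. x \<notin> cball 0 R \<Longrightarrow> \<phi> x = 0"
proof -
  have "bounded {x. \<phi> x \<noteq> 0}"
    by (rule bounded_subset[OF _ closure_subset])
       (use assms in \<open>simp add: test_function_def compact_imp_bounded\<close>)
  then obtain R where R: "\<forall>x\<in>{x. \<phi> x \<noteq> 0}. norm x \<le> R"
    unfolding bounded_iff by blast
  show ?thesis by (rule that[of R]) (use R in auto)
qed

lemma test_function_frechet_derivative: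
  fixes \<phi> :: "'a::euclidean_space \<Rightarrow> real"
  assumes "test_function \<phi>" "b \<in> Basis"
  shows "test_function (\<lambda>x. frechet_derivative \<phi> (at x) b)"
proof -
  obtain R where R: "\<And>x. x \<notin> cball 0 R \<Longrightarrow> \<phi> x = 0"
    using test_functionD[OF assms(1)] by blast
  have "frechet_derivative \<phi> (at x) b = 0" if "x \<notin> cball 0 R" for x
  proof -
    have "(\<phi> has_derivative (\<lambda>_. 0)) (at x)"
      by (rule has_derivative_transform_within_open[of "\<lambda>_. 0" _ _ _ "- cball 0 R"])
         (use that R in \<open>auto simp: open_Compl\<close>)
    then show ?thesis by (simp add: frechet_derivative_eqI)
  qed
  moreover have "Ck k (\<lambda>x. frechet_derivative \<phi> (at x) b)" for k
    using assms Ck_SucD(2) unfolding test_function_def by blast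
  ultimately show ?thesis
    by (intro test_functionI[where K = "cball 0 R"]) auto
qed

lemma test_function_continuous:
  assumes "test_function \<phi>" shows "continuous_on UNIV \<phi>"
proof -
  have "Ck 0 \<phi>" using assms unfolding test_function_def by blast
  then show ?thesis by simp
qed

lemma test_function_bounded:
  assumes "test_function \<phi>"
  obtains B where "\<And>x. \<bar>\<phi> x\<bar> \<le> B"
proof -
  obtain R where R: "\<And>x. x \<notin> cball 0 R \<Longrightarrow> \<phi> x = 0"
    using test_functionD[OF assms] by blast
  have "compact (\<phi> ` cball 0 R)"
    by (intro compact_continuous_image continuous_on_subset[OF test_function_continuous[OF assms]]) auto
  then obtain B where "\<forall>y\<in>\<phi> ` cball 0 R. norm y \<le> B"
    by (meson compact_imp_bounded bounded_iff)
  then have "\<bar>\<phi> x\<bar> \<le> max B 0" for x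
    using R[of x] by (cases "x \<in> cball 0 R") (auto simp: max.coboundedI1)
  then show ?thesis by (rule that)
qed

text \<open>For \<open>s > 0\<close> the value of \<open>flat 1\<close> at \<open>m s\<close> is the \<open>m\<close>-th root of its value at \<open>s\<close>, hence tends to \<open>1\<close>.\<close>

lemma box_test_functions:
  fixes l u :: "'a::euclidean_space"
  obtains \<phi> :: "nat \<Rightarrow> 'a \<Rightarrow> real" where
    "\<And>m. test_function (\<phi> m)" "\<And>m x. \<bar>\<phi> m x\<bar> \<le> indicator (box l u) x"
    "\<And>x. (\<lambda>m. \<phi> m x) \<longlonglongrightarrow> indicator (box l u) x"
proof -
  \<comment> \<open>The arguments are \<open>m (x - l)\<close> and \<open>m (u - x)\<close> in each
    coordinate, written as a linear map plus a constant to fit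
    \<open>Ck_compose_affine\<close>.\<close>
  define \<phi> :: "nat \<Rightarrow> 'a \<Rightarrow> real" where
    "\<phi> m x = (\<Prod>b\<in>Basis. flat 1 (real m *\<^sub>R (x \<bullet> b) + real m * (- (l \<bullet> b)))
        * flat 1 ((- real m) *\<^sub>R (x \<bullet> b) + real m * (u \<bullet> b)))" for m x
  have flat0: "flat 1 t = 0" if "t \<le> 0" for t using that by (simp add: flat_1)
  have out: "\<phi> m x = 0" if "x \<notin> box l u" for m x
  proof -
    have "\<exists>b\<in>Basis. x \<bullet> b \<le> l \<bullet> b \<or> u \<bullet> b \<le> x \<bullet> b"
      using that by (auto simp: mem_box not_less)
    then obtain b where "b \<in> Basis" "x \<bullet> b \<le> l \<bullet> b \<or> u \<bullet> b \<le> x \<bullet> b" by blast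
    then have "real m *\<^sub>R (x \<bullet> b) + real m * (- (l \<bullet> b)) \<le> 0 \<or> (- real m) *\<^sub>R (x \<bullet> b) + real m * (u \<bullet> b) \<le> 0"
      by (auto simp: mult_left_mono)
    with \<open>b \<in> Basis\<close> show ?thesis
      unfolding \<phi>_def by (auto intro!: prod_zero bexI[of _ b] simp: flat0 simp del: real_scaleR_def)
  qed
  have Ckp: "Ck k (\<phi> m)" for k m
    unfolding \<phi>_def
    by (intro Ck_prod Ck_mult Ck_compose_affine[OF Ck_flat]) (auto intro!: bounded_linear_intros bounded_linear_minus)
  have "test_function (\<phi> m)" for m
    by (rule test_functionI[OF Ckp, where K = "box l u"]) (use out in auto)
  moreover have flat_le: "0 \<le> flat 1 t \<and> flat 1 t \<le> 1" for t by (simp add: flat_1)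
  have "0 \<le> \<phi> m x \<and> \<phi> m x \<le> 1" for m x
    unfolding \<phi>_def
    by (intro conjI prod_nonneg prod_le_1 ballI mult_nonneg_nonneg mult_le_one) (use flat_le in auto)
  then have "\<bar>\<phi> m x\<bar> \<le> indicator (box l u) x" for m x
    using out[of x m] by (auto simp: indicator_def)
  moreover have "(\<lambda>m. \<phi> m x) \<longlonglongrightarrow> indicator (box l u) x" for x
  proof (cases "x \<in> box l u")
    case True
    have lim: "(\<lambda>m. flat 1 (real m * c)) \<longlonglongrightarrow> 1" if "c > 0" for c
    proof (rule Lim_transform_eventually)
      have "(\<lambda>m. exp (- (inverse c * inverse (real m)))) \<longlonglongrightarrow> exp (- (inverse c * 0))"
        by (intro tendsto_intros lim_inverse_n)
      then show "(\<lambda>m. exp (- (inverse c * inverse (real m)))) \<longlonglongrightarrow> 1" by simp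
      show "\<forall>\<^sub>F m in sequentially. exp (- (inverse c * inverse (real m))) = flat 1 (real m * c)"
        using eventually_gt_at_top[of 0]
        by eventually_elim (use that in \<open>auto simp: flat_1 field_simps\<close>)
    qed
    have "(\<lambda>m. \<phi> m x) \<longlonglongrightarrow> (\<Prod>b\<in>(Basis::'a set). 1 * 1)"
    proof -
      have "(\<lambda>m. \<Prod>b\<in>Basis. flat 1 (real m * (x \<bullet> b - l \<bullet> b)) * flat 1 (real m * (u \<bullet> b - x \<bullet> b)))
          \<longlonglongrightarrow> (\<Prod>b\<in>(Basis::'a set). 1 * 1)"
        using True by (intro tendsto_prod tendsto_mult lim) (auto simp: mem_box)
      then show ?thesis by (simp add: \<phi>_def algebra_simps)
    qed
    then show ?thesis using True by simp
  qed (simp add: out)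
  ultimately show ?thesis by (rule that)
qed


section \<open>Functions annihilated by all test functions\<close>

text \<open>The positive and negative parts of \<open>g\<close> are densities of two measures that
  agree and are finite on boxes. Boxes form an intersection-stable generator with a countable
  exhaustion, so the measures coincide, and so do the densities almost everywhere.\<close>

lemma AE_zero_if_box_integrals_zero:
  fixes g :: "'a::euclidean_space \<Rightarrow> real"
  assumes [measurable]: "g \<in> borel_measurable lborel"
    and int: "\<And>l u. set_integrable lborel (box l u) g"
    and zero: "\<And>l u. (LINT x:box l u|lborel. g x) = 0"
  shows "AE x in lborel. g x = 0"
proof -
  let ?P = "density lborel (\<lambda>x. ennreal (g x))" and ?N = "density lborel (\<lambda>x. ennreal (- g x))"
  have em: "emeasure ?P (box l u) = emeasure ?N (box l u)" "emeasure ?P (box l u) \<noteq> \<infinity>" for l u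
  proof -
    let ?g = "\<lambda>x. indicator (box l u) x * g x"
    have i: "integrable lborel ?g" using int[of l u] by (simp add: set_integrable_def)
    have P: "emeasure ?P (box l u) = (\<integral>\<^sup>+x. ennreal (?g x) \<partial>lborel)"
      by (auto simp: emeasure_density indicator_def intro!: nn_integral_cong)
    have N: "emeasure ?N (box l u) = (\<integral>\<^sup>+x. ennreal (- ?g x) \<partial>lborel)"
      by (auto simp: emeasure_density indicator_def intro!: nn_integral_cong)
    have fin: "emeasure ?P (box l u) \<noteq> \<infinity>" "emeasure ?N (box l u) \<noteq> \<infinity>"
      using i unfolding P N real_integrable_def by auto
    have "enn2real (emeasure ?P (box l u)) = enn2real (emeasure ?N (box l u))"
      using zero[of l u] real_lebesgue_integral_def[OF i] unfolding P N
      by (simp add: set_lebesgue_integral_def)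
    then show "emeasure ?P (box l u) = emeasure ?N (box l u)"
      using fin by (metis ennreal_enn2real infinity_ennreal_def less_top)
    show "emeasure ?P (box l u) \<noteq> \<infinity>" by fact
  qed
  have "?P = ?N"
  proof (rule measure_eqI_generator_eq)
    let ?E = "range (\<lambda>(a, b). box a b :: 'a set)"
    show "Int_stable ?E" by (auto simp: Int_stable_def box_Int_box)
    show "sets ?P = sigma_sets UNIV ?E" "sets ?N = sigma_sets UNIV ?E"
      by (simp_all add: borel_eq_box)
    show "range (\<lambda>n::nat. box (- real n *\<^sub>R One) (real n *\<^sub>R One)) \<subseteq> ?E" by auto
    show "(\<Union>n::nat. box (- real n *\<^sub>R One) (real n *\<^sub>R One)) = (UNIV :: 'a set)"
      using UN_box_eq_UNIV by simp
  qed (use em in auto)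
  then have "AE x in lborel. ennreal (g x) = ennreal (- g x)"
    by (intro sigma_finite_measure.density_unique[OF sigma_finite_lborel]) auto
  then show ?thesis
  proof eventually_elim
    case (elim x)
    then show ?case by (cases "g x \<ge> 0") (auto simp: ennreal_neg)
  qed
qed

lemma loc_integrable_measurable:
  assumes "loc_integrable f" shows "f \<in> borel_measurable lebesgue"
proof (rule borel_measurable_LIMSEQ_metric)
  show "(\<lambda>x. indicator (cball 0 (real n)) x *\<^sub>R f x) \<in> borel_measurable lebesgue" for n
    by (rule borel_measurable_integrable) (use assms in \<open>simp add: loc_integrable_def set_integrable_def\<close>)
  show "(\<lambda>n. indicator (cball 0 (real n)) x *\<^sub>R f x) \<longlonglongrightarrow> f x" for x
  proof (rule tendsto_eventually)
    obtain N where "norm x \<le> real N" using real_arch_simple by blast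
    then show "\<forall>\<^sub>F n in sequentially. indicator (cball 0 (real n)) x *\<^sub>R f x = f x"
      by (intro eventually_mono[OF eventually_ge_at_top[of N]]) auto
  qed
qed

lemma integrable_test_function_mult:
  assumes "test_function \<phi>" "loc_integrable f"
  shows "integrable lebesgue (\<lambda>x. \<phi> x *\<^sub>R f x)"
proof -
  obtain R where R: "\<And>x. x \<notin> cball 0 R \<Longrightarrow> \<phi> x = 0" using test_functionD[OF assms(1)] by blast
  obtain B where B: "\<And>x. \<bar>\<phi> x\<bar> \<le> B" using test_function_bounded[OF assms(1)] by blast
  have [measurable]: "\<phi> \<in> borel_measurable lebesgue" "f \<in> borel_measurable lebesgue"
    using test_function_continuous[OF assms(1)] loc_integrable_measurable[OF assms(2)]
    by (auto intro!: measurable_completion borel_measurable_continuous_onI)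
  have "integrable lebesgue (\<lambda>x. B *\<^sub>R (indicator (cball 0 R) x *\<^sub>R f x))"
    using assms(2) by (intro integrable_scaleR_right) (auto simp: loc_integrable_def set_integrable_def)
  then show ?thesis
  proof (rule Bochner_Integration.integrable_bound)
    show "AE x in lebesgue. norm (\<phi> x *\<^sub>R f x) \<le> norm (B *\<^sub>R (indicator (cball 0 R) x *\<^sub>R f x))"
    proof (rule AE_I2)
      fix x
      show "norm (\<phi> x *\<^sub>R f x) \<le> norm (B *\<^sub>R (indicator (cball 0 R) x *\<^sub>R f x))"
        using B[of x] R[of x] by (cases "x \<in> cball 0 R") (auto intro!: mult_right_mono)
    qed
  qed measurable
qed

text \<open>Test functions converge boundedly to the indicator of a box, hence all box integrals of
  \<open>f\<close> vanish by dominated convergence.\<close>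

theorem du_Bois_Reymond:
  fixes f :: "'a::euclidean_space \<Rightarrow> complex"
  assumes f: "loc_integrable f"
    and zero: "\<And>\<phi>. test_function \<phi> \<Longrightarrow> (LINT x|lebesgue. \<phi> x *\<^sub>R f x) = 0"
  shows "AE x in lebesgue. f x = 0"
proof -
  note [measurable] = loc_integrable_measurable[OF f]
  have int: "integrable lebesgue (\<lambda>x. indicator (box l u) x *\<^sub>R f x)" for l u
  proof -
    have "set_integrable lebesgue (cbox l u) f" using f by (simp add: loc_integrable_def)
    then show ?thesis
      using set_integrable_subset[of lebesgue "cbox l u" f "box l u"] box_subset_cbox
      by (auto simp: set_integrable_def)
  qed
  have box0: "(LINT x|lebesgue. indicator (box l u) x *\<^sub>R f x) = 0" for l u
  proof -
    obtain \<phi> where \<phi>: "\<And>m. test_function (\<phi> m)" "\<And>m x. \<bar>\<phi> m x\<bar> \<le> indicator (box l u) x"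
      "\<And>x. (\<lambda>m::nat. \<phi> m x) \<longlonglongrightarrow> indicator (box l u) x"
      using box_test_functions[of l u] by blast
    have "(\<lambda>m. LINT x|lebesgue. \<phi> m x *\<^sub>R f x) \<longlonglongrightarrow> (LINT x|lebesgue. indicator (box l u) x *\<^sub>R f x)"
    proof (rule integral_dominated_convergence[OF _ _ integrable_norm[OF int[of l u]]])
      show "AE x in lebesgue. norm (\<phi> m x *\<^sub>R f x) \<le> norm (indicator (box l u) x *\<^sub>R f x)" for m
        using \<phi>(2)[of m] by (auto intro!: mult_right_mono AE_I2)
    qed (auto intro!: tendsto_intros \<phi>(3) borel_measurable_integrable integrable_test_function_mult[OF \<phi>(1) f] int)
    then show ?thesis by (simp add: zero[OF \<phi>(1)] LIMSEQ_const_iff)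
  qed
  \<comment> \<open>A real linear functional \<open>L\<close> covers real and imaginary part at
    once. The box criterion is about Borel functions, so \<open>L (f x)\<close> is first replaced by
    a Borel version \<open>g\<close>.\<close>
  have real_part: "AE x in lebesgue. L (f x) = 0" if L: "bounded_linear L" for L :: "complex \<Rightarrow> real"
  proof -
    have "(\<lambda>x. L (f x)) \<in> borel_measurable lebesgue"
      using L by (auto intro!: borel_measurable_continuous_on[of L] linear_continuous_on)
    then obtain g where [measurable]: "g \<in> borel_measurable lborel" and g: "AE x in lborel. L (f x) = g x"
      using completion_ex_borel_measurable_real by blast
    have meas: "(\<lambda>x. indicator (box l u) x *\<^sub>R g x) \<in> borel_measurable lebesgue" for l u
      by (rule measurable_completion) measurable
    have g': "AE x in lebesgue. L (f x) = g x" using g by (rule AE_completion)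
    have i: "integrable lebesgue (\<lambda>x. L (indicator (box l u) x *\<^sub>R f x))" for l u
      using int by (rule integrable_bounded_linear[OF L])
    have eq: "AE x in lebesgue. L (indicator (box l u) x *\<^sub>R f x) = indicator (box l u) x *\<^sub>R g x" for l u
      using g' by eventually_elim (simp add: linear_simps[OF L])
    have "AE x in lborel. g x = 0"
    proof (rule AE_zero_if_box_integrals_zero)
      fix l u :: 'a
      have "integrable lebesgue (\<lambda>x. indicator (box l u) x *\<^sub>R g x)"
        by (rule integrable_cong_AE_imp[OF i meas eq])
      then show "set_integrable lborel (box l u) g"
        by (simp add: set_integrable_def integrable_completion)
      have "(LINT x|lebesgue. indicator (box l u) x *\<^sub>R g x) = (LINT x|lebesgue. L (indicator (box l u) x *\<^sub>R f x))"
        by (rule integral_cong_AE[OF meas borel_measurable_integrable[OF i]])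
           (rule eventually_mono[OF eq[of l u]], simp)
      also have "\<dots> = 0"
        using box0[of l u] integral_bounded_linear[OF L int[of l u]] by (simp add: linear_simps[OF L])
      finally show "(LINT x:box l u|lborel. g x) = 0"
        by (simp add: set_lebesgue_integral_def integral_completion)
    qed simp
    then show ?thesis using g unfolding AE_completion_iff by eventually_elim simp
  qed
  from real_part[OF bounded_linear_Re] real_part[OF bounded_linear_Im] show ?thesis
    by eventually_elim (simp add: complex_eq_iff)
qed

section \<open>Fourier coefficients on an interval\<close>

text \<open>Completeness of the cosines on \<open>[0, \<pi>]\<close>: substituting \<open>y = cos t\<close> turns
  uniform approximation by cosine polynomials into the Weierstrass theorem on \<open>[-1, 1]\<close>.\<close>

definition cos_poly :: "(real \<Rightarrow> real) \<Rightarrow> bool" where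
  "cos_poly p \<longleftrightarrow> (\<exists>c N. p = (\<lambda>t. \<Sum>k\<le>N. c k * cos (real k * t)))"

lemma cos_poly_cos: "cos_poly (\<lambda>t. a * cos (real m * t))"
  unfolding cos_poly_def
  by (rule exI[of _ "\<lambda>k. if k = m then a else 0"], rule exI[of _ m]) (auto simp: if_distrib if_distribR cong: if_cong)

lemma cos_poly_add: assumes "cos_poly p" "cos_poly q" shows "cos_poly (\<lambda>t. p t + q t)"
proof -
  obtain c N where p: "p = (\<lambda>t. \<Sum>k\<le>N. c k * cos (real k * t))"
    using assms by (auto simp: cos_poly_def)
  obtain d M where q: "q = (\<lambda>t. \<Sum>k\<le>M. d k * cos (real k * t))"
    using assms by (auto simp: cos_poly_def)
  have ext: "(\<Sum>k\<le>N. c k * cos (real k * t)) =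
      (\<Sum>k\<le>max N M. (if k \<le> N then c k else 0) * cos (real k * t))" for c :: "nat \<Rightarrow> real" and N M t
    by (rule sum.mono_neutral_cong_left) auto
  show ?thesis
    unfolding cos_poly_def p q
    by (rule exI[of _ "\<lambda>k. (if k \<le> N then c k else 0) + (if k \<le> M then d k else 0)"], rule exI[of _ "max N M"])
       (simp only: ext[of c _ N M] ext[of d _ M N, unfolded max.commute[of M N]] sum.distrib distrib_right)
qed

lemma cos_poly_sum: "finite I \<Longrightarrow> (\<And>i. i \<in> I \<Longrightarrow> cos_poly (p i)) \<Longrightarrow> cos_poly (\<lambda>t. \<Sum>i\<in>I. p i t)"
  by (induction I rule: finite_induct) (use cos_poly_cos[of 0] cos_poly_add in auto)

text \<open>\<open>2 cos t cos (k t) = cos ((k + 1) t) + cos ((k - 1) t)\<close>.\<close>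

lemma cos_poly_mult_cos: assumes "cos_poly p" shows "cos_poly (\<lambda>t. cos t * p t)"
proof -
  obtain c N where p: "p = (\<lambda>t. \<Sum>k\<le>N. c k * cos (real k * t))"
    using assms by (auto simp: cos_poly_def)
  \<comment> \<open>The absolute value keeps the index natural at \<open>k = 0\<close>, where
    evenness of the cosine turns frequency -1 into 1.\<close>
  have shift: "cos t * cos (real k * t) = (1/2) * cos (real (k + 1) * t) + (1/2) * cos (real (nat \<bar>int k - 1\<bar>) * t)" for k t
  proof (cases k)
    case 0 then show ?thesis by simp
  next
    case (Suc j)
    then show ?thesis by (simp add: cos_times_cos algebra_simps add_divide_distrib)
  qed
  have "cos t * p t = (\<Sum>k\<le>N. (c k / 2) * cos (real (k + 1) * t) + (c k / 2) * cos (real (nat \<bar>int k - 1\<bar>) * t))" for t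
    unfolding p sum_distrib_left
    by (rule sum.cong) (use shift[of t] in \<open>auto simp: algebra_simps mult.left_commute[of "cos t"]\<close>)
  then show ?thesis by (simp only:) (intro cos_poly_sum cos_poly_add cos_poly_cos, simp)
qed

lemma cos_poly_power: "cos_poly (\<lambda>t. a * cos t ^ n)"
proof (induction n)
  case 0 then show ?case using cos_poly_cos[of a 0] by simp
next
  case (Suc n)
  from cos_poly_mult_cos[OF this] show ?case by (simp add: mult.left_commute)
qed

lemma cos_poly_approx:
  fixes f :: "real \<Rightarrow> real"
  assumes "continuous_on {0..pi} f" "e > 0"
  obtains p where "cos_poly p" "\<And>t. t \<in> {0..pi} \<Longrightarrow> \<bar>f t - p t\<bar> < e"
proof -
  have "continuous_on {-1..1} (\<lambda>y. f (arccos y))"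
    by (rule continuous_on_compose2[OF assms(1) continuous_on_arccos'])
       (auto intro: arccos_lbound arccos_ubound)
  then obtain g where g: "real_polynomial_function g" "\<And>y. y \<in> {-1..1} \<Longrightarrow> \<bar>f (arccos y) - g y\<bar> < e"
    using Stone_Weierstrass_real_polynomial_function[of "{-1..1}" "\<lambda>y. f (arccos y)" e] assms(2) by auto
  obtain a n where gn: "g = (\<lambda>y. \<Sum>i\<le>n. a i * y ^ i)"
    using g(1) by (auto simp: real_polynomial_function_iff_sum)
  show ?thesis
  proof (rule that[of "\<lambda>t. g (cos t)"])
    show "cos_poly (\<lambda>t. g (cos t))"
      unfolding gn by (intro cos_poly_sum cos_poly_power) simp
    show "\<bar>f t - g (cos t)\<bar> < e" if "t \<in> {0..pi}" for t
      using g(2)[of "cos t"] that by (simp add: arccos_cos)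
  qed
qed

section \<open>Orthogonality relations and the Bessel inequality\<close>

text \<open>The frequency is an integer because the product formulas below produce the difference
  \<open>j - k\<close>.\<close>

lemma integral_cos_multiple:
  "(LINT t:{0..pi}|lborel. cos (real_of_int k * t)) = (if k = 0 then pi else 0)"
proof (cases "k = 0")
  case True then show ?thesis by (simp add: set_lebesgue_integral_def)
next
  case False
  have "(LINT t|lborel. cos (real_of_int k * t) * indicator {0..pi} t)
      = sin (real_of_int k * pi) / k - sin (real_of_int k * 0) / k"
    by (rule integral_FTC_Icc_real)
       (use False in \<open>auto intro!: derivative_eq_intros continuous_intros simp: field_simps\<close>)
  also have "sin (real_of_int k * pi) = 0" by (simp add: sin_int_times_real mult.commute)
  finally show ?thesis using False by (simp add: set_lebesgue_integral_def mult.commute)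
qed

lemma integral_cos_cos:
  "(LINT t:{0..pi}|lborel. cos (real j * t) * cos (real k * t)) =
     (if j = k then if k = 0 then pi else pi / 2 else 0)"
proof -
  define a b where "a = int j - int k" and "b = int j + int k"
  have int: "set_integrable lborel {0..pi} (\<lambda>t. (1 / 2) * cos (real_of_int k * t))" for k
    by (intro borel_integrable_atLeastAtMost') (auto intro!: continuous_intros)
  have eq: "cos (real j * t) * cos (real k * t) =
      (1 / 2) * cos (real_of_int a * t) + (1 / 2) * cos (real_of_int b * t)" for t
    by (simp add: a_def b_def left_diff_distrib distrib_right cos_diff cos_add)
       (simp add: field_simps)
  show ?thesis
    unfolding eq set_integral_add(2)[OF int int]
    by (simp add: integral_cos_multiple) (auto simp: a_def b_def)
qed

lemma integral_sin_sin:
  "(LINT t:{0..pi}|lborel. sin (real j * t) * sin (real k * t)) =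
     (if j = k then if k = 0 then 0 else pi / 2 else 0)"
proof -
  define a b where "a = int j - int k" and "b = int j + int k"
  have int: "set_integrable lborel {0..pi} (\<lambda>t. (1 / 2) * cos (real_of_int k * t))" for k
    by (intro borel_integrable_atLeastAtMost') (auto intro!: continuous_intros)
  have eq: "sin (real j * t) * sin (real k * t) =
      (1 / 2) * cos (real_of_int a * t) - (1 / 2) * cos (real_of_int b * t)" for t
    by (simp add: a_def b_def left_diff_distrib distrib_right cos_diff cos_add)
       (simp add: field_simps)
  show ?thesis
    unfolding eq set_integral_diff(2)[OF int int]
    by (simp add: integral_cos_multiple) (auto simp: a_def b_def)
qed


text \<open>The coefficients stay arbitrary, since the formula serves two purposes: scaled Fourier
  coefficients give the Bessel inequality, and those of an approximating cosine polynomial give the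
  converse bound.\<close>

lemma orthogonal_expansion:
  fixes \<phi> :: "nat \<Rightarrow> 'a \<Rightarrow> real" and f :: "'a \<Rightarrow> real"
  assumes int: "\<And>j k. j \<le> N \<Longrightarrow> k \<le> N \<Longrightarrow> integrable M (\<lambda>t. \<phi> j t * \<phi> k t)"
    and orth: "\<And>j k. j \<le> N \<Longrightarrow> k \<le> N \<Longrightarrow> (LINT t|M. \<phi> j t * \<phi> k t) = (if j = k then w k else 0)"
    and f\<phi>: "\<And>k. k \<le> N \<Longrightarrow> integrable M (\<lambda>t. f t * \<phi> k t)"
    and f2: "integrable M (\<lambda>t. (f t)\<^sup>2)"
  shows "integrable M (\<lambda>t. (f t - (\<Sum>k\<le>N. c k * \<phi> k t))\<^sup>2)"
    "(LINT t|M. (f t - (\<Sum>k\<le>N. c k * \<phi> k t))\<^sup>2) =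
      (LINT t|M. (f t)\<^sup>2) - 2 * (\<Sum>k\<le>N. c k * (LINT t|M. f t * \<phi> k t)) + (\<Sum>k\<le>N. (c k)\<^sup>2 * w k)"
proof -
  have eq: "(f t - (\<Sum>k\<le>N. c k * \<phi> k t))\<^sup>2 = (f t)\<^sup>2 - 2 * (\<Sum>k\<le>N. c k * (f t * \<phi> k t))
      + (\<Sum>j\<le>N. \<Sum>k\<le>N. c j * c k * (\<phi> j t * \<phi> k t))" for t
  proof -
    have "(f t - (\<Sum>k\<le>N. c k * \<phi> k t))\<^sup>2 = (f t)\<^sup>2 - 2 * (f t * (\<Sum>k\<le>N. c k * \<phi> k t))
        + (\<Sum>k\<le>N. c k * \<phi> k t) * (\<Sum>k\<le>N. c k * \<phi> k t)"
      by (simp add: power2_diff mult.assoc flip: power2_eq_square)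
    also have "f t * (\<Sum>k\<le>N. c k * \<phi> k t) = (\<Sum>k\<le>N. c k * (f t * \<phi> k t))"
      by (simp add: sum_distrib_left mult.left_commute)
    also have "(\<Sum>k\<le>N. c k * \<phi> k t) * (\<Sum>k\<le>N. c k * \<phi> k t)
        = (\<Sum>j\<le>N. \<Sum>k\<le>N. c j * c k * (\<phi> j t * \<phi> k t))"
      by (simp add: sum_product mult_ac)
    finally show ?thesis .
  qed
  have i1: "integrable M (\<lambda>t. \<Sum>k\<le>N. c k * (f t * \<phi> k t))" using f\<phi> by auto
  have i2: "integrable M (\<lambda>t. \<Sum>j\<le>N. \<Sum>k\<le>N. c j * c k * (\<phi> j t * \<phi> k t))"
    by (intro Bochner_Integration.integrable_sum integrable_mult_right int) auto
  show "integrable M (\<lambda>t. (f t - (\<Sum>k\<le>N. c k * \<phi> k t))\<^sup>2)"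
    unfolding eq using i1 i2 f2 by auto
  have "(LINT t|M. (\<Sum>j\<le>N. \<Sum>k\<le>N. c j * c k * (\<phi> j t * \<phi> k t)))
      = (\<Sum>j\<le>N. \<Sum>k\<le>N. c j * c k * (if j = k then w k else 0))"
  proof -
    have "(LINT t|M. (\<Sum>j\<le>N. \<Sum>k\<le>N. c j * c k * (\<phi> j t * \<phi> k t)))
        = (\<Sum>j\<le>N. (LINT t|M. (\<Sum>k\<le>N. c j * c k * (\<phi> j t * \<phi> k t))))"
      by (intro Bochner_Integration.integral_sum Bochner_Integration.integrable_sum integrable_mult_right int) auto
    also have "\<dots> = (\<Sum>j\<le>N. \<Sum>k\<le>N. (LINT t|M. c j * c k * (\<phi> j t * \<phi> k t)))"
      by (intro sum.cong refl Bochner_Integration.integral_sum integrable_mult_right int) auto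
    also have "\<dots> = (\<Sum>j\<le>N. \<Sum>k\<le>N. c j * c k * (if j = k then w k else 0))"
      by (intro sum.cong refl) (simp add: orth)
    finally show ?thesis .
  qed
  also have "\<dots> = (\<Sum>k\<le>N. (c k)\<^sup>2 * w k)"
    by (simp add: power2_eq_square if_distrib[of "\<lambda>x. _ * x"] cong: if_cong)
  finally show "(LINT t|M. (f t - (\<Sum>k\<le>N. c k * \<phi> k t))\<^sup>2) =
      (LINT t|M. (f t)\<^sup>2) - 2 * (\<Sum>k\<le>N. c k * (LINT t|M. f t * \<phi> k t)) + (\<Sum>k\<le>N. (c k)\<^sup>2 * w k)"
    unfolding eq using i1 i2 f2 f\<phi> by (simp add: Bochner_Integration.integral_sum)
qed

text \<open>The squared norms \<open>w k\<close> are only bounded above, because the zeroth sine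
  vanishes and has norm 0. The coefficients \<open>a k / W\<close> replace the optimal
  \<open>a k / w k\<close>; as \<open>w k \<le> W\<close>, the quadratic term still cancels only
  half of the mixed one.\<close>

lemma Bessel_inequality:
  fixes \<phi> :: "nat \<Rightarrow> 'a \<Rightarrow> real" and f :: "'a \<Rightarrow> real"
  assumes int: "\<And>j k. integrable M (\<lambda>t. \<phi> j t * \<phi> k t)"
    and orth: "\<And>j k. (LINT t|M. \<phi> j t * \<phi> k t) = (if j = k then w k else 0)"
    and f\<phi>: "\<And>k. integrable M (\<lambda>t. f t * \<phi> k t)"
    and f2: "integrable M (\<lambda>t. (f t)\<^sup>2)"
    and w: "\<And>k. w k \<le> W" and "W > 0"
  shows "(\<Sum>k\<le>N. (LINT t|M. f t * \<phi> k t)\<^sup>2) \<le> W * (LINT t|M. (f t)\<^sup>2)"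
proof -
  let ?a = "\<lambda>k. LINT t|M. f t * \<phi> k t"
  have "0 \<le> (LINT t|M. (f t - (\<Sum>k\<le>N. (?a k / W) * \<phi> k t))\<^sup>2)" by simp
  also have "\<dots> = (LINT t|M. (f t)\<^sup>2) - 2 * (\<Sum>k\<le>N. ?a k / W * ?a k) + (\<Sum>k\<le>N. (?a k / W)\<^sup>2 * w k)"
    by (rule orthogonal_expansion(2)) (use assms in auto)
  also have "\<dots> \<le> (LINT t|M. (f t)\<^sup>2) - 2 * (\<Sum>k\<le>N. ?a k / W * ?a k) + (\<Sum>k\<le>N. (?a k / W)\<^sup>2 * W)"
    by (intro add_left_mono sum_mono mult_left_mono w) auto
  also have "\<dots> = (LINT t|M. (f t)\<^sup>2) - (\<Sum>k\<le>N. (?a k)\<^sup>2) / W"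
    using \<open>W > 0\<close> by (simp add: power2_eq_square sum_divide_distrib)
  finally show ?thesis using \<open>W > 0\<close> by (simp add: field_simps)
qed


section \<open>Density of cosine polynomials\<close>

abbreviation interval_measure_0_pi :: "real measure" ("\<P>") where
  "\<P> \<equiv> restrict_space lborel {0..pi}"

lemma finite_measure_0_pi: "finite_measure \<P>"
  by (rule finite_measureI) (simp add: emeasure_restrict_space space_restrict_space)

lemma integral_0_pi: "(LINT t|\<P>. f t) = (LINT t:{0..pi}|lborel. (f t :: real))"
  by (simp add: integral_restrict_space set_lebesgue_integral_def)

lemma integrable_square_bounded_mult:
  fixes f g :: "'a \<Rightarrow> real"
  assumes "finite_measure M" and [measurable]: "f \<in> borel_measurable M" "g \<in> borel_measurable M"
    and f2: "integrable M (\<lambda>t. (f t)\<^sup>2)" and g: "\<And>t. \<bar>g t\<bar> \<le> 1"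
  shows "integrable M (\<lambda>t. f t * g t)"
proof -
  interpret finite_measure M by fact
  have "integrable M (\<lambda>t. (f t)\<^sup>2 + 1)" using f2 by simp
  then show ?thesis
  proof (rule Bochner_Integration.integrable_bound)
    have "\<bar>f t * g t\<bar> \<le> (f t)\<^sup>2 + 1" for t
    proof -
      have "0 \<le> (\<bar>f t\<bar> - 1)\<^sup>2" by simp
      then have "2 * \<bar>f t\<bar> \<le> (f t)\<^sup>2 + 1" by (simp add: power2_diff)
      moreover have "\<bar>f t * g t\<bar> \<le> \<bar>f t\<bar> * 1"
        unfolding abs_mult by (intro mult_left_mono g) auto
      moreover have "0 \<le> \<bar>f t\<bar>" by simp
      ultimately show ?thesis by linarith
    qed
    then show "AE t in M. norm (f t * g t) \<le> norm ((f t)\<^sup>2 + 1)" by simp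
  qed measurable
qed

lemma square_integral_truncation_tendsto:
  fixes f :: "'a \<Rightarrow> real"
  assumes [measurable]: "f \<in> borel_measurable M" and f2: "integrable M (\<lambda>t. (f t)\<^sup>2)"
  shows "(\<lambda>n. LINT t|M. (f t - max (- real n) (min (real n) (f t)))\<^sup>2) \<longlonglongrightarrow> 0"
proof -
  have "(\<lambda>n. LINT t|M. (f t - max (- real n) (min (real n) (f t)))\<^sup>2) \<longlonglongrightarrow> (LINT t|M. 0)"
  proof (rule integral_dominated_convergence[OF _ _ f2])
    show "AE t in M. (\<lambda>n. (f t - max (- real n) (min (real n) (f t)))\<^sup>2) \<longlonglongrightarrow> 0"
    proof (rule AE_I2, rule tendsto_eventually)
      fix t
      obtain N where "\<bar>f t\<bar> \<le> real N" using real_arch_simple by blast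
      then show "\<forall>\<^sub>F n in sequentially. (f t - max (- real n) (min (real n) (f t)))\<^sup>2 = 0"
        by (intro eventually_mono[OF eventually_ge_at_top[of N]]) auto
    qed
    show "AE t in M. norm ((f t - max (- real n) (min (real n) (f t)))\<^sup>2) \<le> (f t)\<^sup>2" for n
      by (rule AE_I2) (auto simp: abs_le_square_iff[symmetric])
  qed measurable
  then show ?thesis by simp
qed

text \<open>A measurable function is almost everywhere a limit of continuous functions. Clamping
  these to \<open>[- B, B]\<close> keeps the limit and supplies the dominating constant.\<close>

lemma bounded_L2_approx_continuous:
  fixes f :: "real \<Rightarrow> real"
  assumes [measurable]: "f \<in> borel_measurable borel" and bd: "\<And>t. \<bar>f t\<bar> \<le> B" and "e > 0"
  obtains h where "continuous_on UNIV h" "\<And>t. \<bar>h t\<bar> \<le> B" "(LINT t|\<P>. (f t - h t)\<^sup>2) < e"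
proof -
  interpret finite_measure \<P> by (rule finite_measure_0_pi)
  have "f \<in> borel_measurable lebesgue"
    by (rule measurable_completion) simp
  then have "f measurable_on UNIV"
    by (rule lebesgue_measurable_imp_measurable_on) simp
  then obtain N g where N: "negligible N" and g: "\<And>n::nat. continuous_on UNIV (g n)"
    and lim: "\<And>t. t \<notin> N \<Longrightarrow> (\<lambda>n. g n t) \<longlonglongrightarrow> f t"
    by (auto simp: measurable_on_def)
  define h where "h n t = max (- B) (min B (g n t))" for n t
  have ch: "continuous_on UNIV (h n)" for n
    unfolding h_def using g by (intro continuous_intros) auto
  have "B \<ge> 0" using bd[of 0] by linarith
  then have bh: "\<bar>h n t\<bar> \<le> B" for n t unfolding h_def by linarith
  have [measurable]: "h n \<in> borel_measurable borel" for n
    using ch by (rule borel_measurable_continuous_onI)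
  have "AE t in lebesgue. t \<notin> N" using N by (simp add: negligible_iff_null_sets AE_not_in)
  then have "AE t in lborel. t \<notin> N" by (simp add: AE_completion_iff)
  then have aeN: "AE t in \<P>. t \<notin> N" by (simp add: AE_restrict_space_iff) (auto elim: eventually_mono)
  have "(\<lambda>n. LINT t|\<P>. (f t - h n t)\<^sup>2) \<longlonglongrightarrow> (LINT t|\<P>. 0)"
  proof (rule integral_dominated_convergence)
    show "AE t in \<P>. (\<lambda>n. (f t - h n t)\<^sup>2) \<longlonglongrightarrow> 0"
      using aeN
    proof eventually_elim
      case (elim t)
      have "(\<lambda>n. (f t - h n t)\<^sup>2) \<longlonglongrightarrow> (f t - max (- B) (min B (f t)))\<^sup>2"
        unfolding h_def by (intro tendsto_intros tendsto_max tendsto_min lim elim)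
      moreover have "max (- B) (min B (f t)) = f t" using bd[of t] by linarith
      ultimately show ?case by simp
    qed
    show "AE t in \<P>. norm ((f t - h n t)\<^sup>2) \<le> (2 * B)\<^sup>2" for n
    proof (rule AE_I2)
      fix t have "\<bar>f t - h n t\<bar> \<le> \<bar>2 * B\<bar>" using bd[of t] bh[of n t] by linarith
      then show "norm ((f t - h n t)\<^sup>2) \<le> (2 * B)\<^sup>2" by (simp only: abs_le_square_iff real_norm_def abs_power2)
    qed
  qed (auto intro: measurable_restrict_space1)
  then have "\<forall>\<^sub>F n in sequentially. (LINT t|\<P>. (f t - h n t)\<^sup>2) < e"
    using \<open>e > 0\<close> by (auto dest: order_tendstoD(2))
  then obtain n where "(LINT t|\<P>. (f t - h n t)\<^sup>2) < e"
    by (auto simp: eventually_sequentially)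
  with ch bh show ?thesis by (rule that)
qed

lemma sum3_squared_le: "((a::real) + b + c)\<^sup>2 \<le> 3 * (a\<^sup>2 + b\<^sup>2 + c\<^sup>2)"
proof -
  have "0 \<le> (a - b)\<^sup>2 + (b - c)\<^sup>2 + (a - c)\<^sup>2" by simp
  then show ?thesis by (simp add: power2_eq_square algebra_simps)
qed

text \<open>Three successive approximations: truncation \<open>b\<close>, continuous
  \<open>h\<close>, cosine polynomial \<open>p\<close>. Each squared error is at most
  \<open>e / 12\<close>, and \<open>sum3_squared_le\<close> costs a factor 3, which leaves
  \<open>3 e / 4 < e\<close>.\<close>

lemma L2_approx_cos_poly:
  fixes f :: "real \<Rightarrow> real"
  assumes [measurable]: "f \<in> borel_measurable borel" and f2: "integrable \<P> (\<lambda>t. (f t)\<^sup>2)" and "e > 0"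
  obtains p where "cos_poly p" "(LINT t|\<P>. (f t - p t)\<^sup>2) < e"
proof -
  interpret finite_measure \<P> by (rule finite_measure_0_pi)
  have [measurable]: "f \<in> borel_measurable \<P>" by (auto intro: measurable_restrict_space1)
  have "\<forall>\<^sub>F n in sequentially. (LINT t|\<P>. (f t - max (- real n) (min (real n) (f t)))\<^sup>2) < e / 12"
    by (rule order_tendstoD(2)[OF square_integral_truncation_tendsto[OF _ f2]]) (use \<open>e > 0\<close> in auto)
  then obtain n where n: "(LINT t|\<P>. (f t - max (- real n) (min (real n) (f t)))\<^sup>2) < e / 12"
    by (auto simp: eventually_sequentially)
  define b where "b t = max (- real n) (min (real n) (f t))" for t
  have [measurable]: "b \<in> borel_measurable borel" unfolding b_def by measurable
  obtain h where h: "continuous_on UNIV h" "\<And>t. \<bar>h t\<bar> \<le> real n" "(LINT t|\<P>. (b t - h t)\<^sup>2) < e / 12"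
    by (rule bounded_L2_approx_continuous[of b "real n" "e / 12"]) (use \<open>e > 0\<close> in \<open>auto simp: b_def\<close>)
  \<comment> \<open>A uniform error \<open>d\<close> on an interval of length \<open>pi\<close> has
    squared integral at most \<open>pi * d^2 = e / 12\<close>.\<close>
  define d where "d = sqrt (e / (12 * pi))"
  have "d > 0" using \<open>e > 0\<close> by (simp add: d_def)
  obtain p where p: "cos_poly p" "\<And>t. t \<in> {0..pi} \<Longrightarrow> \<bar>h t - p t\<bar> < d"
    using cos_poly_approx[OF continuous_on_subset[OF h(1)] \<open>d > 0\<close>] by blast
  have [measurable]: "p \<in> borel_measurable borel"
    using p(1) unfolding cos_poly_def by (auto intro!: borel_measurable_continuous_onI continuous_intros)
  have [measurable]: "h \<in> borel_measurable borel"
    using h(1) by (rule borel_measurable_continuous_onI)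
  have m: "g \<in> borel_measurable borel \<Longrightarrow> g \<in> borel_measurable \<P>" for g :: "real \<Rightarrow> real"
    by (auto intro: measurable_restrict_space1)
  have bn: "\<bar>b t\<bar> \<le> real n" for t by (simp add: b_def abs_le_iff)
  have i1: "integrable \<P> (\<lambda>t. (f t - b t)\<^sup>2)"
    by (rule Bochner_Integration.integrable_bound[OF f2])
       (auto intro!: m AE_I2 simp: b_def abs_le_square_iff[symmetric])
  have i2: "integrable \<P> (\<lambda>t. (b t - h t)\<^sup>2)"
  proof (rule integrable_const_bound[of _ "(2 * real n)\<^sup>2"])
    have "\<bar>b t - h t\<bar> \<le> \<bar>2 * real n\<bar>" for t using bn[of t] h(2)[of t] by linarith
    then show "AE t in \<P>. norm ((b t - h t)\<^sup>2) \<le> (2 * real n)\<^sup>2"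
      by (simp only: abs_le_square_iff real_norm_def abs_power2 AE_I2)
  qed (auto intro: m)
  have hp: "(h t - p t)\<^sup>2 \<le> d\<^sup>2" if "t \<in> {0..pi}" for t
    using p(2)[OF that] \<open>d > 0\<close> by (simp add: abs_le_square_iff[symmetric])
  have i3: "integrable \<P> (\<lambda>t. (h t - p t)\<^sup>2)"
    by (rule integrable_const_bound[of _ "d\<^sup>2"]) (use hp in \<open>auto intro!: m AE_I2\<close>)
  have "(LINT t|\<P>. (h t - p t)\<^sup>2) \<le> (LINT t|\<P>. d\<^sup>2)"
    by (rule integral_mono[OF i3]) (use hp in auto)
  also have "\<dots> = e / 12"
    using \<open>e > 0\<close> by (simp add: d_def measure_restrict_space)
  finally have 3: "(LINT t|\<P>. (h t - p t)\<^sup>2) \<le> e / 12" .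
  have "(LINT t|\<P>. (f t - p t)\<^sup>2) \<le> (LINT t|\<P>. 3 * ((f t - b t)\<^sup>2 + (b t - h t)\<^sup>2 + (h t - p t)\<^sup>2))"
  proof (rule integral_mono')
    show "integrable \<P> (\<lambda>t. 3 * ((f t - b t)\<^sup>2 + (b t - h t)\<^sup>2 + (h t - p t)\<^sup>2))"
      using i1 i2 i3 by auto
    show "(f t - p t)\<^sup>2 \<le> 3 * ((f t - b t)\<^sup>2 + (b t - h t)\<^sup>2 + (h t - p t)\<^sup>2)" for t
      using sum3_squared_le[of "f t - b t" "b t - h t" "h t - p t"] by simp
  qed simp
  also have "\<dots> < e"
    using i1 i2 i3 n h(3) 3 \<open>e > 0\<close> unfolding b_def[symmetric] by simp
  finally show ?thesis using p(1) that by blast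
qed

lemma borel_measurable_0_pi: "g \<in> borel_measurable borel \<Longrightarrow> g \<in> borel_measurable \<P>"
  by (auto intro: measurable_restrict_space1)

lemma integrable_0_pi_continuous:
  fixes g :: "real \<Rightarrow> real"
  assumes "continuous_on UNIV g" shows "integrable \<P> g"
  using borel_integrable_atLeastAtMost'[OF continuous_on_subset[OF assms], of 0 pi]
  by (simp add: integrable_restrict_space set_integrable_def)

section \<open>Two-sided bounds for Fourier coefficients\<close>

text \<open>Expand the squared distance to a cosine polynomial that is \<open>e\<close>-close to
  \<open>f\<close>. Whatever its coefficients are, what they contribute is dominated by the Fourier
  coefficients of \<open>f\<close>.\<close>

lemma cos_coefficients_lower_bound:
  fixes f :: "real \<Rightarrow> real"
  assumes f: "f \<in> borel_measurable borel" and f2: "integrable \<P> (\<lambda>t. (f t)\<^sup>2)" and "e > 0"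
  obtains N where "(LINT t|\<P>. (f t)\<^sup>2) \<le> (2 / pi) * (\<Sum>k\<le>N. (LINT t|\<P>. f t * cos (real k * t))\<^sup>2) + e"
proof -
  obtain p where p: "cos_poly p" "(LINT t|\<P>. (f t - p t)\<^sup>2) < e"
    using L2_approx_cos_poly[OF assms] by blast
  obtain c N where pc: "p = (\<lambda>t. \<Sum>k\<le>N. c k * cos (real k * t))"
    using p(1) by (auto simp: cos_poly_def)
  define a where "a k = (LINT t|\<P>. f t * cos (real k * t))" for k :: nat
  define w where "w k = (if k = 0 then pi else pi / 2)" for k :: nat
  have "(LINT t|\<P>. (f t - p t)\<^sup>2) = (LINT t|\<P>. (f t)\<^sup>2) - 2 * (\<Sum>k\<le>N. c k * a k) + (\<Sum>k\<le>N. (c k)\<^sup>2 * w k)"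
    unfolding pc a_def
  proof (rule orthogonal_expansion(2)[where \<phi> = "\<lambda>k t. cos (real k * t)"])
    show "integrable \<P> (\<lambda>t. cos (real j * t) * cos (real k * t))" for j k
      by (intro integrable_0_pi_continuous continuous_intros)
    show "(LINT t|\<P>. cos (real j * t) * cos (real k * t)) = (if j = k then w k else 0)" for j k
      by (simp add: integral_0_pi integral_cos_cos w_def)
    show "integrable \<P> (\<lambda>t. f t * cos (real k * t))" for k
      by (intro integrable_square_bounded_mult[OF finite_measure_0_pi] borel_measurable_0_pi f f2) auto
  qed fact
  \<comment> \<open>Completing the square bounds the left side by \<open>(a k)^2 / w k\<close>, and
    every \<open>w k\<close> is at least \<open>pi / 2\<close>.\<close>
  moreover have "2 * (c k * a k) - (c k)\<^sup>2 * w k \<le> (2 / pi) * (a k)\<^sup>2" for k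
  proof -
    have w: "w k > 0" "1 / w k \<le> 2 / pi" by (auto simp: w_def field_simps)
    have "0 \<le> (c k * w k - a k)\<^sup>2 / w k" using w(1) by simp
    also have "\<dots> = (c k)\<^sup>2 * w k - 2 * (c k * a k) + (a k)\<^sup>2 * (1 / w k)"
      using w(1) by (simp add: power2_eq_square field_simps)
    also have "\<dots> \<le> (c k)\<^sup>2 * w k - 2 * (c k * a k) + (a k)\<^sup>2 * (2 / pi)"
      by (intro add_left_mono mult_left_mono w(2)) simp
    finally show ?thesis by (simp add: mult.commute)
  qed
  then have "2 * (\<Sum>k\<le>N. c k * a k) - (\<Sum>k\<le>N. (c k)\<^sup>2 * w k) \<le> (2 / pi) * (\<Sum>k\<le>N. (a k)\<^sup>2)"
    unfolding sum_distrib_left sum_subtractf[symmetric] by (intro sum_mono)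
  ultimately have "(LINT t|\<P>. (f t)\<^sup>2) \<le> (2 / pi) * (\<Sum>k\<le>N. (a k)\<^sup>2) + e"
    using p(2) by linarith
  then show ?thesis unfolding a_def by (rule that)
qed


lemma cos_sin_coefficients_upper_bound:
  fixes f :: "real \<Rightarrow> real"
  assumes f: "f \<in> borel_measurable borel" and f2: "integrable \<P> (\<lambda>t. (f t)\<^sup>2)"
  shows "(\<Sum>k\<le>N. (LINT t|\<P>. f t * cos (real k * t))\<^sup>2) \<le> pi * (LINT t|\<P>. (f t)\<^sup>2)"
    and "(\<Sum>k\<le>N. (LINT t|\<P>. f t * sin (real k * t))\<^sup>2) \<le> pi * (LINT t|\<P>. (f t)\<^sup>2)"
proof -
  have fg: "integrable \<P> (\<lambda>t. f t * g t)" if "g \<in> borel_measurable borel" "\<And>t. \<bar>g t\<bar> \<le> 1" for g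
    by (intro integrable_square_bounded_mult[OF finite_measure_0_pi] borel_measurable_0_pi f f2 that)
  show "(\<Sum>k\<le>N. (LINT t|\<P>. f t * cos (real k * t))\<^sup>2) \<le> pi * (LINT t|\<P>. (f t)\<^sup>2)"
  proof (rule Bessel_inequality[where \<phi> = "\<lambda>k t. cos (real k * t)" and w = "\<lambda>k. if k = 0 then pi else pi / 2"])
    show "integrable \<P> (\<lambda>t. cos (real j * t) * cos (real k * t))" for j k
      by (intro integrable_0_pi_continuous continuous_intros)
  qed (use f2 in \<open>auto simp: integral_0_pi integral_cos_cos intro!: fg\<close>)
  show "(\<Sum>k\<le>N. (LINT t|\<P>. f t * sin (real k * t))\<^sup>2) \<le> pi * (LINT t|\<P>. (f t)\<^sup>2)"
  proof (rule Bessel_inequality[where \<phi> = "\<lambda>k t. sin (real k * t)" and w = "\<lambda>k. if k = 0 then 0 else pi / 2"])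
    show "integrable \<P> (\<lambda>t. sin (real j * t) * sin (real k * t))" for j k
      by (intro integrable_0_pi_continuous continuous_intros)
  qed (use f2 in \<open>auto simp: integral_0_pi integral_sin_sin intro!: fg\<close>)
qed

definition fourier :: "(real \<Rightarrow> complex) \<Rightarrow> real \<Rightarrow> complex" where
  "fourier f \<tau> = (LINT t|lborel. cis (- \<tau> * t) * f t)"

lemma sum_le_suminf_ennreal: "(\<Sum>k\<le>N. f k) \<le> (\<Sum>k. f k :: ennreal)"
  by (rule sum_le_suminf) auto

text \<open>With \<open>f\<close> extended by zero, the coefficients at \<open>k\<close> and \<open>-k\<close> together carry the cosine and the
  sine coefficients on \<open>[0, \<pi>]\<close>. Each family is orthogonal there and the cosines are already complete,
  so both bounds hold, though not with sharp constants.\<close>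

lemma fourier_0_pi:
  fixes f :: "real \<Rightarrow> complex"
  assumes f: "f \<in> borel_measurable borel" and supp: "\<And>t. t \<notin> {0..pi} \<Longrightarrow> f t = 0"
    and fin: "(\<integral>\<^sup>+t. ennreal ((cmod (f t))\<^sup>2) \<partial>lborel) < \<infinity>"
  shows "(\<integral>\<^sup>+t. ennreal ((cmod (f t))\<^sup>2) \<partial>lborel) \<le>
      ennreal (1 / pi) * (\<Sum>k. ennreal ((cmod (fourier f (real k)))\<^sup>2 + (cmod (fourier f (- real k)))\<^sup>2))"
    and "(\<Sum>k. ennreal ((cmod (fourier f (real k)))\<^sup>2 + (cmod (fourier f (- real k)))\<^sup>2)) \<le>
      ennreal (4 * pi) * (\<integral>\<^sup>+t. ennreal ((cmod (f t))\<^sup>2) \<partial>lborel)"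
proof -
  interpret finite_measure \<P> by (rule finite_measure_0_pi)
  note [measurable] = f
  have restr: "(LINT t|lborel. g t * f t) = (LINT t|\<P>. g t * f t)" for g
    by (subst integral_restrict_space) (auto intro!: Bochner_Integration.integral_cong simp: indicator_def supp)
  have i: "integrable lborel (\<lambda>t. (cmod (f t))\<^sup>2)"
    using fin by (simp add: integrable_iff_bounded)
  have ind: "indicat_real {0..pi} t * (cmod (f t))\<^sup>2 = (cmod (f t))\<^sup>2" for t
    using supp[of t] by (auto simp: indicator_def)
  have iP: "integrable \<P> (\<lambda>t. (cmod (f t))\<^sup>2)"
    by (subst integrable_restrict_space) (use i in \<open>auto simp: ind\<close>)
  define I where "I = (LINT t|\<P>. (cmod (f t))\<^sup>2)"
  have I: "(\<integral>\<^sup>+t. ennreal ((cmod (f t))\<^sup>2) \<partial>lborel) = ennreal I"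
    unfolding I_def by (subst integral_restrict_space) (auto simp: ind nn_integral_eq_integral i)
  have f2: "integrable \<P> (\<lambda>t. (Re (f t))\<^sup>2)" "integrable \<P> (\<lambda>t. (Im (f t))\<^sup>2)"
    by (auto intro!: Bochner_Integration.integrable_bound[OF iP] borel_measurable_0_pi AE_I2 simp: cmod_power2)
  have I_ReIm: "I = (LINT t|\<P>. (Re (f t))\<^sup>2) + (LINT t|\<P>. (Im (f t))\<^sup>2)"
    unfolding I_def cmod_power2 using f2 by simp
  have fg: "integrable \<P> (\<lambda>t. Re (f t) * g t)" "integrable \<P> (\<lambda>t. Im (f t) * g t)"
    if "g \<in> borel_measurable borel" "\<And>t. \<bar>g t\<bar> \<le> 1" for g
    by (intro integrable_square_bounded_mult[OF finite_measure_0_pi] borel_measurable_0_pi f2 that; measurable)+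
  define A B A' B' where "A k = (LINT t|\<P>. Re (f t) * cos (real k * t))"
    and "B k = (LINT t|\<P>. Re (f t) * sin (real k * t))"
    and "A' k = (LINT t|\<P>. Im (f t) * cos (real k * t))"
    and "B' k = (LINT t|\<P>. Im (f t) * sin (real k * t))" for k :: nat
  have cis_int: "integrable \<P> (\<lambda>t. cis (- \<tau> * t) * f t)" for \<tau>
  proof (rule integrableI_bounded)
    show "(\<lambda>t. cis (- \<tau> * t) * f t) \<in> borel_measurable \<P>"
      by (intro borel_measurable_0_pi borel_measurable_times f borel_measurable_continuous_onI continuous_intros)
    have "integrable \<P> (\<lambda>t. (cmod (f t))\<^sup>2 + 1)" using iP by simp
    then have "(\<integral>\<^sup>+t. ennreal ((cmod (f t))\<^sup>2 + 1) \<partial>\<P>) < \<infinity>"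
      by (simp add: integrable_iff_bounded add_nonneg_nonneg)
    moreover have "(\<integral>\<^sup>+t. ennreal (norm (cis (- \<tau> * t) * f t)) \<partial>\<P>) \<le> (\<integral>\<^sup>+t. ennreal ((cmod (f t))\<^sup>2 + 1) \<partial>\<P>)"
    proof (intro nn_integral_mono ennreal_leI)
      fix t
      have "0 \<le> (cmod (f t) - 1)\<^sup>2" by simp
      then have "2 * cmod (f t) \<le> (cmod (f t))\<^sup>2 + 1" by (simp add: power2_diff)
      moreover have "0 \<le> cmod (f t)" by simp
      ultimately show "norm (cis (- \<tau> * t) * f t) \<le> (cmod (f t))\<^sup>2 + 1"
        by (simp only: norm_mult norm_cis)
    qed
    ultimately show "(\<integral>\<^sup>+t. ennreal (norm (cis (- \<tau> * t) * f t)) \<partial>\<P>) < \<infinity>" by (rule le_less_trans[rotated])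
  qed
  have Re_fou: "Re (fourier f \<tau>) = (LINT t|\<P>. Re (f t) * cos (\<tau> * t)) + (LINT t|\<P>. Im (f t) * sin (\<tau> * t))" for \<tau>
  proof -
    have "Re (fourier f \<tau>) = (LINT t|\<P>. Re (cis (- \<tau> * t) * f t))"
      unfolding fourier_def restr by (rule integral_Re[OF cis_int, symmetric])
    also have "\<dots> = (LINT t|\<P>. Re (f t) * cos (\<tau> * t) + Im (f t) * sin (\<tau> * t))"
      by (simp add: mult.commute)
    also have "\<dots> = (LINT t|\<P>. Re (f t) * cos (\<tau> * t)) + (LINT t|\<P>. Im (f t) * sin (\<tau> * t))"
      by (intro Bochner_Integration.integral_add fg) auto
    finally show ?thesis .
  qed
  have Im_fou: "Im (fourier f \<tau>) = (LINT t|\<P>. Im (f t) * cos (\<tau> * t)) - (LINT t|\<P>. Re (f t) * sin (\<tau> * t))" for \<tau>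
  proof -
    have "Im (fourier f \<tau>) = (LINT t|\<P>. Im (cis (- \<tau> * t) * f t))"
      unfolding fourier_def restr by (rule integral_Im[OF cis_int, symmetric])
    also have "\<dots> = (LINT t|\<P>. Im (f t) * cos (\<tau> * t) - Re (f t) * sin (\<tau> * t))"
      by (simp add: mult.commute)
    also have "\<dots> = (LINT t|\<P>. Im (f t) * cos (\<tau> * t)) - (LINT t|\<P>. Re (f t) * sin (\<tau> * t))"
      by (intro Bochner_Integration.integral_diff fg) auto
    finally show ?thesis .
  qed
  have fou: "fourier f (real k) = Complex (A k + B' k) (A' k - B k)"
    "fourier f (- real k) = Complex (A k - B' k) (A' k + B k)" for k
    by (simp_all add: complex_eq_iff Re_fou Im_fou A_def B_def A'_def B'_def)
  \<comment> \<open>Adding the frequencies \<open>k\<close> and \<open>-k\<close> cancels the mixed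
    terms between real and imaginary part. At \<open>k = 0\<close> the same coefficient is counted
    twice, on both sides of the later comparison.\<close>
  have par: "(cmod (fourier f (real k)))\<^sup>2 + (cmod (fourier f (- real k)))\<^sup>2
      = 2 * ((A k)\<^sup>2 + (B k)\<^sup>2 + (A' k)\<^sup>2 + (B' k)\<^sup>2)" for k
    unfolding fou by (simp add: cmod_power2) (simp add: power2_eq_square algebra_simps)
  \<comment> \<open>Each of the four families obeys a Bessel bound with factor \<open>pi\<close>;
    cosines and sines of one part together give \<open>2 * pi\<close>, and the factor 2 in front
    gives \<open>4 * pi\<close>.\<close>
  have "(\<Sum>k\<le>N. 2 * ((A k)\<^sup>2 + (B k)\<^sup>2 + (A' k)\<^sup>2 + (B' k)\<^sup>2)) \<le> 4 * pi * I" for N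
    using cos_sin_coefficients_upper_bound[of "\<lambda>t. Re (f t)" N] cos_sin_coefficients_upper_bound[of "\<lambda>t. Im (f t)" N] f2
    unfolding I_ReIm A_def[symmetric] B_def[symmetric] A'_def[symmetric] B'_def[symmetric]
    by (simp add: sum.distrib distrib_left flip: sum_distrib_left)
  then have bd: "(\<Sum>k\<le>N. ennreal (2 * ((A k)\<^sup>2 + (B k)\<^sup>2 + (A' k)\<^sup>2 + (B' k)\<^sup>2))) \<le> ennreal (4 * pi * I)" for N
    by (subst sum_ennreal) (auto intro!: ennreal_leI)
  then show "(\<Sum>k. ennreal ((cmod (fourier f (real k)))\<^sup>2 + (cmod (fourier f (- real k)))\<^sup>2)) \<le>
      ennreal (4 * pi) * (\<integral>\<^sup>+t. ennreal ((cmod (f t))\<^sup>2) \<partial>lborel)"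
    unfolding par I
  proof (intro suminf_le_const)
    fix N
    have "(\<Sum>k<N. ennreal (2 * ((A k)\<^sup>2 + (B k)\<^sup>2 + (A' k)\<^sup>2 + (B' k)\<^sup>2))) \<le>
        (\<Sum>k\<le>N. ennreal (2 * ((A k)\<^sup>2 + (B k)\<^sup>2 + (A' k)\<^sup>2 + (B' k)\<^sup>2)))"
      by (rule sum_mono2) auto
    also note bd
    also have "ennreal (4 * pi * I) = ennreal (4 * pi) * ennreal I"
      by (rule ennreal_mult) (auto simp: I_def)
    finally show "(\<Sum>k<N. ennreal (2 * ((A k)\<^sup>2 + (B k)\<^sup>2 + (A' k)\<^sup>2 + (B' k)\<^sup>2))) \<le> ennreal (4 * pi) * ennreal I" .
  qed simp
  show "(\<integral>\<^sup>+t. ennreal ((cmod (f t))\<^sup>2) \<partial>lborel) \<le>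
      ennreal (1 / pi) * (\<Sum>k. ennreal ((cmod (fourier f (real k)))\<^sup>2 + (cmod (fourier f (- real k)))\<^sup>2))"
    (is "_ \<le> _ * ?S")
    unfolding I
  proof (rule ennreal_le_epsilon)
    fix e :: real assume "e > 0"
    then have e2: "e / 2 > 0" by simp
    have "(\<lambda>t. Re (f t)) \<in> borel_measurable borel" "(\<lambda>t. Im (f t)) \<in> borel_measurable borel" by measurable
    note meas = this
    obtain N where
      N: "(LINT t|\<P>. (Re (f t))\<^sup>2) \<le> (2 / pi) * (\<Sum>k\<le>N. (A k)\<^sup>2) + e / 2"
      unfolding A_def by (rule cos_coefficients_lower_bound[OF meas(1) f2(1) e2])
    obtain N' where
      N': "(LINT t|\<P>. (Im (f t))\<^sup>2) \<le> (2 / pi) * (\<Sum>k\<le>N'. (A' k)\<^sup>2) + e / 2"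
      unfolding A'_def by (rule cos_coefficients_lower_bound[OF meas(2) f2(2) e2])
    let ?N = "max N N'"
    have "I \<le> (2 / pi) * (\<Sum>k\<le>?N. (A k)\<^sup>2) + (2 / pi) * (\<Sum>k\<le>?N. (A' k)\<^sup>2) + e"
    proof -
      have "(2 / pi) * (\<Sum>k\<le>N. (A k)\<^sup>2) \<le> (2 / pi) * (\<Sum>k\<le>?N. (A k)\<^sup>2)"
        "(2 / pi) * (\<Sum>k\<le>N'. (A' k)\<^sup>2) \<le> (2 / pi) * (\<Sum>k\<le>?N. (A' k)\<^sup>2)"
        by (intro mult_left_mono sum_mono2; simp)+
      then show ?thesis using N N' unfolding I_ReIm by linarith
    qed
    \<comment> \<open>Completeness of the cosines yields a bound by \<open>A\<close> and
      \<open>A'\<close> alone; the squares of the sine coefficients are nonnegative and may be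
      added.\<close>
    also have "\<dots> \<le> (1 / pi) * (\<Sum>k\<le>?N. 2 * ((A k)\<^sup>2 + (B k)\<^sup>2 + (A' k)\<^sup>2 + (B' k)\<^sup>2)) + e"
    proof -
      have "(2 / pi) * (\<Sum>k\<le>?N. (A k)\<^sup>2) + (2 / pi) * (\<Sum>k\<le>?N. (A' k)\<^sup>2)
          = (1 / pi) * (\<Sum>k\<le>?N. 2 * ((A k)\<^sup>2 + (A' k)\<^sup>2))"
        by (simp add: sum.distrib sum_distrib_left distrib_left)
      also have "\<dots> \<le> (1 / pi) * (\<Sum>k\<le>?N. 2 * ((A k)\<^sup>2 + (B k)\<^sup>2 + (A' k)\<^sup>2 + (B' k)\<^sup>2))"
        by (intro mult_left_mono sum_mono) auto
      finally show ?thesis by simp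
    qed
    finally have "ennreal I \<le> ennreal ((1 / pi) * (\<Sum>k\<le>?N. 2 * ((A k)\<^sup>2 + (B k)\<^sup>2 + (A' k)\<^sup>2 + (B' k)\<^sup>2)) + e)"
      by (rule ennreal_leI)
    also have "\<dots> = ennreal (1 / pi) * (\<Sum>k\<le>?N. ennreal (2 * ((A k)\<^sup>2 + (B k)\<^sup>2 + (A' k)\<^sup>2 + (B' k)\<^sup>2))) + ennreal e"
    proof -
      define X where "X = (\<Sum>k\<le>?N. 2 * ((A k)\<^sup>2 + (B k)\<^sup>2 + (A' k)\<^sup>2 + (B' k)\<^sup>2))"
      have "X \<ge> 0" unfolding X_def by (intro sum_nonneg) auto
      moreover have "(\<Sum>k\<le>?N. ennreal (2 * ((A k)\<^sup>2 + (B k)\<^sup>2 + (A' k)\<^sup>2 + (B' k)\<^sup>2))) = ennreal X"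
        unfolding X_def by (rule sum_ennreal) auto
      ultimately show ?thesis
        unfolding X_def[symmetric] using \<open>e > 0\<close> by (simp only: ennreal_plus ennreal_mult[of "1 / pi"] zero_le_divide_1_iff pi_ge_zero mult_nonneg_nonneg less_imp_le)
    qed
    also have "\<dots> \<le> ennreal (1 / pi) * ?S + ennreal e"
      unfolding par by (intro add_right_mono mult_left_mono sum_le_suminf_ennreal) auto
    finally show "ennreal I \<le> ennreal (1 / pi) * ?S + ennreal e" .
  qed
qed


text \<open>An affine substitution carries \<open>[0, pi]\<close> to the symmetric interval of
  length \<open>pi * c\<close>; the translation changes a coefficient only by a phase. The product
  of the two constants is 4 for every \<open>c\<close>, so that later the interval may grow without
  loss.\<close>

lemma fourier_frame:
  fixes f :: "real \<Rightarrow> complex"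
  assumes f: "f \<in> borel_measurable borel" and "c > 0"
    and supp: "\<And>t. t \<notin> {- (pi * c / 2)..pi * c / 2} \<Longrightarrow> f t = 0"
    and fin: "(\<integral>\<^sup>+t. ennreal ((cmod (f t))\<^sup>2) \<partial>lborel) < \<infinity>"
  shows "(\<integral>\<^sup>+t. ennreal ((cmod (f t))\<^sup>2) \<partial>lborel) \<le> ennreal (1 / (pi * c)) *
      (\<Sum>k. ennreal ((cmod (fourier f (real k / c)))\<^sup>2 + (cmod (fourier f (- (real k / c))))\<^sup>2))"
    and "(\<Sum>k. ennreal ((cmod (fourier f (real k / c)))\<^sup>2 + (cmod (fourier f (- (real k / c))))\<^sup>2)) \<le>
      ennreal (4 * pi * c) * (\<integral>\<^sup>+t. ennreal ((cmod (f t))\<^sup>2) \<partial>lborel)"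
proof -
  define d where "d = - (pi * c / 2)"
  define g where "g s = f (d + c * s)" for s
  note [measurable] = f
  have c: "c \<noteq> 0" "\<bar>c\<bar> = c" using \<open>c > 0\<close> by auto
  have g: "g \<in> borel_measurable borel" unfolding g_def by measurable
  have g_supp: "g s = 0" if "s \<notin> {0..pi}" for s
  proof -
    have "c * s < 0 \<or> c * pi < c * s" using that \<open>c > 0\<close> by (auto simp: mult_pos_neg)
    then show ?thesis unfolding g_def d_def by (intro supp) (auto simp: mult.commute)
  qed
  let ?I = "\<lambda>f. \<integral>\<^sup>+t. ennreal ((cmod (f t))\<^sup>2) \<partial>lborel"
  let ?S = "\<Sum>k. ennreal ((cmod (fourier f (real k / c)))\<^sup>2 + (cmod (fourier f (- (real k / c))))\<^sup>2)"
  let ?T = "\<Sum>k. ennreal ((cmod (fourier g (real k)))\<^sup>2 + (cmod (fourier g (- real k)))\<^sup>2)"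
  have I: "?I f = ennreal c * ?I g"
    unfolding g_def by (subst nn_integral_real_affine[OF _ c(1), of _ d]) (auto simp: c)
  then have fin_g: "?I g < \<infinity>"
    using fin \<open>c > 0\<close> by (auto simp: ennreal_mult_less_top ennreal_mult_eq_top_iff less_top)
  have F: "cmod (fourier f \<tau>) = c * cmod (fourier g (\<tau> * c))" for \<tau>
  proof -
    have "fourier f \<tau> = \<bar>c\<bar> *\<^sub>R (LINT s|lborel. cis (- \<tau> * (d + c * s)) * f (d + c * s))"
      unfolding fourier_def by (rule lborel_integral_real_affine[OF c(1)])
    also have "(LINT s|lborel. cis (- \<tau> * (d + c * s)) * f (d + c * s))
        = (LINT s|lborel. cis (- \<tau> * d) * (cis (- (\<tau> * c) * s) * g s))"
      by (simp add: g_def distrib_left cis_mult mult.assoc[symmetric])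
    also have "\<dots> = cis (- \<tau> * d) * fourier g (\<tau> * c)"
      unfolding fourier_def by (rule integral_mult_right_zero)
    finally show ?thesis by (simp add: norm_mult c)
  qed
  have S: "?S = ennreal (c\<^sup>2) * ?T"
  proof -
    have "ennreal ((c * x)\<^sup>2 + (c * y)\<^sup>2) = ennreal (c\<^sup>2) * ennreal (x\<^sup>2 + y\<^sup>2)" for x y
      by (subst ennreal_mult[symmetric]) (auto simp: power_mult_distrib distrib_left)
    then show ?thesis using \<open>c > 0\<close> by (simp add: F)
  qed
  note G = fourier_0_pi[OF g g_supp fin_g]
  have e1: "ennreal c * ennreal (1 / pi) = ennreal (1 / (pi * c)) * ennreal (c\<^sup>2)"
    using \<open>c > 0\<close> by (simp add: power2_eq_square flip: ennreal_mult)
  have "?I f \<le> ennreal c * (ennreal (1 / pi) * ?T)"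
    unfolding I by (intro mult_left_mono G) auto
  also have "\<dots> = ennreal (1 / (pi * c)) * ?S"
    unfolding S mult.assoc[symmetric] e1 ..
  finally show "?I f \<le> ennreal (1 / (pi * c)) * ?S" .
  have e2: "ennreal (c\<^sup>2) * ennreal (4 * pi) = ennreal (4 * pi * c) * ennreal c"
    using \<open>c > 0\<close> by (simp add: power2_eq_square mult_ac flip: ennreal_mult)
  have "?S \<le> ennreal (c\<^sup>2) * (ennreal (4 * pi) * ?I g)"
    unfolding S by (intro mult_left_mono G) auto
  also have "\<dots> = ennreal (4 * pi * c) * ?I f"
    unfolding I mult.assoc[symmetric] e2 ..
  finally show "?S \<le> ennreal (4 * pi * c) * ?I f" .
qed

section \<open>Square integrable functions and weak derivatives\<close>

lemma L2_iff:
  "f \<in> L2 M \<longleftrightarrow> f \<in> borel_measurable M \<and> (\<integral>\<^sup>+x. ennreal ((cmod (f x))\<^sup>2) \<partial>M) < \<infinity>"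
  by (auto simp: L2_def integrable_iff_bounded)

lemma L2_measurable: "f \<in> L2 M \<Longrightarrow> f \<in> borel_measurable M"
  by (simp add: L2_def)

lemma cmod_add_squared_le: "(cmod (a + b))\<^sup>2 \<le> 2 * (cmod a)\<^sup>2 + 2 * (cmod b)\<^sup>2"
proof -
  have "(cmod (a + b))\<^sup>2 \<le> (cmod a + cmod b)\<^sup>2" by (intro power_mono norm_triangle_ineq) auto
  also have "\<dots> \<le> 2 * (cmod a)\<^sup>2 + 2 * (cmod b)\<^sup>2"
    using zero_le_power2[of "cmod a - cmod b"] by (simp add: power2_eq_square algebra_simps)
  finally show ?thesis .
qed

lemma L2_add: assumes "f \<in> L2 M" "g \<in> L2 M" shows "(\<lambda>x. f x + g x) \<in> L2 M"
proof -
  have "integrable M (\<lambda>x. 2 * (cmod (f x))\<^sup>2 + 2 * (cmod (g x))\<^sup>2)"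
    using assms by (simp add: L2_def)
  then have "integrable M (\<lambda>x. (cmod (f x + g x))\<^sup>2)"
    by (rule Bochner_Integration.integrable_bound)
       (use assms cmod_add_squared_le in \<open>auto simp: L2_def\<close>)
  then show ?thesis using assms by (auto simp: L2_def)
qed

lemma L2_cmult: "f \<in> L2 M \<Longrightarrow> (\<lambda>x. c * f x) \<in> L2 M"
  by (auto simp: L2_def norm_mult power_mult_distrib)

lemma L2_zero: "(\<lambda>x. 0) \<in> L2 M"
  by (simp add: L2_def)

lemma L2_sum: "finite I \<Longrightarrow> (\<And>i. i \<in> I \<Longrightarrow> f i \<in> L2 M) \<Longrightarrow> (\<lambda>x. \<Sum>i\<in>I. f i x) \<in> L2 M"
  by (induction I rule: finite_induct) (auto intro: L2_add L2_zero)

lemma L2_bounded_mult: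
  assumes "f \<in> L2 M" "g \<in> borel_measurable M" "\<And>x. cmod (g x) \<le> B"
  shows "(\<lambda>x. g x * f x) \<in> L2 M"
proof -
  have "integrable M (\<lambda>x. B\<^sup>2 * (cmod (f x))\<^sup>2)" using assms by (simp add: L2_def)
  then have "integrable M (\<lambda>x. (cmod (g x * f x))\<^sup>2)"
  proof (rule Bochner_Integration.integrable_bound)
    show "AE x in M. norm ((cmod (g x * f x))\<^sup>2) \<le> norm (B\<^sup>2 * (cmod (f x))\<^sup>2)"
      by (rule AE_I2) (auto simp: norm_mult power_mult_distrib intro!: mult_right_mono power_mono assms(3))
  qed (use assms in \<open>auto simp: L2_def\<close>)
  then show ?thesis using assms by (auto simp: L2_def)
qed

lemma L2_indicator:
  assumes "K \<in> sets M" "emeasure M K < \<infinity>"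
  shows "(\<lambda>x. indicator K x :: complex) \<in> L2 M"
proof -
  have "(cmod (indicator K x))\<^sup>2 = indicat_real K x" for x by (simp add: indicator_def)
  then show ?thesis using assms by (simp add: L2_def)
qed

lemma L2_mult_integrable: assumes "f \<in> L2 M" "g \<in> L2 M" shows "integrable M (\<lambda>x. f x * g x)"
proof -
  have "integrable M (\<lambda>x. (cmod (f x))\<^sup>2 + (cmod (g x))\<^sup>2)" using assms by (simp add: L2_def)
  then show ?thesis
  proof (rule Bochner_Integration.integrable_bound)
    have "cmod a * cmod b \<le> (cmod a)\<^sup>2 + (cmod b)\<^sup>2" for a b
    proof -
      have "2 * (cmod a * cmod b) \<le> (cmod a)\<^sup>2 + (cmod b)\<^sup>2"
        using zero_le_power2[of "cmod a - cmod b"] by (simp add: power2_diff)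
      moreover have "0 \<le> cmod a * cmod b" by simp
      ultimately show ?thesis by linarith
    qed
    then show "AE x in M. norm (f x * g x) \<le> norm ((cmod (f x))\<^sup>2 + (cmod (g x))\<^sup>2)"
      by (auto simp: norm_mult intro!: AE_I2)
  qed (use assms in \<open>auto simp: L2_def\<close>)
qed

lemma L2_cong_AE:
  assumes "f \<in> L2 M" "g \<in> borel_measurable M" "AE x in M. f x = g x"
  shows "g \<in> L2 M"
proof -
  have "(\<integral>\<^sup>+x. ennreal ((cmod (f x))\<^sup>2) \<partial>M) = (\<integral>\<^sup>+x. ennreal ((cmod (g x))\<^sup>2) \<partial>M)"
    using assms(3) by (intro nn_integral_cong_AE) auto
  with assms show ?thesis by (simp add: L2_iff)
qed

lemma L2_lebesgue_iff_lborel: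
  "f \<in> borel_measurable borel \<Longrightarrow> f \<in> L2 lebesgue \<longleftrightarrow> f \<in> L2 lborel"
  by (simp add: L2_iff nn_integral_completion measurable_completion)

lemma L2_continuous_compact_support:
  fixes \<psi> :: "'a::euclidean_space \<Rightarrow> complex"
  assumes "continuous_on UNIV \<psi>" "\<And>x. cmod (\<psi> x) \<le> B" "\<And>x. x \<notin> K \<Longrightarrow> \<psi> x = 0" "bounded K"
  shows "\<psi> \<in> L2 lborel"
proof -
  obtain a where a: "K \<subseteq> cbox (-a) a" using bounded_subset_cbox_symmetric[OF assms(4)] by blast
  have "(\<lambda>x. indicator (cbox (-a) a) x :: complex) \<in> L2 lborel"
    by (rule L2_indicator) (use emeasure_bounded_finite[OF bounded_cbox] in auto)
  then have "(\<lambda>x. \<psi> x * indicator (cbox (-a) a) x) \<in> L2 lborel"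
    by (rule L2_bounded_mult[OF _ _ assms(2)]) (use assms(1) borel_measurable_continuous_onI in auto)
  moreover have "\<psi> x * indicator (cbox (-a) a) x = \<psi> x" for x
    using assms(3)[of x] a by (auto simp: indicator_def)
  ultimately show ?thesis by simp
qed

lemma test_function_L2:
  assumes "test_function \<phi>" shows "(\<lambda>x. complex_of_real (\<phi> x)) \<in> L2 lborel"
proof -
  obtain R where R: "\<And>x. x \<notin> cball 0 R \<Longrightarrow> \<phi> x = 0" using test_functionD[OF assms] by blast
  obtain B where B: "\<And>x. \<bar>\<phi> x\<bar> \<le> B" using test_function_bounded[OF assms] by blast
  show ?thesis
    by (rule L2_continuous_compact_support[where B = B and K = "cball 0 R"])
       (use R B test_function_continuous[OF assms] in \<open>auto intro!: continuous_intros\<close>)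
qed

lemma L2_loc_integrable: assumes "f \<in> L2 lebesgue" shows "loc_integrable f"
  unfolding loc_integrable_def
proof (intro allI impI)
  fix K :: "'a set" assume "compact K"
  then have "K \<in> sets lborel" by (simp add: borel_compact)
  then have "(\<lambda>x. indicator K x :: complex) \<in> L2 lebesgue"
    using emeasure_bounded_finite[OF compact_imp_bounded[OF \<open>compact K\<close>]]
    by (intro L2_indicator) (auto simp: emeasure_completion)
  from L2_mult_integrable[OF this assms] show "set_integrable lebesgue K f"
    unfolding set_integrable_def by (rule Bochner_Integration.integrable_cong[THEN iffD1, rotated -1]) (auto simp: indicator_def)
qed

section \<open>Weak derivatives up to null sets\<close>

text \<open>Weak derivatives see functions only through integrals against test functions. With
  \<open>b\<close> in \<open>Basis\<close> the derivative of a test function is one again, so both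
  sides of the defining identity are unchanged.\<close>

lemma has_weak_deriv_cong_AE:
  assumes "has_weak_deriv f g b" "AE x in lebesgue. f x = f' x" "AE x in lebesgue. g x = g' x"
    "f' \<in> borel_measurable lebesgue" "g' \<in> borel_measurable lebesgue" "b \<in> Basis"
  shows "has_weak_deriv f' g' b"
proof -
  have loc: "loc_integrable h'" if "loc_integrable h" "AE x in lebesgue. h x = h' x" "h' \<in> borel_measurable lebesgue" for h h' :: "'a \<Rightarrow> complex"
    unfolding loc_integrable_def set_integrable_def
  proof (intro allI impI)
    fix K :: "'a set" assume K: "compact K"
    then have [measurable]: "K \<in> sets lebesgue" by (simp add: borel_compact compact_imp_closed)
    note [measurable] = that(3)
    have "integrable lebesgue (\<lambda>x. indicat_real K x *\<^sub>R h x)"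
      using that(1) K by (simp add: loc_integrable_def set_integrable_def)
    then show "integrable lebesgue (\<lambda>x. indicat_real K x *\<^sub>R h' x)"
      by (rule integrable_cong_AE_imp) (use that(2) in \<open>auto elim: eventually_mono\<close>)
  qed
  have int: "(LINT x|lebesgue. \<phi> x *\<^sub>R h x) = (LINT x|lebesgue. \<phi> x *\<^sub>R h' x)"
    if "loc_integrable h" "AE x in lebesgue. h x = h' x" "h' \<in> borel_measurable lebesgue" "test_function \<phi>" for \<phi> and h h' :: "'a \<Rightarrow> complex"
  proof (rule integral_cong_AE)
    show "(\<lambda>x. \<phi> x *\<^sub>R h x) \<in> borel_measurable lebesgue" "(\<lambda>x. \<phi> x *\<^sub>R h' x) \<in> borel_measurable lebesgue"
      using integrable_test_function_mult[OF that(4)] that(1) loc[OF that(1-3)] by (auto intro: borel_measurable_integrable)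
  qed (use that(2) in \<open>auto elim: eventually_mono\<close>)
  have f: "loc_integrable f" and g: "loc_integrable g"
    and fg: "\<And>\<phi>. test_function \<phi> \<Longrightarrow> (LINT x|lebesgue. frechet_derivative \<phi> (at x) b *\<^sub>R f x) = - (LINT x|lebesgue. \<phi> x *\<^sub>R g x)"
    using assms(1) by (auto simp: has_weak_deriv_def)
  show ?thesis
    unfolding has_weak_deriv_def
  proof (intro conjI allI impI)
    fix \<phi> :: "'a \<Rightarrow> real" assume \<phi>: "test_function \<phi>"
    show "(LINT x|lebesgue. frechet_derivative \<phi> (at x) b *\<^sub>R f' x) = - (LINT x|lebesgue. \<phi> x *\<^sub>R g' x)"
      unfolding int[OF f assms(2,4) test_function_frechet_derivative[OF \<phi> assms(6)], symmetric]
        int[OF g assms(3,5) \<phi>, symmetric]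
      by (rule fg[OF \<phi>])
  qed (rule loc[OF f assms(2,4)], rule loc[OF g assms(3,5)])
qed

text \<open>This links a derivative found by computation to the unspecified choice made by
  \<open>wderiv\<close>.\<close>

lemma has_weak_deriv_unique:
  assumes "has_weak_deriv f g b" "has_weak_deriv f h b"
  shows "AE x in lebesgue. g x = h x"
proof -
  have g: "loc_integrable g" and h: "loc_integrable h" using assms by (auto simp: has_weak_deriv_def)
  have "AE x in lebesgue. g x - h x = 0"
  proof (rule du_Bois_Reymond)
    show "loc_integrable (\<lambda>x. g x - h x)"
      using g h unfolding loc_integrable_def by (auto intro: set_integral_diff)
    fix \<phi> :: "'a \<Rightarrow> real" assume \<phi>: "test_function \<phi>"
    have "(LINT x|lebesgue. \<phi> x *\<^sub>R g x) = (LINT x|lebesgue. \<phi> x *\<^sub>R h x)"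
      using assms \<phi> unfolding has_weak_deriv_def by (metis neg_equal_iff_equal)
    then show "(LINT x|lebesgue. \<phi> x *\<^sub>R (g x - h x)) = 0"
      using integrable_test_function_mult[OF \<phi> g] integrable_test_function_mult[OF \<phi> h]
      by (simp add: scaleR_diff_right)
  qed
  then show ?thesis by simp
qed

lemma has_weak_deriv_wderiv: "\<exists>g. has_weak_deriv f g b \<Longrightarrow> has_weak_deriv f (wderiv b f) b"
  unfolding wderiv_def by (elim exE) (rule someI[where P = "\<lambda>g. has_weak_deriv f g b"])

section \<open>Integration against functions of time\<close>

text \<open>With \<open>\<psi>\<close> a cutoff times \<open>cis (- \<tau> * t)\<close> this is the
  Fourier coefficient in time of the cut-off function. A general \<open>\<psi>\<close> lets time
  derivatives be moved from \<open>h\<close> to \<open>\<psi>\<close>.\<close>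

definition slice :: "(real \<Rightarrow> complex) \<Rightarrow> ('a \<times> real \<Rightarrow> complex) \<Rightarrow> 'a \<Rightarrow> complex" where
  "slice \<psi> h x = (LINT t|lborel. \<psi> t * h (x, t))"

lemma slice_measurable:
  fixes h :: "'a::euclidean_space \<times> real \<Rightarrow> complex"
  assumes [measurable]: "\<psi> \<in> borel_measurable borel" "h \<in> borel_measurable borel"
  shows "slice \<psi> h \<in> borel_measurable borel"
proof -
  have "h \<in> borel_measurable (borel \<Otimes>\<^sub>M borel)" by (simp add: borel_prod)
  then have [measurable]: "h \<in> borel_measurable (borel \<Otimes>\<^sub>M lborel)"
    by (simp cong: measurable_cong_sets)
  show ?thesis
    unfolding slice_def
    by (rule sigma_finite_measure.borel_measurable_lebesgue_integral[OF sigma_finite_lborel]) measurable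
qed

lemma nn_integral_lborel_pair:
  fixes f :: "'a::euclidean_space \<times> real \<Rightarrow> ennreal"
  assumes "f \<in> borel_measurable borel"
  shows "(\<integral>\<^sup>+x. \<integral>\<^sup>+t. f (x, t) \<partial>lborel \<partial>lborel) = (\<integral>\<^sup>+y. f y \<partial>lborel)"
proof -
  have "f \<in> borel_measurable (lborel \<Otimes>\<^sub>M lborel)" using assms by (simp add: lborel_prod)
  from sigma_finite_measure.nn_integral_fst[OF sigma_finite_lborel this]
  show ?thesis by (simp add: lborel_prod)
qed

lemma L2_AE_slice:
  fixes h :: "'a::euclidean_space \<times> real \<Rightarrow> complex"
  assumes "h \<in> L2 lborel"
  shows "AE x in lborel. (\<lambda>t. h (x, t)) \<in> L2 lborel"
proof -
  have [measurable]: "h \<in> borel_measurable borel" using L2_measurable[OF assms] by simp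
  have "h \<in> borel_measurable (borel \<Otimes>\<^sub>M borel)" by (simp add: borel_prod)
  then have [measurable]: "(\<lambda>t. h (x, t)) \<in> borel_measurable borel" for x by measurable
  have m: "(\<lambda>x. \<integral>\<^sup>+t. ennreal ((cmod (h (x, t)))\<^sup>2) \<partial>lborel) \<in> borel_measurable lborel"
    by (intro sigma_finite_measure.borel_measurable_nn_integral_fst[OF sigma_finite_lborel, of "\<lambda>y. ennreal ((cmod (h y))\<^sup>2)", simplified])
       (simp add: lborel_prod)
  have "(\<integral>\<^sup>+x. \<integral>\<^sup>+t. ennreal ((cmod (h (x, t)))\<^sup>2) \<partial>lborel \<partial>lborel) < \<infinity>"
    using assms by (subst nn_integral_lborel_pair[of "\<lambda>y. ennreal ((cmod (h y))\<^sup>2)"]) (auto simp: L2_iff)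
  then have "AE x in lborel. (\<integral>\<^sup>+t. ennreal ((cmod (h (x, t)))\<^sup>2) \<partial>lborel) \<noteq> \<infinity>"
    by (intro nn_integral_PInf_AE m) auto
  then show ?thesis by eventually_elim (simp add: L2_iff less_top)
qed

text \<open>Cauchy-Schwarz in time at a fixed \<open>x\<close>. In extended nonnegative reals it
  holds for every \<open>x\<close>, also where the section of \<open>h\<close> has infinite
  norm.\<close>

lemma slice_bound:
  fixes h :: "'a::euclidean_space \<times> real \<Rightarrow> complex"
  assumes [measurable]: "\<psi> \<in> borel_measurable borel" "h \<in> borel_measurable borel"
  shows "ennreal ((cmod (slice \<psi> h x))\<^sup>2) \<le>
    (\<integral>\<^sup>+t. ennreal ((cmod (\<psi> t))\<^sup>2) \<partial>lborel) * (\<integral>\<^sup>+t. ennreal ((cmod (h (x, t)))\<^sup>2) \<partial>lborel)"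
proof -
  have "h \<in> borel_measurable (borel \<Otimes>\<^sub>M borel)" by (simp add: borel_prod)
  then have [measurable]: "(\<lambda>t. h (x, t)) \<in> borel_measurable borel" by measurable
  have "ennreal (cmod (slice \<psi> h x)) \<le> (\<integral>\<^sup>+t. ennreal (cmod (\<psi> t * h (x, t))) \<partial>lborel)"
  \<comment> \<open>Without integrability the Bochner integral has the default value 0, and the
    bound is trivial.\<close>
  proof (cases "integrable lborel (\<lambda>t. \<psi> t * h (x, t))")
    case True
    then show ?thesis unfolding slice_def by (rule integral_norm_bound_ennreal)
  qed (simp add: slice_def not_integrable_integral_eq)
  then have "ennreal (cmod (slice \<psi> h x)) \<le> (\<integral>\<^sup>+t. ennreal (cmod (\<psi> t)) * ennreal (cmod (h (x, t))) \<partial>lborel)"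
    by (simp add: norm_mult ennreal_mult)
  then have "(ennreal (cmod (slice \<psi> h x)))\<^sup>2 \<le> (\<integral>\<^sup>+t. ennreal (cmod (\<psi> t)) * ennreal (cmod (h (x, t))) \<partial>lborel)\<^sup>2"
    by (intro power_mono) auto
  also have "\<dots> \<le> (\<integral>\<^sup>+t. (ennreal (cmod (\<psi> t)))\<^sup>2 \<partial>lborel) * (\<integral>\<^sup>+t. (ennreal (cmod (h (x, t))))\<^sup>2 \<partial>lborel)"
    by (rule Cauchy_Schwarz_nn_integral) auto
  finally show ?thesis by (simp add: ennreal_power)
qed

text \<open>A weight in \<open>x\<close> alone passes through the time integral.
  \<open>W = 1\<close> gives square integrability of slices, and the inverse potential gives their
  finite weighted norm.\<close>

lemma nn_integral_slice_bound:
  fixes h :: "'a::euclidean_space \<times> real \<Rightarrow> complex"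
  assumes [measurable]: "\<psi> \<in> borel_measurable borel" "h \<in> borel_measurable borel" "W \<in> borel_measurable borel"
  shows "(\<integral>\<^sup>+x. W x * ennreal ((cmod (slice \<psi> h x))\<^sup>2) \<partial>lborel) \<le>
    (\<integral>\<^sup>+t. ennreal ((cmod (\<psi> t))\<^sup>2) \<partial>lborel) * (\<integral>\<^sup>+y. W (fst y) * ennreal ((cmod (h y))\<^sup>2) \<partial>lborel)"
proof -
  let ?K = "\<integral>\<^sup>+t. ennreal ((cmod (\<psi> t))\<^sup>2) \<partial>lborel"
  have h: "h \<in> borel_measurable (borel \<Otimes>\<^sub>M borel)" by (simp add: borel_prod)
  then have [measurable]: "(\<lambda>t. h (x, t)) \<in> borel_measurable borel" for x by measurable
  have [measurable]: "(\<lambda>y. W (fst y)) \<in> borel_measurable (borel :: ('a \<times> real) measure)"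
    unfolding borel_prod[symmetric] by measurable
  have m: "(\<lambda>x. \<integral>\<^sup>+t. W x * ennreal ((cmod (h (x, t)))\<^sup>2) \<partial>lborel) \<in> borel_measurable lborel"
    by (intro sigma_finite_measure.borel_measurable_nn_integral_fst[OF sigma_finite_lborel, of "\<lambda>y. W (fst y) * ennreal ((cmod (h y))\<^sup>2)", simplified])
       (simp add: lborel_prod)
  have "(\<integral>\<^sup>+x. W x * ennreal ((cmod (slice \<psi> h x))\<^sup>2) \<partial>lborel) \<le>
      (\<integral>\<^sup>+x. ?K * (\<integral>\<^sup>+t. W x * ennreal ((cmod (h (x, t)))\<^sup>2) \<partial>lborel) \<partial>lborel)"
  proof (rule nn_integral_mono)
    fix x
    have "W x * ennreal ((cmod (slice \<psi> h x))\<^sup>2) \<le> W x * (?K * (\<integral>\<^sup>+t. ennreal ((cmod (h (x, t)))\<^sup>2) \<partial>lborel))"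
      by (intro mult_left_mono slice_bound) auto
    also have "\<dots> = ?K * (\<integral>\<^sup>+t. W x * ennreal ((cmod (h (x, t)))\<^sup>2) \<partial>lborel)"
      by (subst nn_integral_cmult) (auto simp: mult.left_commute)
    finally show "W x * ennreal ((cmod (slice \<psi> h x))\<^sup>2) \<le> ?K * (\<integral>\<^sup>+t. W x * ennreal ((cmod (h (x, t)))\<^sup>2) \<partial>lborel)" .
  qed
  also have "\<dots> = ?K * (\<integral>\<^sup>+x. \<integral>\<^sup>+t. W x * ennreal ((cmod (h (x, t)))\<^sup>2) \<partial>lborel \<partial>lborel)"
    by (rule nn_integral_cmult[OF m])
  also have "(\<integral>\<^sup>+x. \<integral>\<^sup>+t. W x * ennreal ((cmod (h (x, t)))\<^sup>2) \<partial>lborel \<partial>lborel)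
      = (\<integral>\<^sup>+y. W (fst y) * ennreal ((cmod (h y))\<^sup>2) \<partial>lborel)"
    using nn_integral_lborel_pair[of "\<lambda>y. W (fst y) * ennreal ((cmod (h y))\<^sup>2)"] by simp
  finally show ?thesis .
qed

lemma slice_L2:
  fixes h :: "'a::euclidean_space \<times> real \<Rightarrow> complex"
  assumes "\<psi> \<in> L2 lborel" "h \<in> L2 lborel"
  shows "slice \<psi> h \<in> L2 lborel"
proof -
  have m: "\<psi> \<in> borel_measurable borel" "h \<in> borel_measurable borel"
    using assms by (auto simp: L2_def)
  have "(\<integral>\<^sup>+x. ennreal ((cmod (slice \<psi> h x))\<^sup>2) \<partial>lborel) \<le>
    (\<integral>\<^sup>+t. ennreal ((cmod (\<psi> t))\<^sup>2) \<partial>lborel) * (\<integral>\<^sup>+y. ennreal ((cmod (h y))\<^sup>2) \<partial>lborel)"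
    using nn_integral_slice_bound[OF m, of "\<lambda>_. 1"] by simp
  also have "\<dots> < \<infinity>" using assms by (simp add: L2_iff ennreal_mult_less_top)
  finally show ?thesis using slice_measurable[OF m] by (simp add: L2_iff)
qed

lemma L2_tensor:
  fixes \<phi> :: "'a::euclidean_space \<Rightarrow> complex" and \<psi> :: "real \<Rightarrow> complex"
  assumes "\<phi> \<in> L2 lborel" "\<psi> \<in> L2 lborel"
  shows "(\<lambda>y. \<phi> (fst y) * \<psi> (snd y)) \<in> L2 lborel"
proof -
  have [measurable]: "\<phi> \<in> borel_measurable borel" "\<psi> \<in> borel_measurable borel"
    using assms by (auto simp: L2_def)
  have [measurable]: "(\<lambda>y. \<phi> (fst y) * \<psi> (snd y)) \<in> borel_measurable borel"
    unfolding borel_prod[symmetric] by measurable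
  have "(\<lambda>y. ennreal ((cmod (\<phi> (fst y) * \<psi> (snd y)))\<^sup>2)) \<in> borel_measurable borel"
    by measurable
  from nn_integral_lborel_pair[OF this, symmetric]
  have "(\<integral>\<^sup>+y. ennreal ((cmod (\<phi> (fst y) * \<psi> (snd y)))\<^sup>2) \<partial>lborel) =
      (\<integral>\<^sup>+x. \<integral>\<^sup>+t. ennreal ((cmod (\<phi> x))\<^sup>2) * ennreal ((cmod (\<psi> t))\<^sup>2) \<partial>lborel \<partial>lborel)"
    by (simp add: norm_mult power_mult_distrib ennreal_mult)
  also have "\<dots> = (\<integral>\<^sup>+x. ennreal ((cmod (\<phi> x))\<^sup>2) \<partial>lborel) * (\<integral>\<^sup>+t. ennreal ((cmod (\<psi> t))\<^sup>2) \<partial>lborel)"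
    by (simp add: nn_integral_cmult nn_integral_multc)
  also have "\<dots> < \<infinity>" using assms by (simp add: L2_iff ennreal_mult_less_top)
  finally show ?thesis by (simp add: L2_iff)
qed

lemma integral_slice:
  fixes h :: "'a::euclidean_space \<times> real \<Rightarrow> complex"
  assumes "\<phi> \<in> L2 lborel" "\<psi> \<in> L2 lborel" "h \<in> L2 lborel"
  shows "(LINT x|lborel. \<phi> x * slice \<psi> h x) = (LINT y|lborel. \<phi> (fst y) * \<psi> (snd y) * h y)"
proof -
  have i: "integrable (lborel \<Otimes>\<^sub>M lborel) (\<lambda>y. \<phi> (fst y) * \<psi> (snd y) * h y)"
    using L2_mult_integrable[OF L2_tensor[OF assms(1,2)] assms(3)] by (simp add: lborel_prod)
  have "(LINT x|lborel. \<phi> x * slice \<psi> h x) = (LINT x|lborel. LINT t|lborel. \<phi> x * \<psi> t * h (x, t))"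
    by (simp add: slice_def mult.assoc)
  also have "\<dots> = (LINT y|lborel. \<phi> (fst y) * \<psi> (snd y) * h y)"
    using lborel_pair.integral_fst'[OF i] by (simp add: lborel_prod)
  finally show ?thesis .
qed

section \<open>Weak derivatives tested against products of space and time functions\<close>

lemma test_function_tensor:
  fixes \<phi> :: "'a::euclidean_space \<Rightarrow> real" and \<eta> :: "real \<Rightarrow> real"
  assumes "test_function \<phi>" "test_function \<eta>"
  shows "test_function (\<lambda>y. \<phi> (fst y) * \<eta> (snd y))"
proof -
  obtain R where R: "\<And>x. x \<notin> cball 0 R \<Longrightarrow> \<phi> x = 0" using test_functionD[OF assms(1)] by blast
  obtain S where S: "\<And>x. x \<notin> cball 0 S \<Longrightarrow> \<eta> x = 0" using test_functionD[OF assms(2)] by blast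
  show ?thesis
  proof (rule test_functionI[where K = "cball 0 R \<times> cball 0 S"])
    fix k
    have "Ck k (\<lambda>y::'a \<times> real. \<phi> (fst y + 0))" "Ck k (\<lambda>y::'a \<times> real. \<eta> (snd y + 0))"
      using assms by (intro Ck_compose_affine bounded_linear_fst bounded_linear_snd; simp add: test_function_def)+
    then show "Ck k (\<lambda>y. \<phi> (fst y) * \<eta> (snd y))" by (intro Ck_mult) auto
  next
    fix y :: "'a \<times> real" assume "y \<notin> cball 0 R \<times> cball 0 S"
    then show "\<phi> (fst y) * \<eta> (snd y) = 0" using R S by (cases y) force
  qed (auto intro: bounded_Times)
qed

lemma test_function_has_derivative:
  "test_function \<phi> \<Longrightarrow> (\<phi> has_derivative frechet_derivative \<phi> (at x)) (at x)"
  unfolding test_function_def by (metis Ck_SucD(1))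

lemma test_function_has_real_derivative:
  fixes \<eta> :: "real \<Rightarrow> real"
  shows "test_function \<eta> \<Longrightarrow> (\<eta> has_real_derivative deriv \<eta> t) (at t)"
  unfolding test_function_def by (metis Ck_SucD_real(1))

lemma test_function_deriv:
  fixes \<eta> :: "real \<Rightarrow> real"
  assumes "test_function \<eta>" shows "test_function (deriv \<eta>)"
proof -
  have "frechet_derivative \<eta> (at t) 1 = deriv \<eta> t" for t
    using frechet_derivative_eqI[OF test_function_has_real_derivative[OF assms, of t, unfolded has_field_derivative_def]]
    by simp
  then show ?thesis using test_function_frechet_derivative[OF assms, of 1] by simp
qed

lemma frechet_derivative_tensor:
  fixes \<phi> :: "'a::euclidean_space \<Rightarrow> real" and \<eta> :: "real \<Rightarrow> real"
  assumes "test_function \<phi>" "test_function \<eta>"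
  shows "frechet_derivative (\<lambda>y. \<phi> (fst y) * \<eta> (snd y)) (at y) (b, 0) = frechet_derivative \<phi> (at (fst y)) b * \<eta> (snd y)"
    and "frechet_derivative (\<lambda>y. \<phi> (fst y) * \<eta> (snd y)) (at y) (0, 1) = \<phi> (fst y) * deriv \<eta> (snd y)"
proof -
  let ?D = "\<lambda>h. \<phi> (fst y) * (deriv \<eta> (snd y) * snd h) + frechet_derivative \<phi> (at (fst y)) (fst h) * \<eta> (snd y)"
  have 1: "((\<lambda>y. \<phi> (fst y)) has_derivative (\<lambda>h. frechet_derivative \<phi> (at (fst y)) (fst h))) (at y)"
    by (rule has_derivative_compose[OF has_derivative_fst[OF has_derivative_ident] test_function_has_derivative[OF assms(1)]])
  have 2: "((\<lambda>y. \<eta> (snd y)) has_derivative (\<lambda>h. deriv \<eta> (snd y) * snd h)) (at y)"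
    by (rule has_derivative_compose[OF has_derivative_snd[OF has_derivative_ident]
          test_function_has_real_derivative[OF assms(2), unfolded has_field_derivative_def]])
  have D: "frechet_derivative (\<lambda>y. \<phi> (fst y) * \<eta> (snd y)) (at y) = ?D"
    by (rule frechet_derivative_eqI[OF has_derivative_mult[OF 1 2]])
  have "frechet_derivative \<phi> (at (fst y)) 0 = 0"
    using test_function_has_derivative[OF assms(1)] by (intro linear_0 has_derivative_linear)
  then show "frechet_derivative (\<lambda>y. \<phi> (fst y) * \<eta> (snd y)) (at y) (b, 0) = frechet_derivative \<phi> (at (fst y)) b * \<eta> (snd y)"
    "frechet_derivative (\<lambda>y. \<phi> (fst y) * \<eta> (snd y)) (at y) (0, 1) = \<phi> (fst y) * deriv \<eta> (snd y)"
    by (auto simp: D)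
qed

text \<open>Test functions are real, while cutoffs modulated by \<open>cis\<close> are complex;
  identities extend to them by linearity in real and imaginary part.\<close>

definition complex_test_function :: "(real \<Rightarrow> complex) \<Rightarrow> bool" where
  "complex_test_function \<psi> \<longleftrightarrow> test_function (\<lambda>t. Re (\<psi> t)) \<and> test_function (\<lambda>t. Im (\<psi> t))"

lemma complex_test_function_L2:
  assumes "complex_test_function \<psi>" shows "\<psi> \<in> L2 lborel"
proof -
  have "(\<lambda>t. complex_of_real (Re (\<psi> t)) + \<i> * complex_of_real (Im (\<psi> t))) \<in> L2 lborel"
    using assms unfolding complex_test_function_def by (intro L2_add L2_cmult test_function_L2) auto
  then show ?thesis by (simp flip: complex_eq)
qed

lemma integral_tensor_Re_Im:
  fixes h :: "'a::euclidean_space \<times> real \<Rightarrow> complex"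
  assumes "\<phi> \<in> L2 lborel" "complex_test_function \<psi>" "h \<in> L2 lborel"
  shows "(LINT y|lborel. \<phi> (fst y) * \<psi> (snd y) * h y) =
    (LINT y|lborel. \<phi> (fst y) * complex_of_real (Re (\<psi> (snd y))) * h y)
    + \<i> * (LINT y|lborel. \<phi> (fst y) * complex_of_real (Im (\<psi> (snd y))) * h y)"
proof -
  have i: "integrable lborel (\<lambda>y. \<phi> (fst y) * complex_of_real (\<eta> (snd y)) * h y)"
    if "test_function \<eta>" for \<eta> :: "real \<Rightarrow> real"
    by (rule L2_mult_integrable[OF L2_tensor[OF assms(1) test_function_L2[OF that]] assms(3)])
  have "(LINT y|lborel. \<phi> (fst y) * \<psi> (snd y) * h y) =
    (LINT y|lborel. \<phi> (fst y) * complex_of_real (Re (\<psi> (snd y))) * h y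
      + \<i> * (\<phi> (fst y) * complex_of_real (Im (\<psi> (snd y))) * h y))"
    by (intro Bochner_Integration.integral_cong refl) (subst complex_eq, simp add: algebra_simps)
  then show ?thesis
    using i[of "\<lambda>t. Re (\<psi> t)"] i[of "\<lambda>t. Im (\<psi> t)"] assms(2) by (simp add: complex_test_function_def)
qed

lemma integral_test_function_lebesgue:
  fixes g :: "'a::euclidean_space \<Rightarrow> complex"
  assumes "test_function \<phi>" "g \<in> borel_measurable borel"
  shows "(LINT x|lebesgue. \<phi> x *\<^sub>R g x) = (LINT x|lborel. complex_of_real (\<phi> x) * g x)"
proof -
  have [measurable]: "\<phi> \<in> borel_measurable borel"
    using test_function_continuous[OF assms(1)] by (rule borel_measurable_continuous_onI)
  note [measurable] = assms(2)
  have "(LINT x|lebesgue. \<phi> x *\<^sub>R g x) = (LINT x|lborel. \<phi> x *\<^sub>R g x)"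
    by (rule integral_completion) simp
  then show ?thesis by (simp add: scaleR_conv_of_real)
qed

lemma has_weak_deriv_space_tensor:
  fixes h w :: "'a::euclidean_space \<times> real \<Rightarrow> complex"
  assumes hw: "has_weak_deriv h w (b, 0)" and h: "h \<in> L2 lborel" and w: "w \<in> L2 lborel"
    and \<psi>: "complex_test_function \<psi>" and \<phi>: "test_function \<phi>" and b: "b \<in> Basis"
  shows "(LINT y|lborel. complex_of_real (frechet_derivative \<phi> (at (fst y)) b) * \<psi> (snd y) * h y) =
    - (LINT y|lborel. complex_of_real (\<phi> (fst y)) * \<psi> (snd y) * w y)"
proof -
  have m: "h \<in> borel_measurable borel" "w \<in> borel_measurable borel" using h w by (auto simp: L2_def)
  have b0: "(b, 0) \<in> (Basis :: ('a \<times> real) set)" using b by (simp add: Basis_prod_def)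
  have R: "(LINT y|lborel. complex_of_real (frechet_derivative \<phi> (at (fst y)) b) * complex_of_real (\<eta> (snd y)) * h y) =
    - (LINT y|lborel. complex_of_real (\<phi> (fst y)) * complex_of_real (\<eta> (snd y)) * w y)"
    if \<eta>: "test_function \<eta>" for \<eta> :: "real \<Rightarrow> real"
  proof -
    have t: "test_function (\<lambda>y. \<phi> (fst y) * \<eta> (snd y))" by (rule test_function_tensor[OF \<phi> \<eta>])
    have "(LINT y|lebesgue. frechet_derivative (\<lambda>y. \<phi> (fst y) * \<eta> (snd y)) (at y) (b, 0) *\<^sub>R h y) =
        - (LINT y|lebesgue. (\<phi> (fst y) * \<eta> (snd y)) *\<^sub>R w y)"
      using hw t unfolding has_weak_deriv_def by blast
    then show ?thesis
      unfolding integral_test_function_lebesgue[OF t m(2)]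
        integral_test_function_lebesgue[OF test_function_frechet_derivative[OF t b0] m(1)]
      by (simp add: frechet_derivative_tensor[OF \<phi> \<eta>])
  qed
  show ?thesis
    using \<psi> R[of "\<lambda>t. Re (\<psi> t)"] R[of "\<lambda>t. Im (\<psi> t)"]
    unfolding integral_tensor_Re_Im[OF test_function_L2[OF test_function_frechet_derivative[OF \<phi> b]] \<psi> h]
      integral_tensor_Re_Im[OF test_function_L2[OF \<phi>] \<psi> w]
    by (simp add: complex_test_function_def)
qed

lemma has_weak_deriv_time_tensor:
  fixes h w :: "'a::euclidean_space \<times> real \<Rightarrow> complex"
  assumes hw: "has_weak_deriv h w (0, 1)" and h: "h \<in> L2 lborel" and w: "w \<in> L2 lborel"
    and \<psi>: "complex_test_function \<psi>" and \<psi>': "\<And>t. (\<psi> has_vector_derivative \<psi>' t) (at t)"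
    and \<phi>: "test_function \<phi>"
  shows "complex_test_function \<psi>'"
    and "(LINT y|lborel. complex_of_real (\<phi> (fst y)) * \<psi>' (snd y) * h y) =
    - (LINT y|lborel. complex_of_real (\<phi> (fst y)) * \<psi> (snd y) * w y)"
proof -
  have m: "h \<in> borel_measurable borel" "w \<in> borel_measurable borel" using h w by (auto simp: L2_def)
  have b0: "(0, 1) \<in> (Basis :: ('a \<times> real) set)" by (simp add: Basis_prod_def)
  have d: "Re (\<psi>' t) = deriv (\<lambda>t. Re (\<psi> t)) t" "Im (\<psi>' t) = deriv (\<lambda>t. Im (\<psi> t)) t" for t
    using bounded_linear.has_vector_derivative[OF bounded_linear_Re \<psi>'[of t]]
      bounded_linear.has_vector_derivative[OF bounded_linear_Im \<psi>'[of t]]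
    by (auto intro!: DERIV_imp_deriv[symmetric] simp: has_real_derivative_iff_has_vector_derivative)
  show \<psi>'_test: "complex_test_function \<psi>'"
    using \<psi> test_function_deriv unfolding complex_test_function_def d by blast
  have R: "(LINT y|lborel. complex_of_real (\<phi> (fst y)) * complex_of_real (deriv \<eta> (snd y)) * h y) =
    - (LINT y|lborel. complex_of_real (\<phi> (fst y)) * complex_of_real (\<eta> (snd y)) * w y)"
    if \<eta>: "test_function \<eta>" for \<eta> :: "real \<Rightarrow> real"
  proof -
    have t: "test_function (\<lambda>y. \<phi> (fst y) * \<eta> (snd y))" by (rule test_function_tensor[OF \<phi> \<eta>])
    have "(LINT y|lebesgue. frechet_derivative (\<lambda>y. \<phi> (fst y) * \<eta> (snd y)) (at y) (0, 1) *\<^sub>R h y) =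
        - (LINT y|lebesgue. (\<phi> (fst y) * \<eta> (snd y)) *\<^sub>R w y)"
      using hw t unfolding has_weak_deriv_def by blast
    then show ?thesis
      unfolding integral_test_function_lebesgue[OF t m(2)]
        integral_test_function_lebesgue[OF test_function_frechet_derivative[OF t b0] m(1)]
      by (simp add: frechet_derivative_tensor[OF \<phi> \<eta>])
  qed
  show "(LINT y|lborel. complex_of_real (\<phi> (fst y)) * \<psi>' (snd y) * h y) =
    - (LINT y|lborel. complex_of_real (\<phi> (fst y)) * \<psi> (snd y) * w y)"
    using \<psi> R[of "\<lambda>t. Re (\<psi> t)"] R[of "\<lambda>t. Im (\<psi> t)"]
    unfolding integral_tensor_Re_Im[OF test_function_L2[OF \<phi>] \<psi>'_test h]
      integral_tensor_Re_Im[OF test_function_L2[OF \<phi>] \<psi> w]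
    by (simp add: complex_test_function_def d)
qed

text \<open>By Fubini, testing a slice with \<open>\<phi>\<close> is testing \<open>h\<close> with
  the product of \<open>\<phi>\<close> and \<open>\<psi>\<close>, and a spatial derivative falls on
  \<open>\<phi>\<close> alone.\<close>

lemma has_weak_deriv_slice:
  fixes h w :: "'a::euclidean_space \<times> real \<Rightarrow> complex"
  assumes hw: "has_weak_deriv h w (b, 0)" and h: "h \<in> L2 lborel" and w: "w \<in> L2 lborel"
    and \<psi>: "complex_test_function \<psi>" and b: "b \<in> Basis"
  shows "has_weak_deriv (slice \<psi> h) (slice \<psi> w) b"
  unfolding has_weak_deriv_def
proof (intro conjI allI impI)
  note \<psi>2 = complex_test_function_L2[OF \<psi>]
  have s: "slice \<psi> h \<in> L2 lborel" "slice \<psi> w \<in> L2 lborel"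
    using slice_L2[OF \<psi>2] h w by auto
  then have sm: "slice \<psi> h \<in> borel_measurable borel" "slice \<psi> w \<in> borel_measurable borel"
    by (auto simp: L2_def)
  show "loc_integrable (slice \<psi> h)" "loc_integrable (slice \<psi> w)"
    using s sm by (auto intro!: L2_loc_integrable simp: L2_lebesgue_iff_lborel)
  fix \<phi> :: "'a \<Rightarrow> real" assume \<phi>: "test_function \<phi>"
  note d\<phi> = test_function_frechet_derivative[OF \<phi> b]
  show "(LINT x|lebesgue. frechet_derivative \<phi> (at x) b *\<^sub>R slice \<psi> h x) = - (LINT x|lebesgue. \<phi> x *\<^sub>R slice \<psi> w x)"
    unfolding integral_test_function_lebesgue[OF \<phi> sm(2)] integral_test_function_lebesgue[OF d\<phi> sm(1)]
      integral_slice[OF test_function_L2[OF \<phi>] \<psi>2 w] integral_slice[OF test_function_L2[OF d\<phi>] \<psi>2 h]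
    by (rule has_weak_deriv_space_tensor[OF hw h w \<psi> \<phi> b])
qed

text \<open>Here the derivative falls on \<open>\<psi>\<close>. The identity holds after integration
  against every \<open>\<phi>\<close>, hence almost everywhere by
  \<open>du_Bois_Reymond\<close>.\<close>

lemma slice_weak_time_deriv:
  fixes h w :: "'a::euclidean_space \<times> real \<Rightarrow> complex"
  assumes hw: "has_weak_deriv h w (0, 1)" and h: "h \<in> L2 lborel" and w: "w \<in> L2 lborel"
    and \<psi>: "complex_test_function \<psi>" and \<psi>': "\<And>t. (\<psi> has_vector_derivative \<psi>' t) (at t)"
  shows "AE x in lborel. slice \<psi> w x = - slice \<psi>' h x"
proof -
  \<comment> \<open>Any test function serves here: it instantiates \<open>\<phi>\<close> to extract
    the regularity of \<open>\<psi>'\<close>, a conclusion in which \<open>\<phi>\<close> does not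
    occur.\<close>
  have "test_function (\<lambda>x::'a. 0)" by (rule test_functionI[where K = "{}"]) (auto intro: Ck_const)
  note tensor = has_weak_deriv_time_tensor[OF hw h w \<psi> \<psi>']
  have \<psi>2: "\<psi> \<in> L2 lborel" "\<psi>' \<in> L2 lborel"
    using tensor(1)[OF \<open>test_function (\<lambda>x. 0)\<close>] \<psi> by (auto intro: complex_test_function_L2)
  have s: "slice \<psi>' h \<in> L2 lborel" "slice \<psi> w \<in> L2 lborel"
    using slice_L2 \<psi>2 h w by auto
  then have sm: "slice \<psi>' h \<in> borel_measurable borel" "slice \<psi> w \<in> borel_measurable borel"
    by (auto simp: L2_def)
  have "AE x in lebesgue. slice \<psi>' h x + slice \<psi> w x = 0"
  proof (rule du_Bois_Reymond)
    have "(\<lambda>x. slice \<psi>' h x + slice \<psi> w x) \<in> L2 lborel" using s by (rule L2_add)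
    then show "loc_integrable (\<lambda>x. slice \<psi>' h x + slice \<psi> w x)"
      using sm by (intro L2_loc_integrable) (subst L2_lebesgue_iff_lborel, auto)
    fix \<phi> :: "'a \<Rightarrow> real" assume \<phi>: "test_function \<phi>"
    note \<phi>2 = test_function_L2[OF \<phi>]
    have "(LINT x|lebesgue. \<phi> x *\<^sub>R (slice \<psi>' h x + slice \<psi> w x)) =
        (LINT x|lborel. complex_of_real (\<phi> x) * slice \<psi>' h x + complex_of_real (\<phi> x) * slice \<psi> w x)"
      using sm by (subst integral_test_function_lebesgue[OF \<phi>]) (auto simp: distrib_left)
    also have "\<dots> = (LINT x|lborel. complex_of_real (\<phi> x) * slice \<psi>' h x) + (LINT x|lborel. complex_of_real (\<phi> x) * slice \<psi> w x)"
      by (intro Bochner_Integration.integral_add L2_mult_integrable[OF \<phi>2] s)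
    also have "\<dots> = 0"
      unfolding integral_slice[OF \<phi>2 \<psi>2(2) h] integral_slice[OF \<phi>2 \<psi>2(1) w] tensor(2)[OF \<phi>] by simp
    finally show "(LINT x|lebesgue. \<phi> x *\<^sub>R (slice \<psi>' h x + slice \<psi> w x)) = 0" .
  qed
  then show ?thesis
    unfolding AE_completion_iff by eventually_elim (metis add.commute eq_neg_iff_add_eq_0)
qed

section \<open>Borel representatives and second order Sobolev functions\<close>

lemma lebesgue_borel_representative:
  fixes f :: "'a::euclidean_space \<Rightarrow> complex"
  assumes f: "f \<in> borel_measurable lebesgue"
  obtains f' where "f' \<in> borel_measurable borel" "AE x in lebesgue. f x = f' x"
proof -
  have "(\<lambda>x. Re (f x)) \<in> borel_measurable lebesgue" "(\<lambda>x. Im (f x)) \<in> borel_measurable lebesgue"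
    using f by measurable
  then obtain a b where [measurable]: "a \<in> borel_measurable lborel" "b \<in> borel_measurable lborel"
    and ab: "AE x in lborel. Re (f x) = a x" "AE x in lborel. Im (f x) = b x"
    using completion_ex_borel_measurable_real by metis
  from ab have "AE x in lebesgue. f x = Complex (a x) (b x)"
    unfolding AE_completion_iff by eventually_elim (simp add: complex_eq_iff)
  moreover have "(\<lambda>x. Complex (a x) (b x)) \<in> borel_measurable borel"
    by (simp add: Complex_eq)
  ultimately show ?thesis by (intro that[of "\<lambda>x. Complex (a x) (b x)"])
qed

lemma L2_borel_representative:
  fixes f :: "'a::euclidean_space \<Rightarrow> complex"
  assumes "f \<in> L2 lebesgue"
  obtains f' where "f' \<in> L2 lborel" "AE x in lebesgue. f x = f' x"
proof -
  obtain f' where f': "f' \<in> borel_measurable borel" "AE x in lebesgue. f x = f' x"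
    using lebesgue_borel_representative[OF L2_measurable[OF assms]] by blast
  have "f' \<in> L2 lebesgue"
    by (rule L2_cong_AE[OF assms _ f'(2)]) (simp add: f'(1) measurable_completion)
  then have "f' \<in> L2 lborel" using f'(1) by (simp add: L2_lebesgue_iff_lborel)
  with f'(2) show ?thesis by (intro that[of f'])
qed

text \<open>\<open>sobolev\<close> and \<open>laplacian\<close> refer to chosen derivatives, whereas
  slices come with explicit ones. Uniqueness identifies the first derivatives, the second order
  identities are transported along this equality almost everywhere, and uniqueness applies again.
  Mixed derivatives occur because \<open>sobolev\<close> runs through all directions at each
  order.\<close>

lemma sobolev_2I:
  fixes g :: "'a::euclidean_space \<Rightarrow> complex"
  assumes g: "g \<in> L2 lebesgue"
    and d: "\<And>b. b \<in> Basis \<Longrightarrow> has_weak_deriv g (d b) b" "\<And>b. b \<in> Basis \<Longrightarrow> d b \<in> L2 lebesgue"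
    and d2: "\<And>a b. a \<in> Basis \<Longrightarrow> b \<in> Basis \<Longrightarrow> has_weak_deriv (d a) (d2 a b) b"
      "\<And>a b. a \<in> Basis \<Longrightarrow> b \<in> Basis \<Longrightarrow> d2 a b \<in> L2 lebesgue"
  shows "g \<in> sobolev Basis 2 (L2 lebesgue)"
    and "AE x in lebesgue. laplacian g x = (\<Sum>b\<in>Basis. d2 b b x)"
proof -
  have m: "h' \<in> borel_measurable lebesgue" if "has_weak_deriv h h' b" for h h' :: "'a \<Rightarrow> complex" and b
    using that by (auto simp: has_weak_deriv_def loc_integrable_measurable)
  have w1: "has_weak_deriv g (wderiv b g) b" if "b \<in> Basis" for b
    using d(1)[OF that] has_weak_deriv_wderiv by blast
  have e1: "AE x in lebesgue. d b x = wderiv b g x" if "b \<in> Basis" for b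
    by (rule has_weak_deriv_unique[OF d(1)[OF that] w1[OF that]])
  have l1: "wderiv b g \<in> L2 lebesgue" if "b \<in> Basis" for b
    by (rule L2_cong_AE[OF d(2)[OF that] m[OF w1[OF that]] e1[OF that]])
  have ww: "has_weak_deriv (wderiv a g) (d2 a b) b" if "a \<in> Basis" "b \<in> Basis" for a b
    by (rule has_weak_deriv_cong_AE[OF d2(1)[OF that] e1[OF that(1)] AE_I2 m[OF w1[OF that(1)]] m[OF d2(1)[OF that]] that(2)]) simp
  then have w2: "has_weak_deriv (wderiv a g) (wderiv b (wderiv a g)) b" if "a \<in> Basis" "b \<in> Basis" for a b
    using that has_weak_deriv_wderiv by blast
  have e2: "AE x in lebesgue. d2 a b x = wderiv b (wderiv a g) x" if "a \<in> Basis" "b \<in> Basis" for a b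
    by (rule has_weak_deriv_unique[OF ww[OF that] w2[OF that]])
  have l2: "wderiv b (wderiv a g) \<in> L2 lebesgue" if "a \<in> Basis" "b \<in> Basis" for a b
    by (rule L2_cong_AE[OF d2(2)[OF that] m[OF w2[OF that]] e2[OF that]])
  have "\<exists>h. has_weak_deriv g h b" if "b \<in> Basis" for b using w1[OF that] by blast
  moreover have "\<exists>h. has_weak_deriv (wderiv a g) h b" if "a \<in> Basis" "b \<in> Basis" for a b
    using w2[OF that] by blast
  ultimately show "g \<in> sobolev Basis 2 (L2 lebesgue)"
    unfolding numeral_2_eq_2 sobolev.simps
    using g l1 l2 by auto
  have "AE x in lebesgue. \<forall>b\<in>Basis. d2 b b x = wderiv b (wderiv b g) x"
    by (rule AE_finite_allI) (use e2 in auto)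
  then show "AE x in lebesgue. laplacian g x = (\<Sum>b\<in>Basis. d2 b b x)"
    by eventually_elim (simp add: laplacian_def)
qed

section \<open>Weighted norms and passage from frequencies to time\<close>

lemma L2_density_iff:
  assumes "W \<in> borel_measurable M"
  shows "f \<in> L2 (density M W) \<longleftrightarrow>
    f \<in> borel_measurable M \<and> (\<integral>\<^sup>+x. W x * ennreal ((cmod (f x))\<^sup>2) \<partial>M) < \<infinity>"
  using assms by (auto simp: L2_iff nn_integral_density)

lemma L2_norm_density:
  assumes "W \<in> borel_measurable M" "f \<in> borel_measurable M"
  shows "L2_norm (density M W) f = sqrt (enn2real (\<integral>\<^sup>+x. W x * ennreal ((cmod (f x))\<^sup>2) \<partial>M))"
  unfolding L2_norm_def using assms by (subst integral_eq_nn_integral) (auto simp: nn_integral_density)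

text \<open>The squared estimate, in a form fit for summation. Nothing makes \<open>C\<close>
  nonnegative, so it is replaced by a nonnegative upper bound \<open>C'\<close> before
  squaring.\<close>

lemma resolvent_estimate_nn_integral:
  fixes V :: "'a::euclidean_space \<Rightarrow> complex"
  assumes est: "resolvent_estimate V C" and V: "V \<in> borel_measurable lebesgue" and C: "C \<le> C'" "0 \<le> C'"
    and z: "z \<notin> \<real>" and f: "f \<in> L2 lebesgue" and g: "is_resolvent z f g"
    and fin: "(\<integral>\<^sup>+x. inverse (ennreal (cmod (V x))) * ennreal ((cmod (f x))\<^sup>2) \<partial>lebesgue) < \<infinity>"
  shows "(\<integral>\<^sup>+x. ennreal (cmod (V x)) * ennreal ((cmod (g x))\<^sup>2) \<partial>lebesgue) \<le>
    ennreal (C'\<^sup>2) * (\<integral>\<^sup>+x. inverse (ennreal (cmod (V x))) * ennreal ((cmod (f x))\<^sup>2) \<partial>lebesgue)"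
    (is "?A \<le> _ * ?B")
proof -
  note [measurable] = V
  have fm: "f \<in> borel_measurable lebesgue" using f by (rule L2_measurable)
  have "f \<in> L2 (inv_pot_measure V)"
    unfolding inv_pot_measure_def by (subst L2_density_iff) (use fm fin in auto)
  with est z f g have g2: "g \<in> L2 (pot_measure V)"
    and le: "L2_norm (pot_measure V) g \<le> C * L2_norm (inv_pot_measure V) f"
    unfolding resolvent_estimate_def by blast+
  have gm: "g \<in> borel_measurable lebesgue" and A: "?A < \<infinity>"
    using g2 unfolding pot_measure_def by (auto simp: L2_density_iff)
  have "L2_norm (pot_measure V) g = sqrt (enn2real ?A)"
    unfolding pot_measure_def by (rule L2_norm_density) (use gm in auto)
  moreover have "L2_norm (inv_pot_measure V) f = sqrt (enn2real ?B)"
    unfolding inv_pot_measure_def by (rule L2_norm_density) (use fm in auto)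
  ultimately have "sqrt (enn2real ?A) \<le> C * sqrt (enn2real ?B)" using le by simp
  also have "\<dots> \<le> C' * sqrt (enn2real ?B)" by (intro mult_right_mono C) auto
  finally have "(sqrt (enn2real ?A))\<^sup>2 \<le> (C' * sqrt (enn2real ?B))\<^sup>2" by (intro power_mono) auto
  then have "enn2real ?A \<le> C'\<^sup>2 * enn2real ?B" by (simp add: power_mult_distrib)
  then have "ennreal (enn2real ?A) \<le> ennreal (C'\<^sup>2) * ennreal (enn2real ?B)"
    by (simp add: ennreal_leI flip: ennreal_mult)
  then show ?thesis using A fin by simp
qed

text \<open>The frame bounds are applied to time sections at almost every \<open>x\<close>, and sums
  over the frequencies \<open>k / c\<close> and \<open>- k / c\<close> are exchanged with integrals
  of nonnegative functions. The hypothesis has one \<open>K\<close> for all frequencies, and 4 is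
  the product of the two frame constants.\<close>

lemma fourier_transfer:
  fixes H G :: "'a::euclidean_space \<times> real \<Rightarrow> complex" and W Wi :: "'a \<Rightarrow> ennreal"
  assumes H: "H \<in> L2 lborel" and G: "G \<in> L2 lborel" and "c > 0"
    and W: "W \<in> borel_measurable borel" and Wi: "Wi \<in> borel_measurable borel"
    and supp: "\<And>x t. t \<notin> {- (pi * c / 2)..pi * c / 2} \<Longrightarrow> H (x, t) = 0"
      "\<And>x t. t \<notin> {- (pi * c / 2)..pi * c / 2} \<Longrightarrow> G (x, t) = 0"
    and le: "\<And>\<tau>. (\<integral>\<^sup>+x. W x * ennreal ((cmod (fourier (\<lambda>t. H (x, t)) \<tau>))\<^sup>2) \<partial>lborel) \<le>
        ennreal K * (\<integral>\<^sup>+x. Wi x * ennreal ((cmod (fourier (\<lambda>t. G (x, t)) \<tau>))\<^sup>2) \<partial>lborel)"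
  shows "(\<integral>\<^sup>+y. W (fst y) * ennreal ((cmod (H y))\<^sup>2) \<partial>lborel) \<le>
    4 * ennreal K * (\<integral>\<^sup>+y. Wi (fst y) * ennreal ((cmod (G y))\<^sup>2) \<partial>lborel)"
proof -
  let ?F = "\<lambda>H \<tau> x. fourier (\<lambda>t. H (x, t)) \<tau>"
  have fm: "?F H \<tau> \<in> borel_measurable borel" if "H \<in> L2 lborel" for H :: "'a \<times> real \<Rightarrow> complex" and \<tau>
  proof -
    have "(\<lambda>t. cis (- \<tau> * t)) \<in> borel_measurable borel"
      by (intro borel_measurable_continuous_onI continuous_intros)
    moreover have "?F H \<tau> = slice (\<lambda>t. cis (- \<tau> * t)) H"
      by (simp add: slice_def fourier_def fun_eq_iff)
    ultimately show ?thesis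
      using slice_measurable[of "\<lambda>t. cis (- \<tau> * t)" H] that by (simp add: L2_def)
  qed
  note [measurable] = W Wi fm[OF H] fm[OF G]
  have pair: "(\<integral>\<^sup>+y. W (fst y) * ennreal ((cmod (H y))\<^sup>2) \<partial>lborel) =
      (\<integral>\<^sup>+x. W x * (\<integral>\<^sup>+t. ennreal ((cmod (H (x, t)))\<^sup>2) \<partial>lborel) \<partial>lborel)"
    if "H \<in> L2 lborel" "W \<in> borel_measurable borel" for H :: "'a \<times> real \<Rightarrow> complex" and W :: "'a \<Rightarrow> ennreal"
  proof -
    have h: "H \<in> borel_measurable (borel \<Otimes>\<^sub>M borel)" using that by (simp add: borel_prod L2_def)
    then have s: "(\<lambda>t. ennreal ((cmod (H (x, t)))\<^sup>2)) \<in> borel_measurable lborel" for x by measurable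
    note [measurable] = that(2) h
    have "(\<lambda>y. W (fst y) * ennreal ((cmod (H y))\<^sup>2)) \<in> borel_measurable borel"
      unfolding borel_prod[symmetric] by measurable
    from nn_integral_lborel_pair[OF this, symmetric] show ?thesis
      by (simp add: nn_integral_cmult[OF s])
  qed
  have good: "AE x in lborel. (\<lambda>t. H (x, t)) \<in> L2 lborel" "AE x in lborel. (\<lambda>t. G (x, t)) \<in> L2 lborel"
    using L2_AE_slice H G by auto
  let ?S = "\<lambda>H x. \<Sum>k. ennreal ((cmod (?F H (real k / c) x))\<^sup>2 + (cmod (?F H (- (real k / c)) x))\<^sup>2)"
  let ?T = "\<lambda>W H \<tau>. \<integral>\<^sup>+x. W x * ennreal ((cmod (?F H \<tau> x))\<^sup>2) \<partial>lborel"
  have sums: "(\<integral>\<^sup>+x. W x * ?S H x \<partial>lborel) = (\<Sum>k. ?T W H (real k / c) + ?T W H (- (real k / c)))"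
    if [measurable]: "W \<in> borel_measurable borel" "\<And>\<tau>. ?F H \<tau> \<in> borel_measurable borel"
    for H :: "'a \<times> real \<Rightarrow> complex" and W :: "'a \<Rightarrow> ennreal"
  proof -
    have "(\<integral>\<^sup>+x. W x * ?S H x \<partial>lborel) =
      (\<integral>\<^sup>+x. (\<Sum>k. W x * ennreal ((cmod (?F H (real k / c) x))\<^sup>2) + W x * ennreal ((cmod (?F H (- (real k / c)) x))\<^sup>2)) \<partial>lborel)"
      by (simp add: distrib_left flip: ennreal_suminf_cmult)
    also have "\<dots> = (\<Sum>k. \<integral>\<^sup>+x. W x * ennreal ((cmod (?F H (real k / c) x))\<^sup>2) + W x * ennreal ((cmod (?F H (- (real k / c)) x))\<^sup>2) \<partial>lborel)"
      by (rule nn_integral_suminf) measurable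
    also have "\<dots> = (\<Sum>k. ?T W H (real k / c) + ?T W H (- (real k / c)))"
      by (intro suminf_cong nn_integral_add) auto
    finally show ?thesis .
  qed
  have "(\<integral>\<^sup>+y. W (fst y) * ennreal ((cmod (H y))\<^sup>2) \<partial>lborel) \<le>
      (\<integral>\<^sup>+x. W x * (ennreal (1 / (pi * c)) * ?S H x) \<partial>lborel)"
    unfolding pair[OF H W]
  proof (rule nn_integral_mono_AE)
    show "AE x in lborel. W x * (\<integral>\<^sup>+t. ennreal ((cmod (H (x, t)))\<^sup>2) \<partial>lborel) \<le> W x * (ennreal (1 / (pi * c)) * ?S H x)"
      using good(1)
    proof eventually_elim
      case (elim x)
      then show ?case
        by (intro mult_left_mono fourier_frame(1)) (use \<open>c > 0\<close> supp(1) in \<open>auto simp: L2_iff\<close>)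
    qed
  qed
  also have "\<dots> = ennreal (1 / (pi * c)) * (\<integral>\<^sup>+x. W x * ?S H x \<partial>lborel)"
    by (subst nn_integral_cmult[symmetric]) (auto simp: mult.left_commute)
  also have "\<dots> = ennreal (1 / (pi * c)) * (\<Sum>k. ?T W H (real k / c) + ?T W H (- (real k / c)))"
    by (simp only: sums[OF W fm[OF H]])
  also have "\<dots> \<le> ennreal (1 / (pi * c)) * (\<Sum>k. ennreal K * (?T Wi G (real k / c) + ?T Wi G (- (real k / c))))"
    unfolding distrib_left by (intro mult_left_mono suminf_le add_mono le) auto
  also have "\<dots> = ennreal (1 / (pi * c)) * (ennreal K * (\<integral>\<^sup>+x. Wi x * ?S G x \<partial>lborel))"
    by (simp only: sums[OF Wi fm[OF G]] ennreal_suminf_cmult)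
  also have "\<dots> \<le> ennreal (1 / (pi * c)) * (ennreal K * (\<integral>\<^sup>+x. ennreal (4 * pi * c) * (Wi x * (\<integral>\<^sup>+t. ennreal ((cmod (G (x, t)))\<^sup>2) \<partial>lborel)) \<partial>lborel))"
  proof (intro mult_left_mono nn_integral_mono_AE)
    show "AE x in lborel. Wi x * ?S G x \<le> ennreal (4 * pi * c) * (Wi x * (\<integral>\<^sup>+t. ennreal ((cmod (G (x, t)))\<^sup>2) \<partial>lborel))"
      using good(2)
    proof eventually_elim
      case (elim x)
      then show ?case
        unfolding mult.left_commute[of _ "Wi x"]
        by (intro mult_left_mono fourier_frame(2)) (use \<open>c > 0\<close> supp(2) in \<open>auto simp: L2_iff\<close>)
    qed
  qed auto
  also have "\<dots> = ennreal (1 / (pi * c)) * (ennreal K * (ennreal (4 * pi * c) * (\<integral>\<^sup>+y. Wi (fst y) * ennreal ((cmod (G y))\<^sup>2) \<partial>lborel)))"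
  proof -
    have [measurable]: "G \<in> borel_measurable (borel \<Otimes>\<^sub>M borel)" using G by (simp add: borel_prod L2_def)
    have "(\<lambda>x. \<integral>\<^sup>+t. ennreal ((cmod (G (x, t)))\<^sup>2) \<partial>lborel) \<in> borel_measurable borel"
      by (intro sigma_finite_measure.borel_measurable_nn_integral[OF sigma_finite_lborel]) measurable
    then show ?thesis unfolding pair[OF G Wi] by (subst nn_integral_cmult) auto
  qed
  also have "\<dots> = 4 * ennreal K * (\<integral>\<^sup>+y. Wi (fst y) * ennreal ((cmod (G y))\<^sup>2) \<partial>lborel)"
  proof -
    have "ennreal (1 / (pi * c)) * ennreal (4 * pi * c) = 4"
      using \<open>c > 0\<close> by (simp flip: ennreal_mult)
    moreover have "a * (k * (b * z)) = (a * b) * k * z" for a b k z :: ennreal by (simp only: mult_ac)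
    ultimately show ?thesis by simp
  qed
  finally show ?thesis .
qed

section \<open>The equation satisfied by the Fourier coefficients\<close>

lemma fourier_mult: "fourier (\<lambda>t. f t * h (x, t)) \<tau> = slice (\<lambda>t. f t * cis (- \<tau> * t)) h x"
  by (simp add: fourier_def slice_def mult_ac)

lemma complex_test_function_modulated:
  assumes "test_function \<eta>"
  shows "complex_test_function (\<lambda>t. complex_of_real (\<eta> t) * cis (- \<tau> * t))"
proof -
  obtain R where R: "\<And>x. x \<notin> cball 0 R \<Longrightarrow> \<eta> x = 0" using test_functionD[OF assms] by blast
  have "Ck k \<eta>" for k using assms by (simp add: test_function_def)
  then have "Ck k (\<lambda>t. \<eta> t * cos ((- \<tau>) * t))" "Ck k (\<lambda>t. \<eta> t * sin ((- \<tau>) * t))" for k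
    by (intro Ck_mult conjunct1[OF Ck_sin_cos] conjunct2[OF Ck_sin_cos]; blast)+
  then have "test_function (\<lambda>t. \<eta> t * cos ((- \<tau>) * t))" "test_function (\<lambda>t. \<eta> t * sin ((- \<tau>) * t))"
    using R by (intro test_functionI[where K = "cball 0 R"]; simp)+
  then show ?thesis by (simp add: complex_test_function_def)
qed

lemma has_vector_derivative_modulated:
  assumes "test_function \<eta>"
  shows "((\<lambda>t. complex_of_real (\<eta> t) * cis (- \<tau> * t)) has_vector_derivative
    complex_of_real (deriv \<eta> t) * cis (- \<tau> * t) - \<i> * \<tau> * (complex_of_real (\<eta> t) * cis (- \<tau> * t))) (at t)"
proof -
  have 1: "((\<lambda>t. complex_of_real (\<eta> t)) has_vector_derivative complex_of_real (deriv \<eta> t)) (at t)"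
    using test_function_has_real_derivative[OF assms]
    by (intro has_vector_derivative_of_real) (simp add: has_real_derivative_iff_has_vector_derivative)
  have 2: "((\<lambda>t. cis (- \<tau> * t)) has_vector_derivative - \<i> * \<tau> * cis (- \<tau> * t)) (at t)"
  proof -
    have "((\<lambda>t. exp (of_real t * (- \<i> * \<tau>))) has_vector_derivative - \<i> * \<tau> * exp (of_real t * (- \<i> * \<tau>))) (at t)"
      by (rule exp_scaleR_has_vector_derivative_right[of "- \<i> * \<tau>", unfolded scaleR_conv_of_real, THEN has_vector_derivative_eq_rhs])
         (simp add: mult.commute)
    then show ?thesis by (simp add: cis_conv_exp mult_ac)
  qed
  show ?thesis
    by (rule has_vector_derivative_eq_rhs[OF has_vector_derivative_mult[OF 1 2]]) (simp add: algebra_simps)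
qed

lemma slice_add:
  assumes "\<psi> \<in> L2 lborel" "(\<lambda>t. h (x, t)) \<in> L2 lborel" "(\<lambda>t. k (x, t)) \<in> L2 lborel"
  shows "slice \<psi> (\<lambda>y. h y + k y) x = slice \<psi> h x + slice \<psi> k x"
  unfolding slice_def distrib_left
  by (intro Bochner_Integration.integral_add L2_mult_integrable assms)

lemma slice_cmult: "slice \<psi> (\<lambda>y. c * h y) x = c * slice \<psi> h x"
  unfolding slice_def mult.left_commute[of _ c] by (rule integral_mult_right_zero)

lemma slice_sum:
  assumes "\<psi> \<in> L2 lborel" "\<And>i. i \<in> I \<Longrightarrow> (\<lambda>t. h i (x, t)) \<in> L2 lborel"
  shows "slice \<psi> (\<lambda>y. \<Sum>i\<in>I. h i y) x = (\<Sum>i\<in>I. slice \<psi> (h i) x)"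
  unfolding slice_def sum_distrib_left
  by (intro Bochner_Integration.integral_sum L2_mult_integrable assms)

lemma slice_diff_left:
  assumes "\<psi> \<in> L2 lborel" "\<psi>' \<in> L2 lborel" "(\<lambda>t. h (x, t)) \<in> L2 lborel"
  shows "slice (\<lambda>t. \<psi> t - c * \<psi>' t) h x = slice \<psi> h x - c * slice \<psi>' h x"
proof -
  have "slice (\<lambda>t. \<psi> t - c * \<psi>' t) h x = (LINT t|lborel. \<psi> t * h (x, t) - c * (\<psi>' t * h (x, t)))"
    by (simp add: slice_def left_diff_distrib mult.assoc)
  also have "\<dots> = slice \<psi> h x - c * slice \<psi>' h x"
    using L2_mult_integrable[OF assms(1,3)] L2_mult_integrable[OF assms(2,3)] by (simp add: slice_def)
  finally show ?thesis .
qed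

text \<open>Borel functions with explicit weak derivatives, so that slicing never meets the choice
  operator inside \<open>wderiv\<close>.\<close>

locale schroedinger_data =
  fixes u w :: "'a::euclidean_space \<times> real \<Rightarrow> complex"
    and d :: "'a \<Rightarrow> 'a \<times> real \<Rightarrow> complex" and d2 :: "'a \<Rightarrow> 'a \<Rightarrow> 'a \<times> real \<Rightarrow> complex"
  assumes u: "u \<in> L2 lborel" and w: "w \<in> L2 lborel"
    and d: "b \<in> Basis \<Longrightarrow> d b \<in> L2 lborel" and d2: "a \<in> Basis \<Longrightarrow> b \<in> Basis \<Longrightarrow> d2 a b \<in> L2 lborel"
    and uw: "has_weak_deriv u w (0, 1)"
    and ud: "b \<in> Basis \<Longrightarrow> has_weak_deriv u (d b) (b, 0)"
    and dd2: "a \<in> Basis \<Longrightarrow> b \<in> Basis \<Longrightarrow> has_weak_deriv (d a) (d2 a b) (b, 0)"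
begin

definition F :: "'a \<times> real \<Rightarrow> complex" where "F y = \<i> * w y + (\<Sum>b\<in>Basis. d2 b b y)"

text \<open>\<open>source \<eta>\<close> is \<open>(\<i>\<partial>\<^sub>t + \<Delta>) (\<eta> u)\<close> for a cutoff \<open>\<eta>\<close> in time.\<close>

definition source :: "(real \<Rightarrow> real) \<Rightarrow> 'a \<times> real \<Rightarrow> complex" where
  "source \<eta> y = complex_of_real (\<eta> (snd y)) * F y + \<i> * complex_of_real (deriv \<eta> (snd y)) * u y"

lemma F_L2: "F \<in> L2 lborel"
  unfolding F_def using w d2 by (auto intro!: L2_add L2_cmult L2_sum)

lemma slice_sobolev:
  assumes \<psi>: "complex_test_function \<psi>"
  shows "slice \<psi> u \<in> sobolev Basis 2 (L2 lebesgue)"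
    and "AE x in lebesgue. laplacian (slice \<psi> u) x = (\<Sum>b\<in>Basis. slice \<psi> (d2 b b) x)"
proof -
  note \<psi>2 = complex_test_function_L2[OF \<psi>]
  have L: "slice \<psi> h \<in> L2 lebesgue" if "h \<in> L2 lborel" for h :: "'a \<times> real \<Rightarrow> complex"
    using slice_L2[OF \<psi>2 that] by (subst L2_lebesgue_iff_lborel) (auto simp: L2_def)
  note I = sobolev_2I[of "slice \<psi> u" "\<lambda>b. slice \<psi> (d b)" "\<lambda>a b. slice \<psi> (d2 a b)"]
  show "slice \<psi> u \<in> sobolev Basis 2 (L2 lebesgue)"
    "AE x in lebesgue. laplacian (slice \<psi> u) x = (\<Sum>b\<in>Basis. slice \<psi> (d2 b b) x)"
    by (rule I; intro L u d d2 has_weak_deriv_slice \<psi> ud dd2; assumption)+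
qed

text \<open>Integration by parts in time against \<open>\<eta>\<close> times
  \<open>cis (- \<tau> * t)\<close>: the derivative of the exponential produces the eigenvalue term
  with factor \<open>\<tau>\<close>, the derivative of \<open>\<eta>\<close> the commutator term in
  the source.\<close>

lemma slice_source:
  assumes \<eta>: "test_function \<eta>"
  defines "\<psi> \<equiv> \<lambda>\<tau> t. complex_of_real (\<eta> t) * cis (- \<tau> * t)"
    and "\<psi>' \<equiv> \<lambda>\<tau> t. complex_of_real (deriv \<eta> t) * cis (- \<tau> * t)"
  shows "AE x in lborel. fourier (\<lambda>t. source \<eta> (x, t)) \<tau> = slice (\<psi> \<tau>) F x + \<i> * slice (\<psi>' \<tau>) u x"
    and "AE x in lebesgue. laplacian (slice (\<psi> \<tau>) u) x =
      \<tau> * slice (\<psi> \<tau>) u x + (slice (\<psi> \<tau>) F x + \<i> * slice (\<psi>' \<tau>) u x)"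
proof -
  have \<psi>: "complex_test_function (\<psi> \<tau>)" and \<psi>': "complex_test_function (\<psi>' \<tau>)"
    unfolding \<psi>_def \<psi>'_def by (intro complex_test_function_modulated \<eta> test_function_deriv)+
  note \<psi>2 = complex_test_function_L2[OF \<psi>] complex_test_function_L2[OF \<psi>']
  have "AE x in lborel. \<forall>b\<in>Basis. (\<lambda>t. d2 b b (x, t)) \<in> L2 lborel"
    by (rule AE_finite_allI) (use L2_AE_slice d2 in auto)
  \<comment> \<open>At these \<open>x\<close> all time sections are square integrable, so every
    product with \<open>\<psi>\<close> is integrable and integrals of sums may be split.\<close>
  then have good: "AE x in lborel. (\<lambda>t. u (x, t)) \<in> L2 lborel \<and> (\<lambda>t. w (x, t)) \<in> L2 lborel \<and>
      (\<lambda>t. F (x, t)) \<in> L2 lborel \<and> (\<forall>b\<in>Basis. (\<lambda>t. d2 b b (x, t)) \<in> L2 lborel)"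
    using L2_AE_slice[OF u] L2_AE_slice[OF w] L2_AE_slice[OF F_L2] by eventually_elim auto
  show "AE x in lborel. fourier (\<lambda>t. source \<eta> (x, t)) \<tau> = slice (\<psi> \<tau>) F x + \<i> * slice (\<psi>' \<tau>) u x"
    using good
  proof eventually_elim
    case (elim x)
    have "fourier (\<lambda>t. source \<eta> (x, t)) \<tau> = (LINT t|lborel. \<psi> \<tau> t * F (x, t) + \<i> * (\<psi>' \<tau> t * u (x, t)))"
      by (simp add: fourier_def source_def \<psi>_def \<psi>'_def algebra_simps)
    then show ?case
      using L2_mult_integrable[OF \<psi>2(1), of "\<lambda>t. F (x, t)"] L2_mult_integrable[OF \<psi>2(2), of "\<lambda>t. u (x, t)"] elim
      by (simp add: slice_def)
  qed
  have "AE x in lborel. slice (\<psi> \<tau>) w x = - slice (\<lambda>t. \<psi>' \<tau> t - \<i> * \<tau> * \<psi> \<tau> t) u x"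
    by (rule slice_weak_time_deriv[OF uw u w \<psi>])
       (use has_vector_derivative_modulated[OF \<eta>, of \<tau>] in \<open>simp add: \<psi>_def \<psi>'_def\<close>)
  then show "AE x in lebesgue. laplacian (slice (\<psi> \<tau>) u) x =
      \<tau> * slice (\<psi> \<tau>) u x + (slice (\<psi> \<tau>) F x + \<i> * slice (\<psi>' \<tau>) u x)"
    using good slice_sobolev(2)[OF \<psi>] unfolding AE_completion_iff
  proof eventually_elim
    case (elim x)
    have "slice (\<psi> \<tau>) F x = slice (\<psi> \<tau>) (\<lambda>y. \<i> * w y) x + slice (\<psi> \<tau>) (\<lambda>y. \<Sum>b\<in>Basis. d2 b b y) x"
      unfolding F_def using elim by (intro slice_add \<psi>2) (auto intro!: L2_cmult L2_sum)
    also have "\<dots> = \<i> * slice (\<psi> \<tau>) w x + (\<Sum>b\<in>Basis. slice (\<psi> \<tau>) (d2 b b) x)"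
      using elim by (simp add: slice_cmult slice_sum \<psi>2)
    finally have "slice (\<psi> \<tau>) F x = \<i> * slice (\<psi> \<tau>) w x + laplacian (slice (\<psi> \<tau>) u) x"
      using elim by simp
    moreover have "slice (\<psi> \<tau>) w x = - slice (\<psi>' \<tau>) u x + \<i> * \<tau> * slice (\<psi> \<tau>) u x"
      using elim by (simp add: slice_diff_left \<psi>2)
    ultimately show ?case by (simp add: algebra_simps)
  qed
qed

end

section \<open>Summation of the resolvent estimates\<close>

text \<open>The limit \<open>\<delta> \<rightarrow> 0\<close>. Finiteness of \<open>D\<close> is
  essential, since a positive multiple of infinity stays infinite.\<close>

lemma ennreal_le_if_le_add_square_mult:
  fixes A B D :: ennreal
  assumes le: "\<And>\<delta>::real. \<delta> > 0 \<Longrightarrow> A \<le> B + ennreal (\<delta>\<^sup>2) * D" and D: "D < \<infinity>"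
  shows "A \<le> B"
proof (rule ennreal_le_epsilon)
  fix e :: real assume "e > 0"
  obtain r where r: "D = ennreal r" "r \<ge> 0" using D by (cases D) auto
  \<comment> \<open>\<open>r + 1\<close> instead of \<open>r\<close> covers
    \<open>r = 0\<close>.\<close>
  define \<delta> where "\<delta> = sqrt (e / (r + 1))"
  have "\<delta> > 0" using \<open>e > 0\<close> r by (simp add: \<delta>_def)
  have "e * r \<le> e * (r + 1)" using \<open>e > 0\<close> by simp
  then have "\<delta>\<^sup>2 * r \<le> e" using \<open>e > 0\<close> r(2) by (simp add: \<delta>_def field_simps)
  then have "ennreal (\<delta>\<^sup>2) * D \<le> ennreal e"
    unfolding r(1) using r(2) by (simp add: ennreal_leI flip: ennreal_mult)
  with le[OF \<open>\<delta> > 0\<close>] show "A \<le> B + ennreal e"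
    by (meson add_left_mono order_trans)
qed

lemma nn_integral_weight_add_le:
  fixes f g :: "'a \<Rightarrow> complex"
  assumes [measurable]: "W \<in> borel_measurable M" "f \<in> borel_measurable M" "g \<in> borel_measurable M"
  shows "(\<integral>\<^sup>+x. W x * ennreal ((cmod (f x + g x))\<^sup>2) \<partial>M) \<le>
    2 * (\<integral>\<^sup>+x. W x * ennreal ((cmod (f x))\<^sup>2) \<partial>M) + 2 * (\<integral>\<^sup>+x. W x * ennreal ((cmod (g x))\<^sup>2) \<partial>M)"
proof -
  have "(\<integral>\<^sup>+x. W x * ennreal ((cmod (f x + g x))\<^sup>2) \<partial>M) \<le>
      (\<integral>\<^sup>+x. 2 * (W x * ennreal ((cmod (f x))\<^sup>2)) + 2 * (W x * ennreal ((cmod (g x))\<^sup>2)) \<partial>M)"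
  proof (rule nn_integral_mono)
    fix x
    have "ennreal ((cmod (f x + g x))\<^sup>2) \<le> ennreal (2 * (cmod (f x))\<^sup>2 + 2 * (cmod (g x))\<^sup>2)"
      by (intro ennreal_leI cmod_add_squared_le)
    also have "\<dots> = 2 * ennreal ((cmod (f x))\<^sup>2) + 2 * ennreal ((cmod (g x))\<^sup>2)"
      by (simp add: ennreal_mult)
    finally have "W x * ennreal ((cmod (f x + g x))\<^sup>2) \<le> W x * (2 * ennreal ((cmod (f x))\<^sup>2) + 2 * ennreal ((cmod (g x))\<^sup>2))"
      by (rule mult_left_mono) simp
    then show "W x * ennreal ((cmod (f x + g x))\<^sup>2) \<le> 2 * (W x * ennreal ((cmod (f x))\<^sup>2)) + 2 * (W x * ennreal ((cmod (g x))\<^sup>2))"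
      by (simp add: distrib_left mult.left_commute)
  qed
  also have "\<dots> = 2 * (\<integral>\<^sup>+x. W x * ennreal ((cmod (f x))\<^sup>2) \<partial>M) + 2 * (\<integral>\<^sup>+x. W x * ennreal ((cmod (g x))\<^sup>2) \<partial>M)"
    by (subst nn_integral_add) (auto simp: nn_integral_cmult)
  finally show ?thesis .
qed

lemma nn_integral_weight_cmult:
  fixes f :: "'a \<Rightarrow> complex"
  assumes [measurable]: "W \<in> borel_measurable M" "f \<in> borel_measurable M"
  shows "(\<integral>\<^sup>+x. W x * ennreal ((cmod (c * f x))\<^sup>2) \<partial>M) = ennreal ((cmod c)\<^sup>2) * (\<integral>\<^sup>+x. W x * ennreal ((cmod (f x))\<^sup>2) \<partial>M)"
  by (subst nn_integral_cmult[symmetric]) (auto simp: norm_mult power_mult_distrib ennreal_mult mult_ac)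

text \<open>The estimate is known for the Lebesgue measurable \<open>V\<close>, and Fubini is
  applied with its Borel version \<open>V0\<close>. The assumption \<open>u_fin\<close> controls the
  error of the shifted spectral parameter, and \<open>F_fin\<close> makes the absorption
  legitimate.\<close>

locale schroedinger_resolvent = schroedinger_data +
  fixes V V0 :: "'a \<Rightarrow> complex" and C :: real
  assumes est: "resolvent_estimate V C" and C: "C \<le> 1 / 8"
    and V: "V \<in> borel_measurable lebesgue" and V0: "V0 \<in> borel_measurable borel"
    and V_V0: "AE x in lebesgue. V x = V0 x"
    and u_fin: "(\<integral>\<^sup>+y. inverse (ennreal (cmod (V0 (fst y)))) * ennreal ((cmod (u y))\<^sup>2) \<partial>lborel) < \<infinity>"
    and F_fin: "(\<integral>\<^sup>+y. inverse (ennreal (cmod (V0 (fst y)))) * ennreal ((cmod (F y))\<^sup>2) \<partial>lborel) < \<infinity>"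
    and F_le: "AE y in lborel. cmod (F y) \<le> cmod (V0 (fst y) * u y)"
begin

abbreviation "W \<equiv> \<lambda>x. ennreal (cmod (V0 x))"
abbreviation "Wi \<equiv> \<lambda>x. inverse (ennreal (cmod (V0 x)))"

lemma W_measurable [measurable]: "W \<in> borel_measurable borel" "Wi \<in> borel_measurable borel"
  using V0 by measurable

text \<open>The Fourier coefficient \<open>g\<close> of \<open>\<eta> u\<close> at frequency \<open>\<tau>\<close> solves \<open>(\<Delta> - \<tau>) g = h\<close>. The spectral
  parameter \<open>-\<tau>\<close> is real, so the resolvent estimate is applied at \<open>-\<tau> + \<i>\<delta>\<close> and the error \<open>\<i>\<delta>g\<close>
  disappears as \<open>\<delta> \<rightarrow> 0\<close> because \<open>u\<close> itself lies in \<open>L\<^sup>2(|V|\<^sup>-\<^sup>1)\<close>.\<close>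

lemma frequency_estimate:
  assumes \<eta>: "test_function \<eta>"
  shows "(\<integral>\<^sup>+x. W x * ennreal ((cmod (fourier (\<lambda>t. complex_of_real (\<eta> t) * u (x, t)) \<tau>))\<^sup>2) \<partial>lborel) \<le>
    ennreal (1 / 32) * (\<integral>\<^sup>+x. Wi x * ennreal ((cmod (fourier (\<lambda>t. source \<eta> (x, t)) \<tau>))\<^sup>2) \<partial>lborel)"
proof -
  define \<psi> where "\<psi> = (\<lambda>t. complex_of_real (\<eta> t) * cis (- \<tau> * t))"
  define \<psi>' where "\<psi>' = (\<lambda>t. complex_of_real (deriv \<eta> t) * cis (- \<tau> * t))"
  define g where "g = slice \<psi> u"
  define h where "h x = slice \<psi> F x + \<i> * slice \<psi>' u x" for x
  have \<psi>: "complex_test_function \<psi>" and \<psi>': "complex_test_function \<psi>'"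
    unfolding \<psi>_def \<psi>'_def by (intro complex_test_function_modulated \<eta> test_function_deriv)+
  note \<psi>2 = complex_test_function_L2[OF \<psi>] complex_test_function_L2[OF \<psi>']
  have \<psi>m: "\<psi> \<in> borel_measurable borel" "\<psi>' \<in> borel_measurable borel"
    using \<psi>2 by (auto simp: L2_def)
  have um: "u \<in> borel_measurable borel" "F \<in> borel_measurable borel"
    using u F_L2 by (auto simp: L2_def)
  have g2: "g \<in> L2 lborel" and h2: "h \<in> L2 lborel"
    unfolding g_def h_def by (auto intro!: slice_L2 \<psi>2 u F_L2 L2_add L2_cmult)
  then have gm[measurable]: "g \<in> borel_measurable borel" and hm[measurable]: "h \<in> borel_measurable borel"
    by (auto simp: L2_def)
  note [measurable] = slice_measurable[OF \<psi>m(1) um(2)] slice_measurable[OF \<psi>m(2) um(1)]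
  let ?I = "\<lambda>f. \<integral>\<^sup>+x. Wi x * ennreal ((cmod (f x))\<^sup>2) \<partial>lborel"
  have fin: "?I (slice \<xi> k) < \<infinity>"
    if "\<xi> \<in> L2 lborel" "k \<in> borel_measurable borel" "(\<integral>\<^sup>+y. Wi (fst y) * ennreal ((cmod (k y))\<^sup>2) \<partial>lborel) < \<infinity>" for \<xi> k
  proof -
    have "?I (slice \<xi> k) \<le> (\<integral>\<^sup>+t. ennreal ((cmod (\<xi> t))\<^sup>2) \<partial>lborel) * (\<integral>\<^sup>+y. Wi (fst y) * ennreal ((cmod (k y))\<^sup>2) \<partial>lborel)"
      using that by (intro nn_integral_slice_bound) (auto simp: L2_def)
    also have "\<dots> < \<infinity>" using that by (simp add: L2_iff ennreal_mult_less_top)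
    finally show ?thesis .
  qed
  have g_fin: "?I g < \<infinity>" unfolding g_def by (rule fin[OF \<psi>2(1) um(1) u_fin])
  have h_fin: "?I h < \<infinity>"
  proof -
    have "?I h \<le> 2 * ?I (slice \<psi> F) + 2 * ?I (\<lambda>x. \<i> * slice \<psi>' u x)"
      unfolding h_def by (rule nn_integral_weight_add_le) auto
    also have "?I (\<lambda>x. \<i> * slice \<psi>' u x) = ?I (slice \<psi>' u)" by (simp add: norm_mult)
    also have "2 * ?I (slice \<psi> F) + 2 * ?I (slice \<psi>' u) < \<infinity>"
      using fin[OF \<psi>2(1) um(2) F_fin] fin[OF \<psi>2(2) um(1) u_fin] by (simp add: ennreal_mult_less_top)
    finally show ?thesis .
  qed
  have toV: "(\<integral>\<^sup>+x. ennreal (cmod (V x)) * k x \<partial>lebesgue) = (\<integral>\<^sup>+x. W x * k x \<partial>lborel)"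
    "(\<integral>\<^sup>+x. inverse (ennreal (cmod (V x))) * k x \<partial>lebesgue) = (\<integral>\<^sup>+x. Wi x * k x \<partial>lborel)" for k
    unfolding nn_integral_completion using V_V0 unfolding AE_completion_iff
    by (intro nn_integral_cong_AE; auto)+
  have "(\<integral>\<^sup>+x. W x * ennreal ((cmod (g x))\<^sup>2) \<partial>lborel) \<le> ennreal (1 / 32) * ?I h"
  proof (rule ennreal_le_if_le_add_square_mult)
    show "ennreal (1 / 32) * ?I g < \<infinity>" using g_fin by (simp add: ennreal_mult_less_top)
    fix \<delta> :: real assume "\<delta> > 0"
    define z where "z = Complex (- \<tau>) \<delta>"
    \<comment> \<open>Insert the equation \<open>\<Delta>g = \<tau> g + h\<close> into
      \<open>- \<Delta>g - z g\<close> with \<open>z = - \<tau> + \<i> \<delta>\<close>: the terms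
      with \<open>\<tau>\<close> cancel.\<close>
    define f where "f x = (- 1) * h x + (- \<i> * \<delta>) * g x" for x
    have z: "z \<notin> \<real>" using \<open>\<delta> > 0\<close> by (auto simp: z_def complex_is_Real_iff)
    have f2: "f \<in> L2 lborel" unfolding f_def by (intro L2_add L2_cmult g2 h2)
    have "f \<in> L2 lebesgue" using f2 by (subst L2_lebesgue_iff_lborel) (auto simp: L2_def)
    have "is_resolvent z f g"
      unfolding is_resolvent_def
    proof
      show "g \<in> sobolev Basis 2 (L2 lebesgue)" unfolding g_def by (rule slice_sobolev(1)[OF \<psi>])
      show "AE x in lebesgue. - laplacian g x - z * g x = f x"
        using slice_source(2)[OF \<eta>, of \<tau>] unfolding \<psi>_def[symmetric] \<psi>'_def[symmetric] g_def[symmetric] h_def[symmetric]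
        by eventually_elim (simp add: f_def z_def Complex_eq algebra_simps)
    qed
    have If: "?I f \<le> 2 * ?I h + 2 * (ennreal (\<delta>\<^sup>2) * ?I g)"
    proof -
      have "?I f \<le> 2 * ?I (\<lambda>x. (- 1) * h x) + 2 * ?I (\<lambda>x. (- \<i> * \<delta>) * g x)"
        unfolding f_def by (rule nn_integral_weight_add_le) auto
      also have "?I (\<lambda>x. (- 1) * h x) = ?I h" by simp
      also have "?I (\<lambda>x. (- \<i> * \<delta>) * g x) = ennreal (\<delta>\<^sup>2) * ?I g"
        by (subst nn_integral_weight_cmult) (auto simp: norm_mult)
      finally show ?thesis .
    qed
    also have "\<dots> < \<infinity>" using g_fin h_fin by (simp add: ennreal_mult_less_top)
    finally have f_fin: "?I f < \<infinity>" .
    have "(\<integral>\<^sup>+x. W x * ennreal ((cmod (g x))\<^sup>2) \<partial>lborel) \<le> ennreal ((1 / 8)\<^sup>2) * ?I f"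
      using resolvent_estimate_nn_integral[OF est V C _ z \<open>f \<in> L2 lebesgue\<close> \<open>is_resolvent z f g\<close>] f_fin
      unfolding toV by simp
    also have "\<dots> \<le> ennreal ((1 / 8)\<^sup>2) * (2 * ?I h + 2 * (ennreal (\<delta>\<^sup>2) * ?I g))"
      by (intro mult_left_mono If) simp
    also have "\<dots> = (ennreal ((1 / 8)\<^sup>2) * 2) * ?I h + ennreal (\<delta>\<^sup>2) * ((ennreal ((1 / 8)\<^sup>2) * 2) * ?I g)"
      by (simp only: distrib_left mult_ac)
    also have "ennreal ((1 / 8)\<^sup>2) * 2 = ennreal (1 / 32)"
    proof -
      have "ennreal ((1 / 8)\<^sup>2) * ennreal 2 = ennreal (1 / 32)"
        by (subst ennreal_mult[symmetric]) (auto simp: power2_eq_square)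
      then show ?thesis by simp
    qed
    finally show "(\<integral>\<^sup>+x. W x * ennreal ((cmod (g x))\<^sup>2) \<partial>lborel) \<le>
        ennreal (1 / 32) * ?I h + ennreal (\<delta>\<^sup>2) * (ennreal (1 / 32) * ?I g)" .
  qed
  also have "?I h = (\<integral>\<^sup>+x. Wi x * ennreal ((cmod (fourier (\<lambda>t. source \<eta> (x, t)) \<tau>))\<^sup>2) \<partial>lborel)"
    using slice_source(1)[OF \<eta>, of \<tau>] unfolding \<psi>_def[symmetric] \<psi>'_def[symmetric] h_def[symmetric]
    by (intro nn_integral_cong_AE) auto
  finally show ?thesis
    unfolding fourier_mult[of "\<lambda>t. complex_of_real (\<eta> t)" u] g_def \<psi>_def .
qed

text \<open>The source splits into \<open>\<eta> F\<close>, with weighted norm \<open>?P\<close>,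
  and the commutator, with \<open>?Q\<close>. As \<open>|V|^-1 |V u|^2 = |V| |u|^2\<close>, the
  inequality gives \<open>?P \<le> ?A\<close>, and \<open>?A \<le> ?P / 4 + ?Q / 4\<close> becomes
  \<open>?A \<le> ?Q\<close>.\<close>

lemma cutoff_estimate:
  assumes \<eta>: "test_function \<eta>" and "L > 0" and supp: "\<And>t. t \<notin> {- L..L} \<Longrightarrow> \<eta> t = 0"
    and \<eta>_le: "\<And>t. \<bar>\<eta> t\<bar> \<le> 1" and d_le: "\<And>t. \<bar>deriv \<eta> t\<bar> \<le> B"
  shows "(\<integral>\<^sup>+y. W (fst y) * ennreal ((cmod (complex_of_real (\<eta> (snd y)) * u y))\<^sup>2) \<partial>lborel) \<le>
    ennreal (B\<^sup>2) * (\<integral>\<^sup>+y. Wi (fst y) * ennreal ((cmod (u y))\<^sup>2) \<partial>lborel)"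
proof -
  have "B \<ge> 0" using d_le[of 0] by linarith
  have [measurable]: "\<eta> \<in> borel_measurable borel" "deriv \<eta> \<in> borel_measurable borel"
    using test_function_continuous[OF \<eta>] test_function_continuous[OF test_function_deriv[OF \<eta>]]
    by (auto intro: borel_measurable_continuous_onI)
  have m: "(\<lambda>y::'a \<times> real. complex_of_real (\<eta> (snd y))) \<in> borel_measurable lborel"
    "(\<lambda>y::'a \<times> real. complex_of_real (deriv \<eta> (snd y))) \<in> borel_measurable lborel"
    unfolding lborel_prod[symmetric] by measurable
  have Wm [measurable]: "(\<lambda>y::'a \<times> real. W (fst y)) \<in> borel_measurable lborel" "(\<lambda>y::'a \<times> real. Wi (fst y)) \<in> borel_measurable lborel"
    unfolding lborel_prod[symmetric] by measurable
  have um [measurable]: "u \<in> borel_measurable lborel" "F \<in> borel_measurable lborel"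
    using u F_L2 by (auto simp: L2_def)
  note [measurable] = m
  let ?H = "\<lambda>y. complex_of_real (\<eta> (snd y)) * u y"
  have H: "?H \<in> L2 lborel" by (rule L2_bounded_mult[OF u m(1), of 1]) (use \<eta>_le in auto)
  have s1: "(\<lambda>y. complex_of_real (\<eta> (snd y)) * F y) \<in> L2 lborel"
    by (rule L2_bounded_mult[OF F_L2 m(1), of 1]) (use \<eta>_le in auto)
  have s2: "(\<lambda>y. complex_of_real (deriv \<eta> (snd y)) * u y) \<in> L2 lborel"
    by (rule L2_bounded_mult[OF u m(2), of B]) (use d_le in auto)
  have G: "source \<eta> \<in> L2 lborel"
    unfolding source_def using L2_add[OF s1 L2_cmult[OF s2, of \<i>]] by (simp add: mult.assoc)
  have d_supp: "deriv \<eta> t = 0" if "t \<notin> {- L..L}" for t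
  proof -
    have "(\<eta> has_real_derivative 0) (at t)"
      by (rule has_field_derivative_transform_within_open[of "\<lambda>_. 0" _ _ "- {- L..L}"])
         (use that supp in \<open>auto simp: open_Compl\<close>)
    then show ?thesis by (rule DERIV_imp_deriv)
  qed
  \<comment> \<open>This makes the interval of \<open>fourier_transfer\<close> equal to
    \<open>[- L, L]\<close>.\<close>
  define c where "c = 2 * L / pi"
  have c: "c > 0" "pi * c / 2 = L" using \<open>L > 0\<close> by (auto simp: c_def)
  let ?A = "\<integral>\<^sup>+y. W (fst y) * ennreal ((cmod (?H y))\<^sup>2) \<partial>lborel"
  let ?U = "\<integral>\<^sup>+y. Wi (fst y) * ennreal ((cmod (u y))\<^sup>2) \<partial>lborel"
  let ?P = "\<integral>\<^sup>+y. Wi (fst y) * ennreal ((cmod (complex_of_real (\<eta> (snd y)) * F y))\<^sup>2) \<partial>lborel"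
  let ?Q = "\<integral>\<^sup>+y. Wi (fst y) * ennreal ((cmod (\<i> * complex_of_real (deriv \<eta> (snd y)) * u y))\<^sup>2) \<partial>lborel"
  have Q: "?Q \<le> ennreal (B\<^sup>2) * ?U"
  proof -
    have "?Q \<le> (\<integral>\<^sup>+y. ennreal (B\<^sup>2) * (Wi (fst y) * ennreal ((cmod (u y))\<^sup>2)) \<partial>lborel)"
    proof (rule nn_integral_mono)
      fix y :: "'a \<times> real"
      have "(deriv \<eta> (snd y))\<^sup>2 \<le> B\<^sup>2"
        using d_le \<open>B \<ge> 0\<close> by (simp add: abs_le_square_iff[symmetric])
      then have "(cmod (\<i> * complex_of_real (deriv \<eta> (snd y)) * u y))\<^sup>2 \<le> B\<^sup>2 * (cmod (u y))\<^sup>2"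
        by (auto simp: norm_mult power_mult_distrib intro: mult_right_mono)
      then have "Wi (fst y) * ennreal ((cmod (\<i> * complex_of_real (deriv \<eta> (snd y)) * u y))\<^sup>2) \<le> Wi (fst y) * ennreal (B\<^sup>2 * (cmod (u y))\<^sup>2)"
        by (intro mult_left_mono ennreal_leI) auto
      also have "\<dots> = ennreal (B\<^sup>2) * (Wi (fst y) * ennreal ((cmod (u y))\<^sup>2))"
        by (simp add: ennreal_mult mult.left_commute)
      finally show "Wi (fst y) * ennreal ((cmod (\<i> * complex_of_real (deriv \<eta> (snd y)) * u y))\<^sup>2) \<le> ennreal (B\<^sup>2) * (Wi (fst y) * ennreal ((cmod (u y))\<^sup>2))" .
    qed
    then show ?thesis by (subst nn_integral_cmult[symmetric]) auto
  qed
  have "?A \<le> 4 * ennreal (1 / 32) * (\<integral>\<^sup>+y. Wi (fst y) * ennreal ((cmod (source \<eta> y))\<^sup>2) \<partial>lborel)"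
  proof (rule fourier_transfer[OF H G c(1) W_measurable])
    show "complex_of_real (\<eta> (snd (x, t))) * u (x, t) = 0" if "t \<notin> {- (pi * c / 2)..pi * c / 2}" for x t
      using supp[of t] that unfolding c(2) by simp
    show "source \<eta> (x, t) = 0" if "t \<notin> {- (pi * c / 2)..pi * c / 2}" for x t
      using supp[of t] d_supp[of t] that unfolding c(2) by (simp add: source_def)
    show "(\<integral>\<^sup>+x. W x * ennreal ((cmod (fourier (\<lambda>t. complex_of_real (\<eta> (snd (x, t))) * u (x, t)) \<tau>))\<^sup>2) \<partial>lborel) \<le>
        ennreal (1 / 32) * (\<integral>\<^sup>+x. Wi x * ennreal ((cmod (fourier (\<lambda>t. source \<eta> (x, t)) \<tau>))\<^sup>2) \<partial>lborel)" for \<tau>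
      using frequency_estimate[OF \<eta>, of \<tau>] by simp
  qed
  also have "\<dots> \<le> 4 * ennreal (1 / 32) * (2 * ?P + 2 * ?Q)"
    unfolding source_def by (intro mult_left_mono nn_integral_weight_add_le) auto
  also have "\<dots> = ennreal (1 / 4) * ?P + ennreal (1 / 4) * ?Q"
  proof -
    have "4 * ennreal (1 / 32) * 2 = ennreal (4 * (1 / 32) * 2)"
      by (simp only: ennreal_mult'' ennreal_numeral zero_le_numeral)
    then have "4 * ennreal (1 / 32) * 2 = ennreal (1 / 4)" by simp
    then show ?thesis by (simp only: distrib_left mult.assoc[symmetric])
  qed
  finally have A1: "?A \<le> ennreal (1 / 4) * ?P + ennreal (1 / 4) * ?Q" .
  have "?P \<le> (\<integral>\<^sup>+y. Wi (fst y) * ennreal ((cmod (F y))\<^sup>2) \<partial>lborel)"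
    using \<eta>_le by (intro nn_integral_mono mult_left_mono ennreal_leI power_mono)
      (auto simp: norm_mult intro: mult_left_le_one_le)
  then have P_fin: "?P < \<infinity>" using F_fin by (rule le_less_trans)
  have "ennreal (B\<^sup>2) * ?U < \<infinity>" using u_fin by (simp add: ennreal_mult_less_top)
  with Q have Q_fin: "?Q < \<infinity>" by (rule le_less_trans)
  have "?P \<le> ?A"
  proof (rule nn_integral_mono_AE)
    show "AE y in lborel. Wi (fst y) * ennreal ((cmod (complex_of_real (\<eta> (snd y)) * F y))\<^sup>2) \<le>
        W (fst y) * ennreal ((cmod (complex_of_real (\<eta> (snd y)) * u y))\<^sup>2)"
      using F_le
    proof eventually_elim
      case (elim y)
      show ?case
      \<comment> \<open>On the zero set of the potential the inverse weight is infinite, but there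
        \<open>F\<close> vanishes, and \<open>\<infinity> * 0 = 0\<close>.\<close>
      proof (cases "V0 (fst y) = 0")
        case True
        then have "F y = 0" using elim by simp
        then show ?thesis by simp
      next
        case False
        let ?v = "cmod (V0 (fst y))"
        have v: "?v > 0" using False by simp
        have "(cmod (complex_of_real (\<eta> (snd y)) * F y))\<^sup>2 \<le> ?v\<^sup>2 * (cmod (?H y))\<^sup>2"
        proof -
          have "cmod (complex_of_real (\<eta> (snd y)) * F y) \<le> ?v * cmod (?H y)"
            using mult_left_mono[OF elim, of "\<bar>\<eta> (snd y)\<bar>"] by (simp add: norm_mult mult_ac)
          then show ?thesis by (metis norm_ge_zero power_mono power_mult_distrib)
        qed
        then have "Wi (fst y) * ennreal ((cmod (complex_of_real (\<eta> (snd y)) * F y))\<^sup>2) \<le> Wi (fst y) * ennreal (?v\<^sup>2 * (cmod (?H y))\<^sup>2)"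
          by (intro mult_left_mono ennreal_leI) auto
        also have "\<dots> = ennreal (inverse ?v * (?v\<^sup>2 * (cmod (?H y))\<^sup>2))"
          using v by (simp add: inverse_ennreal flip: ennreal_mult)
        also have "inverse ?v * (?v\<^sup>2 * (cmod (?H y))\<^sup>2) = ?v * (cmod (?H y))\<^sup>2"
          using v by (simp add: power2_eq_square)
        also have "ennreal (?v * (cmod (?H y))\<^sup>2) = W (fst y) * ennreal ((cmod (?H y))\<^sup>2)"
          by (simp add: ennreal_mult)
        finally show ?thesis .
      qed
    qed
  qed
  \<comment> \<open>No integrability of \<open>u\<close> against \<open>|V|\<close> was assumed; it
    is a consequence of the unabsorbed estimate, and allows \<open>?A\<close> to be
    cancelled.\<close>
  have "?A < \<infinity>"
    by (rule le_less_trans[OF A1]) (use P_fin Q_fin in \<open>auto simp: ennreal_mult_less_top\<close>)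
  have "?A \<le> ?Q"
  proof -
    obtain a where a: "?A = ennreal a" "a \<ge> 0" using \<open>?A < \<infinity>\<close> by (cases ?A) auto
    obtain q where q: "?Q = ennreal q" "q \<ge> 0" using Q_fin by (cases ?Q) auto
    have "ennreal a \<le> ennreal (1 / 4) * ennreal a + ennreal (1 / 4) * ennreal q"
      using A1 mult_left_mono[OF \<open>?P \<le> ?A\<close>, of "ennreal (1 / 4)"] unfolding a q
      by (meson add_right_mono order_trans zero_le)
    also have "\<dots> = ennreal (a / 4 + q / 4)" using a q by (simp flip: ennreal_mult ennreal_plus)
    finally have "a \<le> q" using a q by (subst (asm) ennreal_le_iff) auto
    then show ?thesis unfolding a q by (rule ennreal_leI)
  qed
  then show ?thesis using Q by (rule order_trans)
qed

end

section \<open>Growing cutoffs in time\<close>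

text \<open>A positive lower bound on the inner half serves in place of a plateau of height 1. There
  both factors are values of \<open>flat 1\<close> at points at least 1/2, hence at least
  \<open>exp (- 2)\<close>.\<close>

lemma smooth_cutoff:
  obtains \<eta> :: "real \<Rightarrow> real" where "test_function \<eta>" "\<And>t. t \<notin> {- 1..1} \<Longrightarrow> \<eta> t = 0"
    "\<And>t. \<bar>\<eta> t\<bar> \<le> 1" "\<And>t. \<bar>t\<bar> \<le> 1 / 2 \<Longrightarrow> exp (- 4) \<le> \<eta> t"
proof -
  define \<eta> where "\<eta> t = flat 1 (t + 1) * flat 1 (- t + 1)" for t :: real
  have flat_le: "0 \<le> flat 1 t \<and> flat 1 t \<le> 1" for t by (simp add: flat_1)
  have flat_ge: "exp (- 2) \<le> flat 1 t" if "t \<ge> 1 / 2" for t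
    using that by (simp add: flat_1 field_simps)
  have supp: "\<eta> t = 0" if "t \<notin> {- 1..1}" for t
    using that by (auto simp: \<eta>_def flat_1)
  have "Ck k \<eta>" for k
    unfolding \<eta>_def
    by (intro Ck_mult Ck_compose_affine[OF Ck_flat] bounded_linear_ident bounded_linear_minus)
  then have "test_function \<eta>" by (rule test_functionI[where K = "{- 1..1}"]) (use supp in auto)
  moreover note supp
  moreover have "\<bar>\<eta> t\<bar> \<le> 1" for t
    using flat_le[of "t + 1"] flat_le[of "- t + 1"] by (simp add: \<eta>_def abs_mult mult_le_one)
  moreover have "exp (- 4) \<le> \<eta> t" if "\<bar>t\<bar> \<le> 1 / 2" for t
  proof -
    have "exp (- 4) = exp (- 2) * exp (- 2 :: real)" by (simp flip: exp_add)
    also have "\<dots> \<le> \<eta> t" unfolding \<eta>_def using that by (intro mult_mono flat_ge) (auto simp: flat_le abs_le_iff)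
    finally show ?thesis .
  qed
  ultimately show ?thesis by (rule that)
qed

lemma test_function_scale:
  fixes \<eta> :: "real \<Rightarrow> real"
  assumes \<eta>: "test_function \<eta>" and "n > 0"
  shows "test_function (\<lambda>t. \<eta> (t / n))" "deriv (\<lambda>t. \<eta> (t / n)) t = deriv \<eta> (t / n) / n"
proof -
  obtain R where R: "\<And>t. t \<notin> cball 0 R \<Longrightarrow> \<eta> t = 0" using test_functionD[OF \<eta>] by blast
  have "Ck k (\<lambda>t. \<eta> (t / n + 0))" for k
    using \<eta> by (intro Ck_compose_affine bounded_linear_divide) (simp add: test_function_def)
  then show "test_function (\<lambda>t. \<eta> (t / n))"
    by (intro test_functionI[where K = "cball 0 (n * R)"]) (use R \<open>n > 0\<close> in \<open>auto simp: field_simps\<close>)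
  have "((\<lambda>t. \<eta> (t / n)) has_real_derivative deriv \<eta> (t / n) * (1 / n)) (at t)"
    by (rule DERIV_chain2[OF test_function_has_real_derivative[OF \<eta>]])
       (use \<open>n > 0\<close> in \<open>auto intro!: derivative_eq_intros\<close>)
  then show "deriv (\<lambda>t. \<eta> (t / n)) t = deriv \<eta> (t / n) / n"
    by (simp add: DERIV_imp_deriv)
qed

text \<open>Stretching the cutoff by \<open>n\<close> makes its derivative at most
  \<open>D / n\<close>. The weighted mass in \<open>|t| \<le> R\<close> is therefore at most a
  constant over \<open>n^2\<close> as soon as \<open>n \<ge> 2 R\<close>, which keeps
  \<open>|t / n| \<le> 1 / 2\<close>; so it is 0.\<close>

lemma (in schroedinger_resolvent) u_AE_zero:
  assumes "AE y in lborel. V0 (fst (y :: 'a \<times> real)) \<noteq> 0"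
  shows "AE y in lborel. u y = 0"
proof -
  obtain \<eta> :: "real \<Rightarrow> real" where \<eta>: "test_function \<eta>" "\<And>t. t \<notin> {- 1..1} \<Longrightarrow> \<eta> t = 0"
    "\<And>t. \<bar>\<eta> t\<bar> \<le> 1" "\<And>t. \<bar>t\<bar> \<le> 1 / 2 \<Longrightarrow> exp (- 4) \<le> \<eta> t"
    using smooth_cutoff by blast
  obtain D where D: "\<And>t. \<bar>deriv \<eta> t\<bar> \<le> D"
    using test_function_bounded[OF test_function_deriv[OF \<eta>(1)]] by blast
  have um [measurable]: "u \<in> borel_measurable lborel" using u by (simp add: L2_def)
  have [measurable]: "(\<lambda>y::'a \<times> real. W (fst y)) \<in> borel_measurable lborel"
    "(\<lambda>y::'a \<times> real. indicator {- R..R} (snd y) :: ennreal) \<in> borel_measurable lborel" for R :: real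
    unfolding lborel_prod[symmetric] by measurable
  obtain r where r: "(\<integral>\<^sup>+y. Wi (fst y) * ennreal ((cmod (u y))\<^sup>2) \<partial>lborel) = ennreal r" "r \<ge> 0"
    using u_fin by (cases "\<integral>\<^sup>+y. Wi (fst y) * ennreal ((cmod (u y))\<^sup>2) \<partial>lborel") auto
  let ?E = "\<lambda>R. \<integral>\<^sup>+y. W (fst y) * ennreal ((cmod (u y))\<^sup>2) * indicator {- R..R} (snd y) \<partial>lborel"
  have E_le: "ennreal ((exp (- 4))\<^sup>2) * ?E R \<le> ennreal (D\<^sup>2 * r * (inverse (real n) * inverse (real n)))"
    if n: "n > 0" "2 * R \<le> real n" for R n
  proof -
    let ?\<eta> = "\<lambda>t. \<eta> (t / real n)"
    have n0: "real n > 0" using n by simp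
    have "ennreal ((exp (- 4))\<^sup>2) * ?E R =
        (\<integral>\<^sup>+y. ennreal ((exp (- 4))\<^sup>2) * (W (fst y) * ennreal ((cmod (u y))\<^sup>2) * indicator {- R..R} (snd y)) \<partial>lborel)"
      by (rule nn_integral_cmult[symmetric]) measurable
    also have "\<dots> \<le> (\<integral>\<^sup>+y. W (fst y) * ennreal ((cmod (complex_of_real (?\<eta> (snd y)) * u y))\<^sup>2) \<partial>lborel)"
    proof (rule nn_integral_mono)
      fix y :: "'a \<times> real"
      show "ennreal ((exp (- 4))\<^sup>2) * (W (fst y) * ennreal ((cmod (u y))\<^sup>2) * indicator {- R..R} (snd y)) \<le>
          W (fst y) * ennreal ((cmod (complex_of_real (?\<eta> (snd y)) * u y))\<^sup>2)"
      proof (cases "snd y \<in> {- R..R}")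
        case True
        then have "\<bar>snd y\<bar> \<le> R" by auto
        then have "\<bar>snd y / real n\<bar> \<le> 1 / 2" using n n0 by (simp add: field_simps)
        from \<eta>(4)[OF this] have "(exp (- 4))\<^sup>2 \<le> (?\<eta> (snd y))\<^sup>2" by (intro power_mono) auto
        then have "(exp (- 4))\<^sup>2 * (cmod (u y))\<^sup>2 \<le> (cmod (complex_of_real (?\<eta> (snd y)) * u y))\<^sup>2"
          unfolding norm_mult power_mult_distrib by (intro mult_right_mono) auto
        then have "ennreal ((exp (- 4))\<^sup>2) * ennreal ((cmod (u y))\<^sup>2) \<le> ennreal ((cmod (complex_of_real (?\<eta> (snd y)) * u y))\<^sup>2)"
          by (simp add: ennreal_leI flip: ennreal_mult)
        then have "W (fst y) * (ennreal ((exp (- 4))\<^sup>2) * ennreal ((cmod (u y))\<^sup>2)) \<le>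
            W (fst y) * ennreal ((cmod (complex_of_real (?\<eta> (snd y)) * u y))\<^sup>2)"
          by (rule mult_left_mono) simp
        then show ?thesis using True by (simp add: mult.left_commute)
      qed simp
    qed
    also have "\<dots> \<le> ennreal ((D / real n)\<^sup>2) * ennreal r"
      unfolding r(1)[symmetric]
    proof (rule cutoff_estimate[OF test_function_scale(1)[OF \<eta>(1) n0] n0])
      show "?\<eta> t = 0" if "t \<notin> {- real n..real n}" for t
        using that n0 by (intro \<eta>(2)) (auto simp: field_simps)
      show "\<bar>deriv ?\<eta> t\<bar> \<le> D / real n" for t
        using D[of "t / real n"] n0 by (simp add: test_function_scale(2)[OF \<eta>(1) n0] divide_right_mono)
    qed (rule \<eta>(3))
    also have "\<dots> = ennreal (D\<^sup>2 * r * (inverse (real n) * inverse (real n)))"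
      unfolding ennreal_mult[OF zero_le_power2 r(2), symmetric]
      by (simp add: power2_eq_square divide_inverse mult_ac)
    finally show ?thesis .
  qed
  have E0: "?E R = 0" for R
  proof -
    have "(\<lambda>n. ennreal (D\<^sup>2 * r * (inverse (real n) * inverse (real n)))) \<longlonglongrightarrow> ennreal (D\<^sup>2 * r * (0 * 0))"
      by (intro tendsto_ennrealI tendsto_intros lim_inverse_n)
    moreover obtain N :: nat where "2 * R \<le> real N" using real_arch_simple by blast
    then have "\<exists>N. \<forall>n\<ge>N. ennreal ((exp (- 4))\<^sup>2) * ?E R \<le> ennreal (D\<^sup>2 * r * (inverse (real n) * inverse (real n)))"
      by (intro exI[of _ "max 1 N"] allI impI E_le) auto
    ultimately have "ennreal ((exp (- 4))\<^sup>2) * ?E R \<le> ennreal (D\<^sup>2 * r * (0 * 0))"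
      by (rule LIMSEQ_le_const)
    then show ?thesis by simp
  qed
  \<comment> \<open>Countably many time intervals exhaust space-time, so a common null set works for
    all of them.\<close>
  have "AE y in lborel. \<forall>R::nat. W (fst y) * ennreal ((cmod (u y))\<^sup>2) * indicator {- real R..real R} (snd y) = 0"
    unfolding AE_all_countable
  proof
    fix R :: nat
    show "AE y in lborel. W (fst y) * ennreal ((cmod (u y))\<^sup>2) * indicator {- real R..real R} (snd y) = 0"
      using E0[of "real R"] by (subst (asm) nn_integral_0_iff_AE) auto
  qed
  then show ?thesis
    using assms
  proof eventually_elim
    case (elim y)
    obtain R :: nat where "\<bar>snd y\<bar> \<le> real R" using real_arch_simple by blast
    then have "indicator {- real R..real R} (snd y) = (1 :: ennreal)" by (auto simp: indicator_def)
    then have "W (fst y) * ennreal ((cmod (u y))\<^sup>2) = 0" using elim(1) by (metis mult.right_neutral)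
    then show ?case using elim(2) by simp
  qed
qed

section \<open>From Borel representatives to the original solution\<close>

text \<open>The cylinder over a null set has measure \<open>0 * \<infinity> = 0\<close>.\<close>

lemma AE_lborel_fst:
  assumes "AE x in lborel. P (x::'a::euclidean_space)"
  shows "AE y in (lborel :: ('a \<times> 'b::euclidean_space) measure). P (fst y)"
proof -
  obtain N where N: "{x. \<not> P x} \<subseteq> N" "N \<in> null_sets lborel"
    using assms by (auto elim!: AE_E simp: null_sets_def)
  have "emeasure (lborel \<Otimes>\<^sub>M lborel) (N \<times> (UNIV :: 'b set)) = emeasure lborel N * emeasure lborel (UNIV :: 'b set)"
    using N(2) by (intro sigma_finite_measure.emeasure_pair_measure_Times[OF sigma_finite_lborel]) auto
  then have "N \<times> (UNIV :: 'b set) \<in> null_sets (lborel \<Otimes>\<^sub>M lborel)"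
    using N(2) by (auto simp: null_sets_def)
  then show ?thesis
    unfolding lborel_prod by (rule AE_I'[of _ lborel, unfolded space_lborel]) (use N(1) in auto)
qed

text \<open>Completeness of Lebesgue measure. It yields measurability on space-time of
  \<open>V\<close> composed with \<open>fst\<close>, by comparison with a Borel version of
  \<open>V\<close>.\<close>

lemma measurable_lebesgue_AE:
  fixes f g :: "'a::euclidean_space \<Rightarrow> complex"
  assumes g: "g \<in> borel_measurable lebesgue" and "AE x in lebesgue. f x = g x"
  shows "f \<in> borel_measurable lebesgue"
proof (rule measurableI)
  fix A :: "complex set" assume "A \<in> sets borel"
  obtain N where N: "{x. f x \<noteq> g x} \<subseteq> N" "N \<in> null_sets lebesgue"
    using assms(2) by (auto elim!: AE_E simp: null_sets_def)
  have "f -` A \<inter> N \<in> sets lebesgue"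
    using null_sets_completion_subset[OF _ N(2), of "f -` A \<inter> N"] by (auto simp: null_sets_def)
  moreover have "g -` A - N \<in> sets lebesgue"
    using measurable_sets[OF g \<open>A \<in> sets borel\<close>] N(2) by (auto simp: null_sets_def)
  moreover have "f -` A \<inter> space lebesgue = (g -` A - N) \<union> (f -` A \<inter> N)" using N(1) by auto
  ultimately show "f -` A \<inter> space lebesgue \<in> sets lebesgue" by (simp only: sets.Un)
qed auto

theorem schroedinger_inequality_global_vanishing:
  fixes V :: "'a::euclidean_space \<Rightarrow> complex" and u :: "'a \<times> real \<Rightarrow> complex"
  assumes V: "V \<in> borel_measurable lebesgue" and est: "resolvent_estimate V C" and C: "C \<le> 1 / 8"
    and V_nonzero: "AE x in lebesgue. V x \<noteq> 0"
    and u: "u \<in> H1_t (sol_L2 V) \<inter> H2_x (sol_L2 V)"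
    and ineq: "schroedinger_ineq V u"
  shows "AE y in lebesgue. u y = 0"
proof -
  obtain V0 where V0: "V0 \<in> borel_measurable borel" "AE x in lebesgue. V x = V0 x"
    using lebesgue_borel_representative[OF V] by blast
  have V_fst: "AE y in lborel. V (fst (y :: 'a \<times> real)) = V0 (fst y)"
    using V0(2) unfolding AE_completion_iff by (rule AE_lborel_fst)
  have V0_fst: "(\<lambda>y. V0 (fst (y :: 'a \<times> real))) \<in> borel_measurable borel"
    using V0(1) unfolding borel_prod[symmetric] by measurable
  have Vm [measurable]: "(\<lambda>y. V (fst (y :: 'a \<times> real))) \<in> borel_measurable lebesgue"
    by (rule measurable_lebesgue_AE[of "\<lambda>y. V0 (fst y)"])
       (use V_fst V0_fst in \<open>auto simp: AE_completion_iff measurable_completion\<close>)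
  let ?X = "sol_L2 V"
  let ?dx = "\<lambda>b::'a. (b, 0::real)"
  have weighted: "(\<integral>\<^sup>+y. inverse (ennreal (cmod (V0 (fst y)))) * ennreal ((cmod (f0 y))\<^sup>2) \<partial>lborel) < \<infinity>"
    if "f \<in> L2 (inv_pot_measure (\<lambda>y. V (fst y)))" "AE y in lebesgue. f y = f0 y" for f f0 :: "'a \<times> real \<Rightarrow> complex"
  proof -
    have "(\<integral>\<^sup>+y. inverse (ennreal (cmod (V (fst y)))) * ennreal ((cmod (f y))\<^sup>2) \<partial>lebesgue) < \<infinity>"
      using that(1) unfolding inv_pot_measure_def by (subst (asm) L2_density_iff) auto
    also have "(\<integral>\<^sup>+y. inverse (ennreal (cmod (V (fst y)))) * ennreal ((cmod (f y))\<^sup>2) \<partial>lebesgue) =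
        (\<integral>\<^sup>+y. inverse (ennreal (cmod (V0 (fst y)))) * ennreal ((cmod (f0 y))\<^sup>2) \<partial>lborel)"
      unfolding nn_integral_completion using that(2) V_fst unfolding AE_completion_iff
      by (intro nn_integral_cong_AE) auto
    finally show ?thesis .
  qed
  have X: "f \<in> L2 lebesgue" "f \<in> L2 (inv_pot_measure (\<lambda>y. V (fst y)))" if "f \<in> ?X" for f
    using that by (auto simp: sol_L2_def)
  have uX: "u \<in> ?X" and ut: "\<exists>g. has_weak_deriv u g time_dir" "wderiv time_dir u \<in> ?X"
    and ux: "\<And>b. b \<in> Basis \<Longrightarrow> \<exists>g. has_weak_deriv u g (?dx b)" "\<And>b. b \<in> Basis \<Longrightarrow> wderiv (?dx b) u \<in> ?X"
    and uxx: "\<And>a b. a \<in> Basis \<Longrightarrow> b \<in> Basis \<Longrightarrow> \<exists>g. has_weak_deriv (wderiv (?dx a) u) g (?dx b)"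
      "\<And>a b. a \<in> Basis \<Longrightarrow> b \<in> Basis \<Longrightarrow> wderiv (?dx b) (wderiv (?dx a) u) \<in> ?X"
    using u by (auto simp: H1_t_def H2_x_def space_dirs_def numeral_2_eq_2)
  \<comment> \<open>A choice depending only on \<open>f\<close>, so that the representative obtained
    as a first derivative is the same function that is differentiated at the second order.\<close>
  define rep where "rep f = (SOME f'. f' \<in> L2 lborel \<and> (AE y in lebesgue. f y = f' y))" for f :: "'a \<times> real \<Rightarrow> complex"
  have rep: "rep f \<in> L2 lborel \<and> (AE y in lebesgue. f y = rep f y)" if "f \<in> ?X" for f
  proof -
    have "\<exists>f'. f' \<in> L2 lborel \<and> (AE y in lebesgue. f y = f' y)"
      using L2_borel_representative[OF X(1)[OF that]] by blast
    then show ?thesis unfolding rep_def by (rule someI_ex)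
  qed
  have rep_weak: "has_weak_deriv (rep f) (rep (wderiv e f)) e"
    if "f \<in> ?X" "wderiv e f \<in> ?X" "\<exists>g. has_weak_deriv f g e" "e \<in> Basis" for f e
    by (rule has_weak_deriv_cong_AE[OF has_weak_deriv_wderiv[OF that(3)]])
       (use rep[OF that(1)] rep[OF that(2)] that(4) in \<open>auto simp: L2_def measurable_completion\<close>)
  have basis: "time_dir \<in> (Basis :: ('a \<times> real) set)" "b \<in> Basis \<Longrightarrow> ?dx b \<in> Basis" for b
    by (auto simp: time_dir_def Basis_prod_def)
  interpret schroedinger_data "rep u" "rep (wderiv time_dir u)" "\<lambda>a. rep (wderiv (?dx a) u)"
    "\<lambda>a b. rep (wderiv (?dx b) (wderiv (?dx a) u))"
  proof
    show "has_weak_deriv (rep u) (rep (wderiv time_dir u)) (0, 1)"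
      using rep_weak[OF uX ut(2,1) basis(1)] by (simp add: time_dir_def)
  qed (use rep uX ut ux uxx in \<open>auto intro!: rep_weak basis\<close>)
  have op_eq: "schroedinger_op u y = \<i> * wderiv time_dir u y + (\<Sum>b\<in>Basis. wderiv (?dx b) (wderiv (?dx b) u) y)" for y
    unfolding schroedinger_op_def space_dirs_def by (subst sum.reindex) (auto simp: inj_on_def)
  have "AE y in lebesgue. \<forall>b\<in>Basis. wderiv (?dx b) (wderiv (?dx b) u) y = rep (wderiv (?dx b) (wderiv (?dx b) u)) y"
    by (rule AE_finite_allI) (use rep uxx in auto)
  then have F_eq: "AE y in lebesgue. schroedinger_op u y = F y"
    using conjunct2[OF rep[OF ut(2)]] by eventually_elim (simp add: op_eq F_def)
  \<comment> \<open>Weighted integrability of \<open>F\<close> comes from the solution space, which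
    places each derivative in \<open>L2\<close> of the inverse weight.\<close>
  have "schroedinger_op u \<in> L2 (inv_pot_measure (\<lambda>y. V (fst y)))"
    unfolding op_eq[abs_def] by (intro L2_add L2_cmult L2_sum X ut uxx) auto
  note F_fin = weighted[OF this F_eq]
  interpret schroedinger_resolvent "rep u" "rep (wderiv time_dir u)" "\<lambda>a. rep (wderiv (?dx a) u)"
    "\<lambda>a b. rep (wderiv (?dx b) (wderiv (?dx a) u))" V V0 C
  proof
    show "AE y in lborel. cmod (F y) \<le> cmod (V0 (fst y) * rep u y)"
      using ineq F_eq conjunct2[OF rep[OF uX]] V_fst unfolding schroedinger_ineq_def AE_completion_iff
      by eventually_elim (auto simp: case_prod_beta)
  qed (use est C V V0 weighted[OF X(2)[OF uX] conjunct2[OF rep[OF uX]]] F_fin in auto)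
  have "AE x in lborel. V x \<noteq> 0" using V_nonzero unfolding AE_completion_iff .
  from AE_lborel_fst[OF this] have "AE y in lborel. V0 (fst (y :: 'a \<times> real)) \<noteq> 0"
    using V_fst by eventually_elim auto
  then have "AE y in lborel. rep u y = 0" by (rule u_AE_zero)
  then show ?thesis
    using conjunct2[OF rep[OF uX]] unfolding AE_completion_iff by eventually_elim auto
qed

theorem theorem1p5:
  fixes R :: "((real ^ 'n) \<Rightarrow> complex) set"
    and br :: "((real ^ 'n) \<Rightarrow> complex) \<Rightarrow> real"
    and c :: "(real ^ 'n) \<times> real"
    and r C_A2 :: real
  assumes "CARD('n) \<ge> 2"
    and "resolvent_type R br"
    and "r > 0"
  shows "\<exists>\<epsilon>>0. \<forall>V u p \<nu>.
           V \<in> R \<longrightarrow>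
           u \<in> H1_t (sol_L2 V) \<inter> H2_x (sol_L2 V) \<longrightarrow>
           schroedinger_ineq V u \<longrightarrow>
           p \<in> sphere c r \<longrightarrow>
           vanishes_outside_near u c r p \<longrightarrow>
           \<nu> = outward_normal c r p \<longrightarrow>
           A2_dir C_A2 (fst \<nu>) (\<lambda>x. ennreal (cmod (V x))) \<longrightarrow>
           br V < \<epsilon> \<longrightarrow>
           vanishes_near u p"
\<comment> \<open>The threshold is an absolute constant: the frame quotient 4 and the two splittings
  turn the square of 1/8 into the factor 1/4.\<close>
proof (intro exI[of _ "1 / 8 :: real"] conjI allI impI)
  fix V :: "(real ^ 'n) \<Rightarrow> complex" and u p \<nu>
  assume V: "V \<in> R" and u: "u \<in> H1_t (sol_L2 V) \<inter> H2_x (sol_L2 V)" and ineq: "schroedinger_ineq V u"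
    and A2: "A2_dir C_A2 (fst \<nu>) (\<lambda>x. ennreal (cmod (V x)))" and small: "br V < 1 / 8"
  have "V \<in> borel_measurable lebesgue" "resolvent_estimate V (br V)"
    using assms(2) V by (auto simp: resolvent_type_def)
  \<comment> \<open>A weight vanishes at most on a null set; applied to \<open>|V|\<close> this
    makes weighted vanishing of \<open>u\<close> actual vanishing.\<close>
  moreover have "AE x in lebesgue. V x \<noteq> 0"
    using A2 by (auto simp: A2_dir_def weight_def elim: eventually_mono)
  ultimately have "AE y in lebesgue. u y = 0"
    using small u ineq by (intro schroedinger_inequality_global_vanishing[of V "br V"]) auto
  then show "vanishes_near u p"
    unfolding vanishes_near_def by (intro exI[of _ UNIV]) auto
qed simp

end
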